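(* For $n\ge1$ let $\mathcal{S}_n=\{k/n:k\in\mathbb{N}\}$ and, on the toy Fock space $T\Phi(n)=T\Phi(\mathcal{S}_n)$, consider the operators $Y_i^{(n)}=a_i^++a_i^-+\sqrt n\,a_i^\circ+\frac1{\sqrt n}a_i^\times$, $i\in\mathbb{N}$. Then: (1) For all $n\ge1$, the family $\{Y_i^{(n)}\}_{i\in\mathbb{N}}$ is a free family (with respect to the vacuum state) of Bernoulli random variables of distribution $\frac1{n+1}\delta_{\frac{n+1}{\sqrt n}}+\frac n{n+1}\delta_0$. (2) For all $t\in\mathbb{R}_+$, the operator $$N_t^{(n)}=\frac1{\sqrt n}\sum_{i=0}^{\lfloor nt\rfloor}Y_i^{(n)}$$ (regarded as an operator on $\Phi$ vanishing on $T\Phi(n)^\perp$) converges strongly, as $n\to\infty$, to the free Poisson process operator $N_t=a_t^++a_t^-+a_t^\circ+a_t^\times$ on $\Phi$.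
   Context: Free Fock space: $\Phi=\mathcal{F}(L^2(\mathbb{R}_+;\mathbb{C}))=\mathbb{C}\Omega\oplus\bigoplus_{m\ge1}L^2(\mathbb{R}_+^m)$ (orthogonal Hilbert sum, $L^2(\mathbb{R}_+)^{\otimes m}=L^2(\mathbb{R}_+^m)$), with vacuum vector $\Omega$, $\|\Omega\|=1$. For real-valued $h\in L^2(\mathbb{R}_+)$, $b\in L^\infty(\mathbb{R}_+)$ and $f_m\in L^2(\mathbb{R}_+^m)$: $a^+(h)\Omega=h$, $a^+(h)f_m=h\otimes f_m$; $a^-(h)\Omega=0$, $(a^-(h)f_m)(x_2,\dots,x_m)=\int h(x)f_m(x,x_2,\dots,x_m)\,dx$ (for $m=1$ this is $(\int hf_1)\Omega$); $a^\circ(b)\Omega=0$, $(a^\circ(b)f_m)(x_1,\dots,x_m)=b(x_1)f_m(x_1,\dots,x_m)$; $a^\times(b)=(\int b)\,\mathrm{Id}$ for integrable $b$. Put $a_t^\varepsilon=a^\varepsilon(\mathbf{1}_{[0,t)})$ for $\varepsilon\in\{+,-,\circ,\times\}$, so $a_t^\times=t\,\mathrm{Id}$. Toy Fock space of $\mathcal{S}_n$: with $\mathbb{N}=\{0,1,2,\dots\}$, put $X_i=\sqrt n\,\mathbf{1}_{[i/n,(i+1)/n)}$. A finite word $\sigma=[\sigma_1,\dots,\sigma_m]$ in $\mathbb{N}$ is adapted if $\sigma_j\neq\sigma_{j+1}$ for all $j$; the empty word is adapted. $X_\sigma=X_{\sigma_1}\otimes\cdots\otimes X_{\sigma_m}$,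 $X_\emptyset=\Omega$. $T\Phi(n)$ is the closed subspace of $\Phi$ with orthonormal basis $\{X_\sigma\}_{\sigma\text{ adapted}}$. The operators $a_i^\varepsilon$ on $T\Phi(n)$ are given, for $\sigma=[\sigma_1,\dots,\sigma_m]$ non-empty adapted, by $a_i^+\Omega=X_i$, $a_i^+X_\sigma=\mathbf{1}_{\sigma_1\ne i}X_{[i,\sigma_1,\dots,\sigma_m]}$; $a_i^-\Omega=0$, $a_i^-X_\sigma=\mathbf{1}_{\sigma_1=i}X_{[\sigma_2,\dots,\sigma_m]}$; $a_i^\circ\Omega=0$, $a_i^\circ X_\sigma=\mathbf{1}_{\sigma_1=i}X_\sigma$; $a_i^\times\Omega=\Omega$, $a_i^\times X_\sigma=\mathbf{1}_{\sigma_1\ne i}X_\sigma$; they are extended by $0$ on $T\Phi(n)^\perp$ to operators on $\Phi$. The vacuum state is $\phi(T)=\langle\Omega,T\Omega\rangle$ on $\mathcal{B}(T\Phi(n))$. A self-adjoint operator $Y$ has distribution $\mu$ (a compactly supported probability measure on $\mathbb{R}$) if $\phi(Y^k)=\int x^k\,d\mu(x)$ for all $k\in\mathbb{N}$. Unital subalgebras $(\mathcal{A}_i)_{i\in I}$ are free if $\phi(b_1\cdots b_m)=0$ for all $m\ge1$ whenever $b_k\in\mathcal{A}_{j(k)}$, $\phi(b_k)=0$ for all $k$, and $j(k)\ne j(k+1)$ for all $1\le k<m$; a family of random variables is free if the unital algebras they generate are free. *)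

theory Defs
  imports "HOL-Probability.Probability"
begin

section \<open>Square-integrable functions\<close>

definition square_integrable :: "'a measure \<Rightarrow> ('a \<Rightarrow> complex) \<Rightarrow> bool" where
  "square_integrable M f \<longleftrightarrow>
     f \<in> borel_measurable M \<and> integrable M (\<lambda>x. (cmod (f x))\<^sup>2)"

lemma square_integrable_zero [simp]: "square_integrable M (\<lambda>_. 0)"
  by (simp add: square_integrable_def)

lemma cmod_add_sq_le: "(cmod (a + b))\<^sup>2 \<le> 2 * ((cmod a)\<^sup>2 + (cmod b)\<^sup>2)"
proof -
  have "(cmod (a + b))\<^sup>2 \<le> (cmod a + cmod b)\<^sup>2"
    by (intro power_mono norm_triangle_ineq) auto
  also have "\<dots> \<le> 2 * ((cmod a)\<^sup>2 + (cmod b)\<^sup>2)"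
    using sum_squares_bound[of "cmod a" "cmod b"] by (simp add: power2_sum)
  finally show ?thesis .
qed

lemma cmod_cnj_mult_le: "cmod (cnj a * b) \<le> (cmod a)\<^sup>2 + (cmod b)\<^sup>2"
proof -
  have "2 * (cmod a * cmod b) \<le> (cmod a)\<^sup>2 + (cmod b)\<^sup>2"
    using sum_squares_bound[of "cmod a" "cmod b"] by (simp add: power2_eq_square)
  moreover have "0 \<le> cmod a * cmod b" by (rule mult_nonneg_nonneg) auto
  ultimately show ?thesis unfolding norm_mult complex_mod_cnj by linarith
qed

lemma square_integrable_add:
  assumes "square_integrable M f" "square_integrable M g"
  shows "square_integrable M (\<lambda>x. f x + g x)"
    and "(\<integral>x. (cmod (f x + g x))\<^sup>2 \<partial>M)
         \<le> 2 * ((\<integral>x. (cmod (f x))\<^sup>2 \<partial>M) + (\<integral>x. (cmod (g x))\<^sup>2 \<partial>M))"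
proof -
  have [measurable]: "f \<in> borel_measurable M" "g \<in> borel_measurable M"
    and i: "integrable M (\<lambda>x. 2 * ((cmod (f x))\<^sup>2 + (cmod (g x))\<^sup>2))"
    using assms by (auto simp: square_integrable_def)
  have j: "integrable M (\<lambda>x. (cmod (f x + g x))\<^sup>2)"
    by (rule Bochner_Integration.integrable_bound[OF i])
       (auto intro!: AE_I2 order_trans[OF cmod_add_sq_le])
  then show "square_integrable M (\<lambda>x. f x + g x)"
    by (simp add: square_integrable_def)
  have "(\<integral>x. (cmod (f x + g x))\<^sup>2 \<partial>M) \<le> (\<integral>x. 2 * ((cmod (f x))\<^sup>2 + (cmod (g x))\<^sup>2) \<partial>M)"
    by (intro integral_mono i j cmod_add_sq_le)
  also have "\<dots> = 2 * ((\<integral>x. (cmod (f x))\<^sup>2 \<partial>M) + (\<integral>x. (cmod (g x))\<^sup>2 \<partial>M))"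
    using assms by (simp add: square_integrable_def)
  finally show "(\<integral>x. (cmod (f x + g x))\<^sup>2 \<partial>M)
         \<le> 2 * ((\<integral>x. (cmod (f x))\<^sup>2 \<partial>M) + (\<integral>x. (cmod (g x))\<^sup>2 \<partial>M))" .
qed

lemma square_integrable_scale:
  assumes "square_integrable M f"
  shows "square_integrable M (\<lambda>x. c * f x)"
    and "(\<integral>x. (cmod (c * f x))\<^sup>2 \<partial>M) = (cmod c)\<^sup>2 * (\<integral>x. (cmod (f x))\<^sup>2 \<partial>M)"
  using assms by (auto simp: square_integrable_def norm_mult power_mult_distrib)

lemma square_integrable_cnj_mult:
  assumes "square_integrable M f" "square_integrable M g"
  shows "integrable M (\<lambda>x. cnj (f x) * g x)"
    and "cmod (\<integral>x. cnj (f x) * g x \<partial>M)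
         \<le> (\<integral>x. (cmod (f x))\<^sup>2 \<partial>M) + (\<integral>x. (cmod (g x))\<^sup>2 \<partial>M)"
proof -
  have [measurable]: "f \<in> borel_measurable M" "g \<in> borel_measurable M"
    and i: "integrable M (\<lambda>x. (cmod (f x))\<^sup>2 + (cmod (g x))\<^sup>2)"
    using assms by (auto simp: square_integrable_def)
  have [measurable]: "(\<lambda>x. cnj (f x)) \<in> borel_measurable M"
    by (intro borel_measurable_continuous_on[OF _ \<open>f \<in> borel_measurable M\<close>] continuous_intros)
  show j: "integrable M (\<lambda>x. cnj (f x) * g x)"
  proof (rule Bochner_Integration.integrable_bound[OF i])
    show "AE x in M. norm (cnj (f x) * g x) \<le> norm ((cmod (f x))\<^sup>2 + (cmod (g x))\<^sup>2)"
      using cmod_cnj_mult_le by auto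
  qed simp
  have "cmod (\<integral>x. cnj (f x) * g x \<partial>M) \<le> (\<integral>x. cmod (cnj (f x) * g x) \<partial>M)"
    by simp
  also have "\<dots> \<le> (\<integral>x. (cmod (f x))\<^sup>2 + (cmod (g x))\<^sup>2 \<partial>M)"
    by (intro integral_mono i integrable_norm j cmod_cnj_mult_le)
  also have "\<dots> = (\<integral>x. (cmod (f x))\<^sup>2 \<partial>M) + (\<integral>x. (cmod (g x))\<^sup>2 \<partial>M)"
    using assms by (simp add: square_integrable_def)
  finally show "cmod (\<integral>x. cnj (f x) * g x \<partial>M)
         \<le> (\<integral>x. (cmod (f x))\<^sup>2 \<partial>M) + (\<integral>x. (cmod (g x))\<^sup>2 \<partial>M)" .
qed


section \<open>The free Fock space\<close>

abbreviation half_line :: "real measure" where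
  "half_line \<equiv> restrict_space lborel {0..}"

text \<open>
  The \<open>m\<close>-fold power of the half line. \<open>half_line_pow 0\<close> is a one-point space of mass 1, so that
  its \<open>L\<^sup>2\<close> space is the vacuum summand.
\<close>

definition half_line_pow :: "nat \<Rightarrow> (nat \<Rightarrow> real) measure" where
  "half_line_pow m = Pi\<^sub>M {..<m} (\<lambda>_. half_line)"

type_synonym fock_fun = "nat \<Rightarrow> (nat \<Rightarrow> real) \<Rightarrow> complex"

definition fock_carrier :: "fock_fun set" where
  "fock_carrier = {f. (\<forall>m. square_integrable (half_line_pow m) (f m)) \<and>
     summable (\<lambda>m. \<integral>x. (cmod (f m x))\<^sup>2 \<partial>half_line_pow m)}"

definition fock_rel :: "fock_fun \<Rightarrow> fock_fun \<Rightarrow> bool" where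
  "fock_rel f g \<longleftrightarrow> f \<in> fock_carrier \<and> g \<in> fock_carrier \<and>
     (\<forall>m. AE x in half_line_pow m. f m x = g m x)"

lemma fock_carrier_zero: "(\<lambda>_ _. 0) \<in> fock_carrier"
  by (simp add: fock_carrier_def)

lemma fock_carrier_add:
  assumes "f \<in> fock_carrier" "g \<in> fock_carrier"
  shows "(\<lambda>m x. f m x + g m x) \<in> fock_carrier"
proof -
  have s: "\<And>m. square_integrable (half_line_pow m) (f m)"
      "\<And>m. square_integrable (half_line_pow m) (g m)"
    and "summable (\<lambda>m. 2 * ((\<integral>x. (cmod (f m x))\<^sup>2 \<partial>half_line_pow m) +
           (\<integral>x. (cmod (g m x))\<^sup>2 \<partial>half_line_pow m)))"
    using assms by (auto simp: fock_carrier_def intro!: summable_add summable_mult)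
  then have "summable (\<lambda>m. \<integral>x. (cmod (f m x + g m x))\<^sup>2 \<partial>half_line_pow m)"
  proof (rule_tac summable_comparison_test')
    show "norm (\<integral>x. (cmod (f m x + g m x))\<^sup>2 \<partial>half_line_pow m)
       \<le> 2 * ((\<integral>x. (cmod (f m x))\<^sup>2 \<partial>half_line_pow m) + (\<integral>x. (cmod (g m x))\<^sup>2 \<partial>half_line_pow m))"
      if "m \<ge> 0" for m
      using square_integrable_add(2)[OF s] by simp
  qed
  then show ?thesis
    using square_integrable_add(1)[OF s] by (simp add: fock_carrier_def)
qed

lemma fock_carrier_scale:
  assumes "f \<in> fock_carrier"
  shows "(\<lambda>m x. c * f m x) \<in> fock_carrier"
proof -
  have s: "\<And>m. square_integrable (half_line_pow m) (f m)"
    and "summable (\<lambda>m. (cmod c)\<^sup>2 * (\<integral>x. (cmod (f m x))\<^sup>2 \<partial>half_line_pow m))"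
    using assms by (auto simp: fock_carrier_def intro!: summable_mult)
  then show ?thesis
    unfolding fock_carrier_def mem_Collect_eq square_integrable_scale(2)[OF s]
    by (blast intro: square_integrable_scale(1))
qed

quotient_type fock = fock_fun / partial: fock_rel
proof (rule part_equivpI)
  show "\<exists>f. fock_rel f f"
    using fock_carrier_zero by (auto simp: fock_rel_def)
  show "symp fock_rel"
    by (rule sympI) (simp add: fock_rel_def eq_commute)
  show "transp fock_rel"
  proof (rule transpI)
    fix f g h assume 1: "fock_rel f g" and 2: "fock_rel g h"
    have "AE x in half_line_pow m. f m x = h m x" for m
    proof -
      have "AE x in half_line_pow m. f m x = g m x" "AE x in half_line_pow m. g m x = h m x"
        using 1 2 by (auto simp: fock_rel_def)
      then show ?thesis by eventually_elim simp
    qed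
    then show "fock_rel f h" using 1 2 by (auto simp: fock_rel_def)
  qed
qed

lemma fock_rel_AE: "fock_rel f g \<Longrightarrow> AE x in half_line_pow m. f m x = g m x"
  by (simp add: fock_rel_def)

lift_definition scale_fock :: "complex \<Rightarrow> fock \<Rightarrow> fock" (infixr "*\<^sub>C" 75)
  is "\<lambda>c f m x. c * f m x"
  unfolding fock_rel_def by (auto intro: fock_carrier_scale)

text \<open>The scalar product is conjugate-linear in its first argument.\<close>

lift_definition cinner_fock :: "fock \<Rightarrow> fock \<Rightarrow> complex" ("\<langle>_,/ _\<rangle>")
  is "\<lambda>f g. \<Sum>m. \<integral>x. cnj (f m x) * g m x \<partial>half_line_pow m"
proof -
  fix f f' g g' assume *: "fock_rel f f'" "fock_rel g g'"
  have "(\<integral>x. cnj (f m x) * g m x \<partial>half_line_pow m)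
      = (\<integral>x. cnj (f' m x) * g' m x \<partial>half_line_pow m)" for m
  proof (rule integral_cong_AE)
    have [measurable]: "f m \<in> borel_measurable (half_line_pow m)" "f' m \<in> borel_measurable (half_line_pow m)"
      "g m \<in> borel_measurable (half_line_pow m)" "g' m \<in> borel_measurable (half_line_pow m)"
      using * by (auto simp: fock_rel_def fock_carrier_def square_integrable_def)
    have [measurable]: "cnj \<in> borel_measurable borel"
      by (intro borel_measurable_continuous_onI continuous_intros)
    show "(\<lambda>x. cnj (f m x) * g m x) \<in> borel_measurable (half_line_pow m)" by measurable
    show "(\<lambda>x. cnj (f' m x) * g' m x) \<in> borel_measurable (half_line_pow m)" by measurable
    show "AE x in half_line_pow m. cnj (f m x) * g m x = cnj (f' m x) * g' m x"
      using fock_rel_AE[OF *(1), of m] fock_rel_AE[OF *(2), of m] by eventually_elim simp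
  qed
  then show "(\<Sum>m. \<integral>x. cnj (f m x) * g m x \<partial>half_line_pow m)
      = (\<Sum>m. \<integral>x. cnj (f' m x) * g' m x \<partial>half_line_pow m)" by simp
qed

instantiation fock :: real_inner
begin

lift_definition zero_fock :: fock is "\<lambda>_ _. 0"
  using fock_carrier_zero by (simp add: fock_rel_def)

lift_definition plus_fock :: "fock \<Rightarrow> fock \<Rightarrow> fock" is "\<lambda>f g m x. f m x + g m x"
proof -
  fix f f' g g' assume *: "fock_rel f f'" "fock_rel g g'"
  have "AE x in half_line_pow m. f m x + g m x = f' m x + g' m x" for m
    using fock_rel_AE[OF *(1), of m] fock_rel_AE[OF *(2), of m] by eventually_elim simp
  then show "fock_rel (\<lambda>m x. f m x + g m x) (\<lambda>m x. f' m x + g' m x)"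
    using * by (auto simp: fock_rel_def fock_carrier_add)
qed

definition uminus_fock :: "fock \<Rightarrow> fock" where "- (F::fock) = (-1) *\<^sub>C F"
definition minus_fock :: "fock \<Rightarrow> fock \<Rightarrow> fock" where "(F::fock) - G = F + - G"
definition scaleR_fock :: "real \<Rightarrow> fock \<Rightarrow> fock" where "r *\<^sub>R (F::fock) = complex_of_real r *\<^sub>C F"
definition inner_fock :: "fock \<Rightarrow> fock \<Rightarrow> real" where "(F::fock) \<bullet> G = Re \<langle>F, G\<rangle>"
definition norm_fock :: "fock \<Rightarrow> real" where "norm (F::fock) = sqrt (F \<bullet> F)"
definition sgn_fock :: "fock \<Rightarrow> fock" where "sgn (F::fock) = inverse (norm F) *\<^sub>R F"
definition dist_fock :: "fock \<Rightarrow> fock \<Rightarrow> real" where "dist (F::fock) G = norm (F - G)"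
definition uniformity_fock :: "(fock \<times> fock) filter" where
  "uniformity_fock = (INF e\<in>{0<..}. principal {(x, y). dist x y < e})"
definition open_fock :: "fock set \<Rightarrow> bool" where
  "open_fock U \<longleftrightarrow> (\<forall>x\<in>U. \<forall>\<^sub>F (x', y) in uniformity. x' = x \<longrightarrow> y \<in> U)"

lemma scale_fock_add_right: "c *\<^sub>C (F + G) = c *\<^sub>C F + c *\<^sub>C (G::fock)"
  by transfer (auto simp: fock_rel_def algebra_simps intro: fock_carrier_add fock_carrier_scale)

lemma scale_fock_add_left: "(c + d) *\<^sub>C F = c *\<^sub>C F + d *\<^sub>C (F::fock)"
  by transfer (auto simp: fock_rel_def distrib_right intro: fock_carrier_add fock_carrier_scale)

lemma scale_fock_scale: "c *\<^sub>C d *\<^sub>C F = (c * d) *\<^sub>C (F::fock)"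
  by transfer (auto simp: fock_rel_def mult.assoc intro: fock_carrier_scale)

lemma scale_fock_one: "1 *\<^sub>C F = (F::fock)"
  by transfer (auto simp: fock_rel_def)

lemma fock_add_assoc: "(F + G) + H = F + (G + H :: fock)"
  by transfer (auto simp: fock_rel_def add.assoc intro: fock_carrier_add)

lemma fock_add_commute: "F + G = G + (F::fock)"
  by transfer (auto simp: fock_rel_def add.commute intro: fock_carrier_add)

lemma fock_add_zero: "0 + F = (F::fock)"
  by transfer (auto simp: fock_rel_def)

lemma fock_add_minus: "- F + F = (0::fock)"
  unfolding uminus_fock_def
  by transfer (auto simp: fock_rel_def fock_carrier_zero)

lemma summable_cinner_aux:
  assumes "f \<in> fock_carrier" "g \<in> fock_carrier"
  shows "summable (\<lambda>m. \<integral>x. cnj (f m x) * g m x \<partial>half_line_pow m)"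
proof (rule summable_comparison_test'[where N = 0])
  show "summable (\<lambda>m. (\<integral>x. (cmod (f m x))\<^sup>2 \<partial>half_line_pow m) + (\<integral>x. (cmod (g m x))\<^sup>2 \<partial>half_line_pow m))"
    using assms by (intro summable_add) (auto simp: fock_carrier_def)
qed (use assms in \<open>auto intro!: square_integrable_cnj_mult simp: fock_carrier_def\<close>)

lemma cinner_fock_add_right: "\<langle>F, G + H\<rangle> = \<langle>F, G\<rangle> + \<langle>F, H\<rangle>"
proof (transfer)
  fix f g h assume "fock_rel f f" "fock_rel g g" "fock_rel h h"
  then have c: "f \<in> fock_carrier" "g \<in> fock_carrier" "h \<in> fock_carrier"
    by (auto simp: fock_rel_def)
  then have "integrable (half_line_pow m) (\<lambda>x. cnj (f m x) * g m x)"
      "integrable (half_line_pow m) (\<lambda>x. cnj (f m x) * h m x)" for m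
    by (auto simp: fock_carrier_def intro!: square_integrable_cnj_mult)
  then show "(\<Sum>m. \<integral>x. cnj (f m x) * (g m x + h m x) \<partial>half_line_pow m)
      = (\<Sum>m. \<integral>x. cnj (f m x) * g m x \<partial>half_line_pow m)
      + (\<Sum>m. \<integral>x. cnj (f m x) * h m x \<partial>half_line_pow m)"
    using c by (simp add: distrib_left suminf_add[OF summable_cinner_aux summable_cinner_aux])
qed

lemma cinner_fock_scale_right: "\<langle>F, c *\<^sub>C G\<rangle> = c * \<langle>F, G\<rangle>"
proof (transfer)
  fix f g c assume "fock_rel f f" "fock_rel g g"
  then have c: "f \<in> fock_carrier" "g \<in> fock_carrier"
    by (auto simp: fock_rel_def)
  have *: "(\<integral>x. cnj (f m x) * (c * g m x) \<partial>half_line_pow m)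
      = c * (\<integral>x. cnj (f m x) * g m x \<partial>half_line_pow m)" for m
    by (simp add: mult.left_commute)
  show "(\<Sum>m. \<integral>x. cnj (f m x) * (c * g m x) \<partial>half_line_pow m)
      = c * (\<Sum>m. \<integral>x. cnj (f m x) * g m x \<partial>half_line_pow m)"
    unfolding * by (rule suminf_mult[OF summable_cinner_aux[OF c]])
qed

lemma cinner_fock_commute: "\<langle>G, F\<rangle> = cnj \<langle>F, G\<rangle>"
proof (transfer)
  fix f g assume "fock_rel f f" "fock_rel g g"
  then have c: "f \<in> fock_carrier" "g \<in> fock_carrier"
    by (auto simp: fock_rel_def)
  have "(\<integral>x. cnj (g m x) * f m x \<partial>half_line_pow m)
      = cnj (\<integral>x. cnj (f m x) * g m x \<partial>half_line_pow m)" for m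
    by (subst Bochner_Integration.integral_cnj[symmetric])
       (simp add: mult.commute del: Bochner_Integration.integral_cnj)
  then show "(\<Sum>m. \<integral>x. cnj (g m x) * f m x \<partial>half_line_pow m)
      = cnj (\<Sum>m. \<integral>x. cnj (f m x) * g m x \<partial>half_line_pow m)"
    using bounded_linear.suminf[OF bounded_linear_cnj summable_cinner_aux[OF c]] by simp
qed

lemma integral_cnj_mult_self:
  "(\<integral>x. cnj (f x) * f x \<partial>M) = complex_of_real (\<integral>x. (cmod (f x))\<^sup>2 \<partial>M)"
proof -
  have "(\<lambda>x. cnj (f x) * f x) = (\<lambda>x. complex_of_real ((cmod (f x))\<^sup>2))"
    by (rule ext) (metis complex_norm_square mult.commute)
  then show ?thesis by (simp only: integral_complex_of_real)
qed

lemma Re_cinner_fock_self: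
  "f \<in> fock_carrier \<Longrightarrow>
     Re (\<Sum>m. \<integral>x. cnj (f m x) * f m x \<partial>half_line_pow m)
     = (\<Sum>m. \<integral>x. (cmod (f m x))\<^sup>2 \<partial>half_line_pow m)"
  unfolding integral_cnj_mult_self
  by (subst suminf_of_real[symmetric]) (auto simp: fock_carrier_def)

lemma cinner_fock_self_nonneg: "0 \<le> Re \<langle>F, F\<rangle>"
proof transfer
  fix f assume "fock_rel f f"
  then have c: "f \<in> fock_carrier" by (auto simp: fock_rel_def)
  then show "0 \<le> Re (\<Sum>m. \<integral>x. cnj (f m x) * f m x \<partial>half_line_pow m)"
    unfolding Re_cinner_fock_self[OF c] by (auto simp: fock_carrier_def intro!: suminf_nonneg)
qed

lemma cinner_fock_self_eq_0: "Re \<langle>F, F\<rangle> = 0 \<longleftrightarrow> F = 0"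
proof transfer
  fix f assume "fock_rel f f"
  then have c: "f \<in> fock_carrier" by (auto simp: fock_rel_def)
  then have "(\<Sum>m. \<integral>x. (cmod (f m x))\<^sup>2 \<partial>half_line_pow m) = 0
     \<longleftrightarrow> (\<forall>m. (\<integral>x. (cmod (f m x))\<^sup>2 \<partial>half_line_pow m) = 0)"
    by (intro suminf_eq_zero_iff) (auto simp: fock_carrier_def)
  also have "\<dots> \<longleftrightarrow> (\<forall>m. AE x in half_line_pow m. f m x = 0)"
  proof (rule all_cong1)
    fix m
    have "integrable (half_line_pow m) (\<lambda>x. (cmod (f m x))\<^sup>2)"
      using c by (auto simp: fock_carrier_def square_integrable_def)
    then show "((\<integral>x. (cmod (f m x))\<^sup>2 \<partial>half_line_pow m) = 0)
       = (AE x in half_line_pow m. f m x = 0)"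
      by (subst integral_nonneg_eq_0_iff_AE) auto
  qed
  finally show "Re (\<Sum>m. \<integral>x. cnj (f m x) * f m x \<partial>half_line_pow m) = 0
     \<longleftrightarrow> fock_rel f (\<lambda>_ _. 0)"
    unfolding Re_cinner_fock_self[OF c] using c by (simp add: fock_rel_def fock_carrier_zero)
qed

instance
proof
  fix F G H :: fock and a b :: real
  show "F + G + H = F + (G + H)" by (rule fock_add_assoc)
  show "F + G = G + F" by (rule fock_add_commute)
  show "0 + F = F" by (rule fock_add_zero)
  show "- F + F = 0" by (rule fock_add_minus)
  show "F - G = F + - G" by (rule minus_fock_def)
  show "a *\<^sub>R (F + G) = a *\<^sub>R F + a *\<^sub>R G"
    by (simp add: scaleR_fock_def scale_fock_add_right)
  show "(a + b) *\<^sub>R F = a *\<^sub>R F + b *\<^sub>R F"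
    by (simp add: scaleR_fock_def scale_fock_add_left)
  show "a *\<^sub>R b *\<^sub>R F = (a * b) *\<^sub>R F"
    by (simp add: scaleR_fock_def scale_fock_scale)
  show "1 *\<^sub>R F = F" by (simp add: scaleR_fock_def scale_fock_one)
  show "dist F G = norm (F - G)" by (rule dist_fock_def)
  show "uniformity = (INF e\<in>{0<..}. principal {(x, y). dist (x::fock) y < e})"
    by (rule uniformity_fock_def)
  show "open U = (\<forall>x\<in>U. \<forall>\<^sub>F (x', y) in uniformity. x' = x \<longrightarrow> y \<in> U)" for U :: "fock set"
    by (rule open_fock_def)
  show "sgn F = inverse (norm F) *\<^sub>R F" by (rule sgn_fock_def)
  show "F \<bullet> G = G \<bullet> F"
    unfolding inner_fock_def by (subst cinner_fock_commute) simp
  show "(F + G) \<bullet> H = F \<bullet> H + G \<bullet> H"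
    unfolding inner_fock_def
    by (subst (1 2 3) cinner_fock_commute) (simp add: cinner_fock_add_right)
  show "(a *\<^sub>R F) \<bullet> G = a * (F \<bullet> G)"
    unfolding inner_fock_def scaleR_fock_def
    by (subst (1 2) cinner_fock_commute) (simp add: cinner_fock_scale_right)
  show "0 \<le> F \<bullet> F" unfolding inner_fock_def by (rule cinner_fock_self_nonneg)
  show "F \<bullet> F = 0 \<longleftrightarrow> F = 0" unfolding inner_fock_def by (rule cinner_fock_self_eq_0)
  show "norm F = sqrt (F \<bullet> F)" by (rule norm_fock_def)
qed

end

interpretation fock: vector_space scale_fock
  by unfold_locales
    (auto simp: scale_fock_add_right scale_fock_add_left scale_fock_scale scale_fock_one)


section \<open>Creation, annihilation and gauge operators\<close>

definition pt_cons :: "nat \<Rightarrow> real \<Rightarrow> (nat \<Rightarrow> real) \<Rightarrow> nat \<Rightarrow> real" where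
  "pt_cons m x w = (\<lambda>i\<in>{..<Suc m}. case i of 0 \<Rightarrow> x | Suc j \<Rightarrow> w j)"

definition pt_tl :: "nat \<Rightarrow> (nat \<Rightarrow> real) \<Rightarrow> nat \<Rightarrow> real" where
  "pt_tl m y = (\<lambda>i\<in>{..<m}. y (Suc i))"

definition real_L2 :: "(real \<Rightarrow> real) \<Rightarrow> bool" where
  "real_L2 h \<longleftrightarrow> h \<in> borel_measurable half_line \<and> integrable half_line (\<lambda>x. (h x)\<^sup>2)"

definition real_Linf :: "(real \<Rightarrow> real) \<Rightarrow> bool" where
  "real_Linf b \<longleftrightarrow> b \<in> borel_measurable half_line \<and> (\<exists>C. AE x in half_line. \<bar>b x\<bar> \<le> C)"

definition tensor_fun :: "(real \<Rightarrow> real) \<Rightarrow> fock_fun \<Rightarrow> fock_fun" where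
  "tensor_fun h f m y =
     (case m of 0 \<Rightarrow> 0 | Suc k \<Rightarrow> complex_of_real (h (y 0)) * f k (pt_tl k y))"

definition annihilate_fun :: "(real \<Rightarrow> real) \<Rightarrow> fock_fun \<Rightarrow> fock_fun" where
  "annihilate_fun h f m w =
     (\<integral>x. complex_of_real (h x) * f (Suc m) (pt_cons m x w) \<partial>half_line)"

definition gauge_fun :: "(real \<Rightarrow> real) \<Rightarrow> fock_fun \<Rightarrow> fock_fun" where
  "gauge_fun b f m y = (if m = 0 then 0 else complex_of_real (b (y 0)) * f m y)"

interpretation half_line: sigma_finite_measure half_line
  by (rule sigma_finite_measure_restrict_space[OF sigma_finite_lborel]) simp

interpretation half_line_prod: product_sigma_finite "\<lambda>_::nat. half_line"
  by (simp add: product_sigma_finite_def half_line.sigma_finite_measure_axioms)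

lemma sigma_finite_half_line_pow: "sigma_finite_measure (half_line_pow m)"
proof -
  interpret finite_product_sigma_finite "\<lambda>_::nat. half_line" "{..<m}"
    by standard simp
  show ?thesis unfolding half_line_pow_def by (rule sigma_finite_measure_axioms)
qed

interpretation half_line_pow: sigma_finite_measure "half_line_pow m" for m
  by (rule sigma_finite_half_line_pow)

interpretation half_line_pair: pair_sigma_finite "half_line_pow m" half_line for m ..

lemma measurable_pt_cons [measurable]:
  "(\<lambda>(w, x). pt_cons m x w) \<in> half_line_pow m \<Otimes>\<^sub>M half_line \<rightarrow>\<^sub>M half_line_pow (Suc m)"
  unfolding half_line_pow_def pt_cons_def case_prod_beta
proof (rule measurable_restrict)
  fix i assume "i \<in> {..<Suc m}"
  then show "(\<lambda>p. case i of 0 \<Rightarrow> snd p | Suc j \<Rightarrow> fst p j)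
      \<in> Pi\<^sub>M {..<m} (\<lambda>_. half_line) \<Otimes>\<^sub>M half_line \<rightarrow>\<^sub>M half_line"
    by (cases i) (auto intro!: measurable_compose[OF measurable_fst measurable_component_singleton])
qed

lemma measurable_pt_tl [measurable]: "pt_tl m \<in> half_line_pow (Suc m) \<rightarrow>\<^sub>M half_line_pow m"
  unfolding half_line_pow_def pt_tl_def
  by (rule measurable_restrict) (auto intro!: measurable_component_singleton)

lemma measurable_pt_hd [measurable]: "(\<lambda>y. y 0) \<in> half_line_pow (Suc m) \<rightarrow>\<^sub>M half_line"
  unfolding half_line_pow_def by (auto intro!: measurable_component_singleton)

lemma pt_cons_0 [simp]: "pt_cons m x w 0 = x"
  by (simp add: pt_cons_def)

lemma pt_tl_cons: "w \<in> space (half_line_pow m) \<Longrightarrow> pt_tl m (pt_cons m x w) = w"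
  by (auto simp: pt_cons_def pt_tl_def half_line_pow_def space_PiM PiE_def extensional_def
      restrict_def fun_eq_iff)

lemma half_line_pow_Suc:
  "half_line_pow (Suc m)
   = distr (half_line_pow m \<Otimes>\<^sub>M half_line) (half_line_pow (Suc m)) (\<lambda>(w, x). pt_cons m x w)"
proof (subst (1) half_line_pow_def, rule half_line_prod.PiM_eqI[symmetric])
  fix A assume A: "\<And>i. i \<in> {..<Suc m} \<Longrightarrow> A i \<in> sets half_line"
  have sub: "A i \<subseteq> {0..}" if "i < Suc m" for i
    using sets.sets_into_space[OF A[of i]] that by (auto simp: space_restrict_space)
  have "Pi\<^sub>E {..<Suc m} A \<in> sets (half_line_pow (Suc m))"
    unfolding half_line_pow_def using A by (intro sets_PiM_I_finite) auto
  then have "emeasure (distr (half_line_pow m \<Otimes>\<^sub>M half_line) (half_line_pow (Suc m))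
        (\<lambda>(w, x). pt_cons m x w)) (Pi\<^sub>E {..<Suc m} A)
     = emeasure (half_line_pow m \<Otimes>\<^sub>M half_line)
        ((\<lambda>(w, x). pt_cons m x w) -` (Pi\<^sub>E {..<Suc m} A) \<inter> space (half_line_pow m \<Otimes>\<^sub>M half_line))"
    by (rule emeasure_distr[OF measurable_pt_cons])
  also have "(\<lambda>(w, x). pt_cons m x w) -` (Pi\<^sub>E {..<Suc m} A) \<inter> space (half_line_pow m \<Otimes>\<^sub>M half_line)
     = (Pi\<^sub>E {..<m} (\<lambda>i. A (Suc i))) \<times> A 0"
  proof (intro equalityI subsetI)
    fix p assume p: "p \<in> (\<lambda>(w, x). pt_cons m x w) -` (Pi\<^sub>E {..<Suc m} A) \<inter> space (half_line_pow m \<Otimes>\<^sub>M half_line)"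
    obtain w x where [simp]: "p = (w, x)" by (cases p)
    have 1: "pt_cons m x w i \<in> A i" if "i < Suc m" for i using p that by auto
    have "w j \<in> A (Suc j)" if "j < m" for j using 1[of "Suc j"] that by (simp add: pt_cons_def)
    moreover have "x \<in> A 0" using 1[of 0] by simp
    moreover have "w \<in> extensional {..<m}"
      using p by (auto simp: space_pair_measure half_line_pow_def space_PiM PiE_def)
    ultimately show "p \<in> (Pi\<^sub>E {..<m} (\<lambda>i. A (Suc i))) \<times> A 0" by (auto simp: PiE_def)
  next
    fix p assume p: "p \<in> (Pi\<^sub>E {..<m} (\<lambda>i. A (Suc i))) \<times> A 0"
    obtain w x where [simp]: "p = (w, x)" by (cases p)
    have w: "w \<in> Pi\<^sub>E {..<m} (\<lambda>i. A (Suc i))" and x: "x \<in> A 0" using p by auto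
    have "w \<in> space (half_line_pow m)"
      using w sub by (fastforce simp: half_line_pow_def space_PiM space_restrict_space PiE_iff)
    moreover have "x \<in> space half_line" using x sub[of 0] by (auto simp: space_restrict_space)
    moreover have "pt_cons m x w \<in> Pi\<^sub>E {..<Suc m} A"
      using w x by (auto simp: pt_cons_def PiE_iff split: nat.splits)
    ultimately show "p \<in> (\<lambda>(w, x). pt_cons m x w) -` (Pi\<^sub>E {..<Suc m} A)
        \<inter> space (half_line_pow m \<Otimes>\<^sub>M half_line)"
      by (simp add: space_pair_measure)
  qed
  also have "emeasure (half_line_pow m \<Otimes>\<^sub>M half_line) \<dots>
      = emeasure (half_line_pow m) (Pi\<^sub>E {..<m} (\<lambda>i. A (Suc i))) * emeasure half_line (A 0)"
    unfolding half_line_pow_def using A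
    by (intro half_line.emeasure_pair_measure_Times sets_PiM_I_finite) auto
  also have "emeasure (half_line_pow m) (Pi\<^sub>E {..<m} (\<lambda>i. A (Suc i)))
      = (\<Prod>i<m. emeasure half_line (A (Suc i)))"
    unfolding half_line_pow_def using A by (intro half_line_prod.emeasure_PiM) auto
  also have "\<dots> * emeasure half_line (A 0) = (\<Prod>i<Suc m. emeasure half_line (A i))"
    by (subst prod.lessThan_Suc_shift) (simp add: mult.commute)
  finally show "emeasure (distr (half_line_pow m \<Otimes>\<^sub>M half_line) (half_line_pow (Suc m))
        (\<lambda>(w, x). pt_cons m x w)) (Pi\<^sub>E {..<Suc m} A)
     = (\<Prod>i<Suc m. emeasure half_line (A i))" .
qed (auto simp: half_line_pow_def)

lemma measurable_pt_cons' [measurable]: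
  "(\<lambda>p. pt_cons m (snd p) (fst p)) \<in> half_line_pow m \<Otimes>\<^sub>M half_line \<rightarrow>\<^sub>M half_line_pow (Suc m)"
  using measurable_pt_cons by (simp add: case_prod_beta)

lemma half_line_pow_Suc':
  "half_line_pow (Suc m)
   = distr (half_line_pow m \<Otimes>\<^sub>M half_line) (half_line_pow (Suc m)) (\<lambda>p. pt_cons m (snd p) (fst p))"
  by (rule half_line_pow_Suc[unfolded case_prod_beta'])

lemma AE_half_line_pow_Suc_iff:
  assumes "Measurable.pred (half_line_pow (Suc m)) P"
  shows "(AE y in half_line_pow (Suc m). P y)
     \<longleftrightarrow> (AE p in half_line_pow m \<Otimes>\<^sub>M half_line. P (pt_cons m (snd p) (fst p)))"
  using assms
  by (subst half_line_pow_Suc', intro AE_distr_iff[OF measurable_pt_cons']) (simp add: pred_def)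

lemma integrable_half_line_pow_Suc_iff:
  fixes f :: "(nat \<Rightarrow> real) \<Rightarrow> real"
  assumes "f \<in> borel_measurable (half_line_pow (Suc m))"
  shows "integrable (half_line_pow (Suc m)) f
     \<longleftrightarrow> integrable (half_line_pow m \<Otimes>\<^sub>M half_line) (\<lambda>p. f (pt_cons m (snd p) (fst p)))"
  using assms by (subst half_line_pow_Suc', intro integrable_distr_eq[OF measurable_pt_cons'])

lemma integral_half_line_pow_Suc:
  fixes f :: "(nat \<Rightarrow> real) \<Rightarrow> 'a::{banach, second_countable_topology}"
  assumes "f \<in> borel_measurable (half_line_pow (Suc m))"
  shows "(\<integral>y. f y \<partial>half_line_pow (Suc m))
     = (\<integral>p. f (pt_cons m (snd p) (fst p)) \<partial>(half_line_pow m \<Otimes>\<^sub>M half_line))"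
  using assms by (subst half_line_pow_Suc', intro integral_distr[OF measurable_pt_cons'])

lemma AE_half_line_pow_tl:
  assumes [measurable]: "f \<in> borel_measurable (half_line_pow m)" "g \<in> borel_measurable (half_line_pow m)"
    and "AE w in half_line_pow m. f w = (g w :: complex)"
  shows "AE y in half_line_pow (Suc m). f (pt_tl m y) = g (pt_tl m y)"
proof -
  have "AE p in half_line_pow m \<Otimes>\<^sub>M half_line. f (fst p) = g (fst p)"
  proof (rule half_line_pair.AE_pair_measure)
    show "{p \<in> space (half_line_pow m \<Otimes>\<^sub>M half_line). f (fst p) = g (fst p)}
        \<in> sets (half_line_pow m \<Otimes>\<^sub>M half_line)" by measurable
    show "AE x in half_line_pow m. AE y in half_line. f (fst (x, y)) = g (fst (x, y))"
      using assms(3) by eventually_elim simp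
  qed
  then have "AE p in half_line_pow m \<Otimes>\<^sub>M half_line.
      f (pt_tl m (pt_cons m (snd p) (fst p))) = g (pt_tl m (pt_cons m (snd p) (fst p)))"
    by (rule AE_mp) (auto intro!: AE_I2 simp: space_pair_measure pt_tl_cons)
  moreover have "Measurable.pred (half_line_pow (Suc m)) (\<lambda>y. f (pt_tl m y) = g (pt_tl m y))"
    unfolding pred_def by measurable
  ultimately show ?thesis by (simp add: AE_half_line_pow_Suc_iff)
qed

lemma AE_half_line_pow_cons:
  assumes [measurable]: "f \<in> borel_measurable (half_line_pow (Suc m))"
      "g \<in> borel_measurable (half_line_pow (Suc m))"
    and "AE y in half_line_pow (Suc m). f y = (g y :: complex)"
  shows "AE w in half_line_pow m. AE x in half_line. f (pt_cons m x w) = g (pt_cons m x w)"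
proof -
  have "Measurable.pred (half_line_pow (Suc m)) (\<lambda>y. f y = g y)"
    unfolding pred_def by measurable
  from assms(3)[unfolded AE_half_line_pow_Suc_iff[OF this]]
  show ?thesis by (auto dest: half_line_pair.AE_pair)
qed

lemma tensor_fun_sq:
  assumes h: "real_L2 h" and f: "square_integrable (half_line_pow m) f"
  shows "square_integrable (half_line_pow (Suc m)) (\<lambda>y. complex_of_real (h (y 0)) * f (pt_tl m y))"
    and "(\<integral>y. (cmod (complex_of_real (h (y 0)) * f (pt_tl m y)))\<^sup>2 \<partial>half_line_pow (Suc m))
       = (\<integral>x. (h x)\<^sup>2 \<partial>half_line) * (\<integral>w. (cmod (f w))\<^sup>2 \<partial>half_line_pow m)"
proof -
  have [measurable]: "h \<in> borel_measurable half_line" "f \<in> borel_measurable (half_line_pow m)"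
    and ih: "integrable half_line (\<lambda>x. (h x)\<^sup>2)"
    and if': "integrable (half_line_pow m) (\<lambda>w. (cmod (f w))\<^sup>2)"
    using h f by (auto simp: real_L2_def square_integrable_def)
  let ?g = "\<lambda>y. (cmod (complex_of_real (h (y 0)) * f (pt_tl m y)))\<^sup>2"
  let ?k = "\<lambda>w x. (h x)\<^sup>2 * (cmod (f w))\<^sup>2"
  have meas: "(\<lambda>y. complex_of_real (h (y 0)) * f (pt_tl m y)) \<in> borel_measurable (half_line_pow (Suc m))"
    by measurable
  have meas_k: "case_prod ?k \<in> borel_measurable (half_line_pow m \<Otimes>\<^sub>M half_line)"
    by measurable
  have int_k: "integrable (half_line_pow m \<Otimes>\<^sub>M half_line) (case_prod ?k)"
    by (rule half_line_pair.Fubini_integrable[OF meas_k]) (use ih if' in auto)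
  have meas_g: "?g \<in> borel_measurable (half_line_pow (Suc m))"
    using meas by measurable
  have cong: "?g (pt_cons m (snd p) (fst p)) = case_prod ?k p"
    if "p \<in> space (half_line_pow m \<Otimes>\<^sub>M half_line)" for p
    using that by (auto simp: space_pair_measure pt_tl_cons norm_mult power_mult_distrib)
  have "integrable (half_line_pow m \<Otimes>\<^sub>M half_line) (\<lambda>p. ?g (pt_cons m (snd p) (fst p)))
      \<longleftrightarrow> integrable (half_line_pow m \<Otimes>\<^sub>M half_line) (case_prod ?k)"
    by (rule Bochner_Integration.integrable_cong[OF refl cong])
  then have "integrable (half_line_pow (Suc m)) ?g"
    using int_k integrable_half_line_pow_Suc_iff[OF meas_g] by blast
  with meas show "square_integrable (half_line_pow (Suc m))
      (\<lambda>y. complex_of_real (h (y 0)) * f (pt_tl m y))"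
    by (simp add: square_integrable_def)
  have "(\<integral>y. ?g y \<partial>half_line_pow (Suc m))
      = (\<integral>p. ?g (pt_cons m (snd p) (fst p)) \<partial>(half_line_pow m \<Otimes>\<^sub>M half_line))"
    by (rule integral_half_line_pow_Suc[OF meas_g])
  also have "\<dots> = (\<integral>p. case_prod ?k p \<partial>(half_line_pow m \<Otimes>\<^sub>M half_line))"
    by (rule Bochner_Integration.integral_cong[OF refl cong])
  also have "\<dots> = (\<integral>w. \<integral>x. ?k w x \<partial>half_line \<partial>half_line_pow m)"
    using half_line_pair.integral_fst[OF int_k] by simp
  also have "\<dots> = (\<integral>x. (h x)\<^sup>2 \<partial>half_line) * (\<integral>w. (cmod (f w))\<^sup>2 \<partial>half_line_pow m)"
    by simp
  finally show "(\<integral>y. ?g y \<partial>half_line_pow (Suc m))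
       = (\<integral>x. (h x)\<^sup>2 \<partial>half_line) * (\<integral>w. (cmod (f w))\<^sup>2 \<partial>half_line_pow m)" .
qed

lemma fock_carrier_tensor_fun:
  assumes h: "real_L2 h" and f: "f \<in> fock_carrier"
  shows "tensor_fun h f \<in> fock_carrier"
proof -
  have s: "square_integrable (half_line_pow m) (f m)" for m
    using f by (auto simp: fock_carrier_def)
  have 0: "tensor_fun h f 0 = (\<lambda>_. 0)"
    and S: "tensor_fun h f (Suc m) = (\<lambda>y. complex_of_real (h (y 0)) * f m (pt_tl m y))" for m
    by (auto simp: tensor_fun_def)
  have "square_integrable (half_line_pow m) (tensor_fun h f m)" for m
    by (cases m) (simp_all add: 0 S tensor_fun_sq(1)[OF h s])
  moreover have "summable (\<lambda>m. \<integral>x. (cmod (tensor_fun h f (Suc m) x))\<^sup>2 \<partial>half_line_pow (Suc m))"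
    unfolding S tensor_fun_sq(2)[OF h s]
    using f by (auto simp: fock_carrier_def intro!: summable_mult)
  ultimately show ?thesis
    unfolding fock_carrier_def by (subst (asm) summable_Suc_iff) auto
qed

lemma fock_rel_tensor_fun:
  assumes h: "real_L2 h" and fg: "fock_rel f g"
  shows "fock_rel (tensor_fun h f) (tensor_fun h g)"
proof -
  have c: "f \<in> fock_carrier" "g \<in> fock_carrier" using fg by (auto simp: fock_rel_def)
  have "AE y in half_line_pow m. tensor_fun h f m y = tensor_fun h g m y" for m
  proof (cases m)
    case (Suc k)
    have "AE y in half_line_pow (Suc k). f k (pt_tl k y) = g k (pt_tl k y)"
      using c fock_rel_AE[OF fg]
      by (intro AE_half_line_pow_tl) (auto simp: fock_carrier_def square_integrable_def)
    then show ?thesis unfolding Suc by eventually_elim (simp add: tensor_fun_def)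
  qed (simp add: tensor_fun_def)
  then show ?thesis using c h by (simp add: fock_rel_def fock_carrier_tensor_fun)
qed

lemma norm_integral_mult_sq_le:
  assumes h: "real_L2 h" and p: "square_integrable half_line p"
  shows "(cmod (\<integral>x. complex_of_real (h x) * p x \<partial>half_line))\<^sup>2
     \<le> (1 + (\<integral>x. (h x)\<^sup>2 \<partial>half_line)) * (\<integral>x. (cmod (p x))\<^sup>2 \<partial>half_line)"
proof -
  have [measurable]: "h \<in> borel_measurable half_line" "p \<in> borel_measurable half_line"
    and ih: "integrable half_line (\<lambda>x. (h x)\<^sup>2)"
    and ip: "integrable half_line (\<lambda>x. (cmod (p x))\<^sup>2)"
    using h p by (auto simp: real_L2_def square_integrable_def)
  have i: "integrable half_line (\<lambda>x. \<bar>h x\<bar> * cmod (p x))"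
  proof (rule Bochner_Integration.integrable_bound)
    show "integrable half_line (\<lambda>x. (h x)\<^sup>2 + (cmod (p x))\<^sup>2)" using ih ip by simp
    have "\<bar>h x\<bar> * cmod (p x) \<le> (h x)\<^sup>2 + (cmod (p x))\<^sup>2" for x
      using cmod_cnj_mult_le[of "complex_of_real (h x)" "p x"] by (simp add: norm_mult)
    then show "AE x in half_line. norm (\<bar>h x\<bar> * cmod (p x)) \<le> norm ((h x)\<^sup>2 + (cmod (p x))\<^sup>2)"
      by (intro AE_I2) simp
  qed measurable
  define a where "a = 1 + (\<integral>x. (h x)\<^sup>2 \<partial>half_line)"
  define b where "b = (\<integral>x. (cmod (p x))\<^sup>2 \<partial>half_line)"
  define c where "c = (\<integral>x. \<bar>h x\<bar> * cmod (p x) \<partial>half_line)"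
  have a: "a \<ge> 1" by (simp add: a_def)
  have e: "(c / a * \<bar>h x\<bar> - cmod (p x))\<^sup>2
      = (c / a)\<^sup>2 * (h x)\<^sup>2 - 2 * (c / a) * (\<bar>h x\<bar> * cmod (p x)) + (cmod (p x))\<^sup>2" for x
    by (simp add: power2_eq_square algebra_simps)
  have "0 \<le> (\<integral>x. (c / a * \<bar>h x\<bar> - cmod (p x))\<^sup>2 \<partial>half_line)" by simp
  also have "\<dots> = (c / a)\<^sup>2 * (a - 1) - 2 * (c / a) * c + b"
    unfolding e using ih ip i by (simp add: a_def b_def c_def)
  also have "\<dots> \<le> (c / a)\<^sup>2 * a - 2 * (c / a) * c + b"
    by (intro add_right_mono diff_right_mono mult_left_mono) auto
  also have "\<dots> = b - c\<^sup>2 / a"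
    using a by (simp add: field_simps power2_eq_square)
  finally have "c\<^sup>2 \<le> a * b" using a by (simp add: field_simps)
  moreover have "(cmod (\<integral>x. complex_of_real (h x) * p x \<partial>half_line))\<^sup>2 \<le> c\<^sup>2"
  proof (rule power_mono)
    show "cmod (\<integral>x. complex_of_real (h x) * p x \<partial>half_line) \<le> c"
      unfolding c_def
      using integral_norm_bound[of half_line "\<lambda>x. complex_of_real (h x) * p x"]
      by (simp add: norm_mult)
  qed simp
  ultimately show ?thesis by (simp add: a_def b_def)
qed

lemma annihilate_fun_sq:
  assumes h: "real_L2 h" and f: "square_integrable (half_line_pow (Suc m)) (f (Suc m))"
  shows "square_integrable (half_line_pow m) (annihilate_fun h f m)"
    and "(\<integral>w. (cmod (annihilate_fun h f m w))\<^sup>2 \<partial>half_line_pow m)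
       \<le> (1 + (\<integral>x. (h x)\<^sup>2 \<partial>half_line)) * (\<integral>y. (cmod (f (Suc m) y))\<^sup>2 \<partial>half_line_pow (Suc m))"
proof -
  have [measurable]: "h \<in> borel_measurable half_line"
      "f (Suc m) \<in> borel_measurable (half_line_pow (Suc m))"
    and if': "integrable (half_line_pow (Suc m)) (\<lambda>y. (cmod (f (Suc m) y))\<^sup>2)"
    using h f by (auto simp: real_L2_def square_integrable_def)
  let ?C = "1 + (\<integral>x. (h x)\<^sup>2 \<partial>half_line)"
  let ?k = "\<lambda>w x. (cmod (f (Suc m) (pt_cons m x w)))\<^sup>2"
  have meas_f: "(\<lambda>p. f (Suc m) (pt_cons m (snd p) (fst p)))
      \<in> borel_measurable (half_line_pow m \<Otimes>\<^sub>M half_line)"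
    by measurable
  have meas_f2: "(\<lambda>y. (cmod (f (Suc m) y))\<^sup>2) \<in> borel_measurable (half_line_pow (Suc m))"
    by measurable
  have int_k: "integrable (half_line_pow m \<Otimes>\<^sub>M half_line) (case_prod ?k)"
    using if' unfolding integrable_half_line_pow_Suc_iff[OF meas_f2] by (simp add: case_prod_beta')
  have eq_k: "(\<integral>w. \<integral>x. ?k w x \<partial>half_line \<partial>half_line_pow m)
      = (\<integral>y. (cmod (f (Suc m) y))\<^sup>2 \<partial>half_line_pow (Suc m))"
    unfolding half_line_pair.integral_fst[OF int_k] integral_half_line_pow_Suc[OF meas_f2]
    by (simp add: case_prod_beta')
  have int_w: "integrable (half_line_pow m) (\<lambda>w. ?C * (\<integral>x. ?k w x \<partial>half_line))"
    using half_line_pair.integrable_fst[OF int_k] by simp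
  have meas: "annihilate_fun h f m \<in> borel_measurable (half_line_pow m)"
    unfolding annihilate_fun_def[abs_def] by measurable
  have le: "AE w in half_line_pow m. (cmod (annihilate_fun h f m w))\<^sup>2 \<le> ?C * (\<integral>x. ?k w x \<partial>half_line)"
    using half_line_pair.AE_integrable_fst[OF int_k] AE_space
  proof eventually_elim
    case (elim w)
    have [measurable]: "w \<in> space (half_line_pow m)" by fact
    have "(\<lambda>x. f (Suc m) (pt_cons m x w)) \<in> borel_measurable half_line"
      using measurable_Pair2[OF meas_f elim(2)] by simp
    with elim(1) show ?case
      unfolding annihilate_fun_def
      by (intro norm_integral_mult_sq_le[OF h]) (simp add: square_integrable_def)
  qed
  have int: "integrable (half_line_pow m) (\<lambda>w. (cmod (annihilate_fun h f m w))\<^sup>2)"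
  proof (rule Bochner_Integration.integrable_bound[OF int_w])
    show "AE w in half_line_pow m. norm ((cmod (annihilate_fun h f m w))\<^sup>2)
        \<le> norm (?C * (\<integral>x. ?k w x \<partial>half_line))"
      using le by eventually_elim auto
  qed (use meas in measurable)
  with meas show "square_integrable (half_line_pow m) (annihilate_fun h f m)"
    by (simp add: square_integrable_def)
  have "(\<integral>w. (cmod (annihilate_fun h f m w))\<^sup>2 \<partial>half_line_pow m)
      \<le> (\<integral>w. ?C * (\<integral>x. ?k w x \<partial>half_line) \<partial>half_line_pow m)"
    by (rule integral_mono_AE[OF int int_w le])
  also have "\<dots> = ?C * (\<integral>y. (cmod (f (Suc m) y))\<^sup>2 \<partial>half_line_pow (Suc m))"
    using eq_k by simp
  finally show "(\<integral>w. (cmod (annihilate_fun h f m w))\<^sup>2 \<partial>half_line_pow m)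
       \<le> ?C * (\<integral>y. (cmod (f (Suc m) y))\<^sup>2 \<partial>half_line_pow (Suc m))" .
qed

lemma fock_carrier_annihilate_fun:
  assumes h: "real_L2 h" and f: "f \<in> fock_carrier"
  shows "annihilate_fun h f \<in> fock_carrier"
proof -
  have s: "square_integrable (half_line_pow (Suc m)) (f (Suc m))" for m
    using f by (auto simp: fock_carrier_def)
  have "summable (\<lambda>m. (1 + (\<integral>x. (h x)\<^sup>2 \<partial>half_line)) *
      (\<integral>y. (cmod (f (Suc m) y))\<^sup>2 \<partial>half_line_pow (Suc m)))"
    using f summable_Suc_iff[of "\<lambda>m. \<integral>y. (cmod (f m y))\<^sup>2 \<partial>half_line_pow m"]
    by (intro summable_mult) (simp add: fock_carrier_def)
  then have "summable (\<lambda>m. \<integral>w. (cmod (annihilate_fun h f m w))\<^sup>2 \<partial>half_line_pow m)"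
  proof (rule summable_comparison_test')
    show "norm (\<integral>w. (cmod (annihilate_fun h f m w))\<^sup>2 \<partial>half_line_pow m)
        \<le> (1 + (\<integral>x. (h x)\<^sup>2 \<partial>half_line)) *
      (\<integral>y. (cmod (f (Suc m) y))\<^sup>2 \<partial>half_line_pow (Suc m))" if "m \<ge> 0" for m
      using annihilate_fun_sq(2)[where f = f, OF h s] by simp
  qed
  then show ?thesis
    using annihilate_fun_sq(1)[where f = f, OF h s] by (simp add: fock_carrier_def)
qed

lemma fock_rel_annihilate_fun:
  assumes h: "real_L2 h" and fg: "fock_rel f g"
  shows "fock_rel (annihilate_fun h f) (annihilate_fun h g)"
proof -
  have c: "f \<in> fock_carrier" "g \<in> fock_carrier" using fg by (auto simp: fock_rel_def)
  have [measurable]: "f m \<in> borel_measurable (half_line_pow m)"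
      "g m \<in> borel_measurable (half_line_pow m)" for m
    using c by (auto simp: fock_carrier_def square_integrable_def)
  have [measurable]: "h \<in> borel_measurable half_line" using h by (simp add: real_L2_def)
  have "AE w in half_line_pow m. annihilate_fun h f m w = annihilate_fun h g m w" for m
    using AE_half_line_pow_cons[of "f (Suc m)" m "g (Suc m)", OF _ _ fock_rel_AE[OF fg], simplified]
      AE_space
  proof eventually_elim
    case (elim w)
    have "(\<lambda>p. F (pt_cons m (snd p) (fst p))) \<in> borel_measurable (half_line_pow m \<Otimes>\<^sub>M half_line)"
      if [measurable]: "F \<in> borel_measurable (half_line_pow (Suc m))"
      for F :: "(nat \<Rightarrow> real) \<Rightarrow> complex"
      by measurable
    from measurable_Pair2[OF this elim(2)]
    have [measurable]: "(\<lambda>x. f (Suc m) (pt_cons m x w)) \<in> borel_measurable half_line"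
      "(\<lambda>x. g (Suc m) (pt_cons m x w)) \<in> borel_measurable half_line" by auto
    show ?case unfolding annihilate_fun_def
    proof (rule integral_cong_AE)
      show "AE x in half_line. complex_of_real (h x) * f (Suc m) (pt_cons m x w)
          = complex_of_real (h x) * g (Suc m) (pt_cons m x w)"
        using elim(1) by eventually_elim simp
    qed measurable
  qed
  then show ?thesis using c h by (simp add: fock_rel_def fock_carrier_annihilate_fun)
qed

lemma AE_half_line_pow_hd:
  assumes [measurable]: "Measurable.pred half_line P" and "AE x in half_line. P x"
  shows "AE y in half_line_pow (Suc m). P (y 0)"
proof -
  have "AE p in half_line_pow m \<Otimes>\<^sub>M half_line. P (snd p)"
  proof (rule half_line_pair.AE_pair_measure)
    show "{p \<in> space (half_line_pow m \<Otimes>\<^sub>M half_line). P (snd p)}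
        \<in> sets (half_line_pow m \<Otimes>\<^sub>M half_line)" by measurable
  qed (use assms(2) in simp)
  moreover have "Measurable.pred (half_line_pow (Suc m)) (\<lambda>y. P (y 0))" by measurable
  ultimately show ?thesis by (simp add: AE_half_line_pow_Suc_iff)
qed

lemma fock_carrier_gauge_fun:
  assumes b: "real_Linf b" and f: "f \<in> fock_carrier"
  shows "gauge_fun b f \<in> fock_carrier"
proof -
  obtain C where [measurable]: "b \<in> borel_measurable half_line" and C: "AE x in half_line. \<bar>b x\<bar> \<le> C"
    using b by (auto simp: real_Linf_def)
  have s: "integrable (half_line_pow m) (\<lambda>y. (cmod (f m y))\<^sup>2)"
    and [measurable]: "f m \<in> borel_measurable (half_line_pow m)" for m
    using f by (auto simp: fock_carrier_def square_integrable_def)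
  have meas: "gauge_fun b f m \<in> borel_measurable (half_line_pow m)" for m
    by (cases m) (auto simp: gauge_fun_def[abs_def])
  have le: "AE y in half_line_pow m. (cmod (gauge_fun b f m y))\<^sup>2 \<le> C\<^sup>2 * (cmod (f m y))\<^sup>2" for m
  proof (cases m)
    case (Suc k)
    have "AE y in half_line_pow (Suc k). \<bar>b (y 0)\<bar> \<le> C"
      by (rule AE_half_line_pow_hd[OF _ C]) measurable
    then show ?thesis unfolding Suc
    proof eventually_elim
      case (elim y)
      then have "(b (y 0))\<^sup>2 \<le> C\<^sup>2" by (metis abs_ge_zero power2_abs power_mono)
      then show ?case
        by (simp add: gauge_fun_def norm_mult power_mult_distrib mult_right_mono)
    qed
  qed (simp add: gauge_fun_def)
  have int: "integrable (half_line_pow m) (\<lambda>y. (cmod (gauge_fun b f m y))\<^sup>2)" for m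
  proof (rule Bochner_Integration.integrable_bound)
    show "integrable (half_line_pow m) (\<lambda>y. C\<^sup>2 * (cmod (f m y))\<^sup>2)" using s by simp
    show "AE y in half_line_pow m. norm ((cmod (gauge_fun b f m y))\<^sup>2) \<le> norm (C\<^sup>2 * (cmod (f m y))\<^sup>2)"
      using le[of m] by eventually_elim simp
  qed (use meas in measurable)
  have "(\<integral>y. (cmod (gauge_fun b f m y))\<^sup>2 \<partial>half_line_pow m)
      \<le> (\<integral>y. C\<^sup>2 * (cmod (f m y))\<^sup>2 \<partial>half_line_pow m)" for m
    by (rule integral_mono_AE[OF int _ le]) (use s in simp)
  then have le': "(\<integral>y. (cmod (gauge_fun b f m y))\<^sup>2 \<partial>half_line_pow m)
      \<le> C\<^sup>2 * (\<integral>y. (cmod (f m y))\<^sup>2 \<partial>half_line_pow m)" for m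
    by simp
  have "summable (\<lambda>m. C\<^sup>2 * (\<integral>y. (cmod (f m y))\<^sup>2 \<partial>half_line_pow m))"
    using f by (intro summable_mult) (simp add: fock_carrier_def)
  then have "summable (\<lambda>m. \<integral>y. (cmod (gauge_fun b f m y))\<^sup>2 \<partial>half_line_pow m)"
    by (rule summable_comparison_test') (use le' in simp)
  then show ?thesis using meas int by (simp add: fock_carrier_def square_integrable_def)
qed

lemma fock_rel_gauge_fun:
  assumes b: "real_Linf b" and fg: "fock_rel f g"
  shows "fock_rel (gauge_fun b f) (gauge_fun b g)"
proof -
  have "AE y in half_line_pow m. gauge_fun b f m y = gauge_fun b g m y" for m
    using fock_rel_AE[OF fg, of m] by eventually_elim (simp add: gauge_fun_def)
  then show ?thesis using b fg by (auto simp: fock_rel_def fock_carrier_gauge_fun)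
qed

lemma fock_rel_zero: "fock_rel (\<lambda>_ _. 0) (\<lambda>_ _. 0)"
  by (simp add: fock_rel_def fock_carrier_zero)

lift_definition vacuum :: fock ("\<Omega>") is "\<lambda>m _. if m = 0 then 1 else 0"
proof -
  have "summable (\<lambda>m. \<integral>x. (cmod (if m = 0 then 1 else 0))\<^sup>2 \<partial>half_line_pow m)"
    by (rule summable_finite[of "{0}"]) auto
  then show "fock_rel (\<lambda>m _. if m = 0 then 1 else 0) (\<lambda>m _. if m = 0 then 1 else 0)"
    by (auto simp: fock_rel_def fock_carrier_def square_integrable_def half_line_pow_def PiM_empty
        intro!: integrable_count_space)
qed

text \<open>
  The operators depend on a function \<open>h \<in> L\<^sup>2\<close> or \<open>b \<in> L\<^sup>\<infinity>\<close>; outside of these classes they are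
  set to 0.
\<close>

lift_definition tensor_left :: "(real \<Rightarrow> real) \<Rightarrow> fock \<Rightarrow> fock" (infixr "\<otimes>\<^sub>L" 75)
  is "\<lambda>h f. if real_L2 h then tensor_fun h f else (\<lambda>_ _. 0)"
  by (simp add: fock_rel_tensor_fun fock_rel_zero)

lemma cinner_tensor_left:
  assumes h: "real_L2 h" and k: "real_L2 k"
  shows "\<langle>h \<otimes>\<^sub>L F, k \<otimes>\<^sub>L G\<rangle> = (\<integral>x. h x * k x \<partial>half_line) *\<^sub>R \<langle>F, G\<rangle>"
  using h k
proof (transfer)
  fix f g :: fock_fun and h k :: "real \<Rightarrow> real"
  assume h: "real_L2 h" and k: "real_L2 k" and "fock_rel f f" "fock_rel g g"
  then have c: "f \<in> fock_carrier" "g \<in> fock_carrier" by (auto simp: fock_rel_def)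
  then have s: "square_integrable (half_line_pow m) (f m)" "square_integrable (half_line_pow m) (g m)" for m
    by (auto simp: fock_carrier_def)
  have [measurable]: "h \<in> borel_measurable half_line" "k \<in> borel_measurable half_line"
      "f m \<in> borel_measurable (half_line_pow m)" "g m \<in> borel_measurable (half_line_pow m)" for m
    using h k s by (auto simp: real_L2_def square_integrable_def)
  have [measurable]: "cnj \<in> borel_measurable borel"
    by (intro borel_measurable_continuous_onI continuous_intros)
  let ?I = "\<integral>x. h x * k x \<partial>half_line"
  let ?t = "\<lambda>m. \<integral>y. cnj (tensor_fun h f m y) * tensor_fun k g m y \<partial>half_line_pow m"
  have "square_integrable half_line (\<lambda>x. complex_of_real (h x))"
    "square_integrable half_line (\<lambda>x. complex_of_real (k x))"
    using h k by (auto simp: real_L2_def square_integrable_def)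
  from square_integrable_cnj_mult(1)[OF this]
  have int_hk: "integrable half_line (\<lambda>x. complex_of_real (h x * k x))" by simp
  have term_Suc: "?t (Suc m) = ?I *\<^sub>R (\<integral>w. cnj (f m w) * g m w \<partial>half_line_pow m)" for m
  proof -
    let ?g = "\<lambda>y. cnj (tensor_fun h f (Suc m) y) * tensor_fun k g (Suc m) y"
    let ?k = "\<lambda>w x. complex_of_real (h x * k x) * (cnj (f m w) * g m w)"
    have meas_k: "case_prod ?k \<in> borel_measurable (half_line_pow m \<Otimes>\<^sub>M half_line)"
      by measurable
    have int_fg: "integrable (half_line_pow m) (\<lambda>w. cnj (f m w) * g m w)"
      by (rule square_integrable_cnj_mult(1)[OF s])
    have int_k: "integrable (half_line_pow m \<Otimes>\<^sub>M half_line) (case_prod ?k)"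
    proof (rule half_line_pair.Fubini_integrable[OF meas_k])
      show "integrable (half_line_pow m) (\<lambda>w. \<integral>x. norm (case_prod ?k (w, x)) \<partial>half_line)"
        using integrable_norm[OF int_fg] by (simp add: norm_mult)
      show "AE w in half_line_pow m. integrable half_line (\<lambda>x. case_prod ?k (w, x))"
        unfolding prod.case by (intro AE_I2 integrable_mult_left int_hk)
    qed
    have meas_g: "?g \<in> borel_measurable (half_line_pow (Suc m))"
      unfolding tensor_fun_def by simp
    have cong: "?g (pt_cons m (snd p) (fst p)) = case_prod ?k p"
      if "p \<in> space (half_line_pow m \<Otimes>\<^sub>M half_line)" for p
      using that by (auto simp: space_pair_measure pt_tl_cons tensor_fun_def)
    have "?t (Suc m) = (\<integral>p. ?g (pt_cons m (snd p) (fst p)) \<partial>(half_line_pow m \<Otimes>\<^sub>M half_line))"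
      by (rule integral_half_line_pow_Suc[OF meas_g])
    also have "\<dots> = (\<integral>p. case_prod ?k p \<partial>(half_line_pow m \<Otimes>\<^sub>M half_line))"
      by (rule Bochner_Integration.integral_cong[OF refl cong])
    also have "\<dots> = (\<integral>w. \<integral>x. ?k w x \<partial>half_line \<partial>half_line_pow m)"
      using half_line_pair.integral_fst[OF int_k] by simp
    also have "\<dots> = (\<integral>w. complex_of_real ?I * (cnj (f m w) * g m w) \<partial>half_line_pow m)"
      by (simp only: integral_mult_left_zero integral_complex_of_real)
    also have "\<dots> = ?I *\<^sub>R (\<integral>w. cnj (f m w) * g m w \<partial>half_line_pow m)"
      by (simp only: integral_mult_right_zero scaleR_conv_of_real)
    finally show ?thesis .
  qed
  have "(\<Sum>m. ?t (Suc m)) = (\<Sum>m. ?t m) - ?t 0"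
    by (rule suminf_split_head summable_cinner_aux fock_carrier_tensor_fun h k c)+
  also have "?t 0 = 0" by (simp add: tensor_fun_def)
  finally have "(\<Sum>m. ?t m) = (\<Sum>m. ?I *\<^sub>R (\<integral>w. cnj (f m w) * g m w \<partial>half_line_pow m))"
    unfolding term_Suc by simp
  also have "\<dots> = ?I *\<^sub>R (\<Sum>m. \<integral>w. cnj (f m w) * g m w \<partial>half_line_pow m)"
    by (rule suminf_scaleR_right[symmetric, OF summable_cinner_aux[OF c]])
  finally show "(\<Sum>m. \<integral>x. cnj ((if real_L2 h then tensor_fun h f else (\<lambda>_ _. 0)) m x) *
           (if real_L2 k then tensor_fun k g else (\<lambda>_ _. 0)) m x \<partial>half_line_pow m)
     = ?I *\<^sub>R (\<Sum>m. \<integral>x. cnj (f m x) * g m x \<partial>half_line_pow m)"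
    using h k by simp
qed

lemma cinner_vacuum_tensor_left: "\<langle>\<Omega>, h \<otimes>\<^sub>L F\<rangle> = 0"
proof transfer
  fix h :: "real \<Rightarrow> real" and f :: fock_fun
  have "(\<lambda>m. \<integral>x. cnj (if m = 0 then 1 else 0) *
      (if real_L2 h then tensor_fun h f else (\<lambda>_ _. 0)) m x \<partial>half_line_pow m) = (\<lambda>_. 0)"
    by (rule ext) (simp add: tensor_fun_def[abs_def])
  then show "(\<Sum>m. \<integral>x. cnj (if m = 0 then 1 else 0) *
      (if real_L2 h then tensor_fun h f else (\<lambda>_ _. 0)) m x \<partial>half_line_pow m) = 0"
    by simp
qed

lemma cinner_vacuum: "\<langle>\<Omega>, \<Omega>\<rangle> = 1"
proof transfer
  have "(\<Sum>m. \<integral>x. cnj (if m = 0 then 1 else 0) * (if m = 0 then 1 else 0) \<partial>half_line_pow m)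
      = (\<Sum>m\<in>{0}. \<integral>x. cnj (if m = 0 then 1 else 0) * (if m = 0 then 1 else 0) \<partial>half_line_pow m)"
    by (rule suminf_finite) auto
  also have "\<dots> = 1"
    by (simp add: half_line_pow_def PiM_empty measure_def)
  finally show "(\<Sum>m. \<integral>x. cnj (if m = 0 then 1 else 0) * (if m = 0 then 1 else 0) \<partial>half_line_pow m) = 1" .
qed

definition creation :: "(real \<Rightarrow> real) \<Rightarrow> fock \<Rightarrow> fock" where
  "creation h F = h \<otimes>\<^sub>L F"

lift_definition annihilation :: "(real \<Rightarrow> real) \<Rightarrow> fock \<Rightarrow> fock"
  is "\<lambda>h f. if real_L2 h then annihilate_fun h f else (\<lambda>_ _. 0)"
  by (simp add: fock_rel_annihilate_fun fock_rel_zero)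

lift_definition gauge_op :: "(real \<Rightarrow> real) \<Rightarrow> fock \<Rightarrow> fock"
  is "\<lambda>b f. if real_Linf b then gauge_fun b f else (\<lambda>_ _. 0)"
  by (simp add: fock_rel_gauge_fun fock_rel_zero)

definition time_op :: "(real \<Rightarrow> real) \<Rightarrow> fock \<Rightarrow> fock" where
  "time_op b F = complex_of_real (\<integral>x. b x \<partial>half_line) *\<^sub>C F"

definition free_poisson :: "real \<Rightarrow> fock \<Rightarrow> fock" where
  "free_poisson t F = (let b = indicator {0..<t} in
     creation b F + annihilation b F + gauge_op b F + time_op b F)"


section \<open>The toy Fock space\<close>

definition toy_step :: "nat \<Rightarrow> nat \<Rightarrow> real \<Rightarrow> real" where
  "toy_step n i x = sqrt n * indicator {real i / real n ..< (real i + 1) / real n} x"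

fun toy_vec :: "nat \<Rightarrow> nat list \<Rightarrow> fock" where
  "toy_vec n [] = \<Omega>"
| "toy_vec n (i # \<sigma>) = toy_step n i \<otimes>\<^sub>L toy_vec n \<sigma>"

abbreviation adapted :: "nat list set" where
  "adapted \<equiv> {\<sigma>. distinct_adj \<sigma>}"

definition toy_fock :: "nat \<Rightarrow> fock set" where
  "toy_fock n = closure (fock.span (toy_vec n ` adapted))"

text \<open>
  The operator with prescribed values \<open>A \<sigma>\<close> on the orthonormal basis of \<open>toy_fock n\<close>, extended by 0
  on the orthogonal complement (all coefficients vanish there). The sum is over the net of finite
  subsets, in the norm topology of the Fock space.
\<close>

definition toy_op :: "nat \<Rightarrow> (nat list \<Rightarrow> fock) \<Rightarrow> fock \<Rightarrow> fock" where
  "toy_op n A F = (\<Sum>\<^sub>\<infinity>\<sigma>\<in>adapted. \<langle>toy_vec n \<sigma>, F\<rangle> *\<^sub>C A \<sigma>)"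

lemma integral_toy_step:
  assumes n: "n \<ge> 1"
  shows "integrable half_line (\<lambda>x. toy_step n i x * toy_step n j x)"
    and "(\<integral>x. toy_step n i x * toy_step n j x \<partial>half_line) = (if i = j then 1 else 0)"
proof -
  let ?A = "{real i / real n ..< (real i + 1) / real n}"
  have eq: "toy_step n i x * toy_step n j x = (if i = j then real n * (indicator ?A x :: real) else 0)" for x
  proof (cases "i = j")
    case False
    have "\<not> (x \<in> ?A \<and> x \<in> {real j / real n ..< (real j + 1) / real n})"
    proof
      assume "x \<in> ?A \<and> x \<in> {real j / real n ..< (real j + 1) / real n}"
      then have "real i \<le> x * n" "x * n < real i + 1" "real j \<le> x * n" "x * n < real j + 1"
        using n by (auto simp: field_simps)
      then have "real i < real j + 1" "real j < real i + 1" by linarith+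
      with False show False by linarith
    qed
    then show ?thesis using False by (auto simp: toy_step_def indicator_def)
  qed (auto simp: toy_step_def indicator_def)
  have sub: "?A \<subseteq> {0..}"
    by (auto intro: order_trans[of 0 "real i / real n"])
  then have m: "emeasure half_line ?A = ennreal (1 / n)"
    using n by (subst emeasure_restrict_space) (auto simp: field_simps diff_divide_distrib[symmetric])
  then have m': "measure half_line ?A = 1 / n" by (simp add: measure_def)
  have [measurable]: "?A \<in> sets half_line"
    using sub by (simp add: sets_restrict_space_iff)
  have i: "integrable half_line (\<lambda>x. indicator ?A x :: real)"
    by (rule integrable_real_indicator) (simp_all add: m)
  show "integrable half_line (\<lambda>x. toy_step n i x * toy_step n j x)"
    unfolding eq using i by (cases "i = j") simp_all
  have one: "real n * (\<integral>x. indicator ?A x \<partial>half_line) = 1"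
    using n by (simp add: m' Int_absorb2[OF sub] space_restrict_space)
  show "(\<integral>x. toy_step n i x * toy_step n j x \<partial>half_line) = (if i = j then 1 else 0)"
  proof (cases "i = j")
    case True
    show ?thesis unfolding eq if_P[OF True] integral_mult_right_zero by (rule one)
  qed (simp add: eq)
qed

lemma real_L2_toy_step: "n \<ge> 1 \<Longrightarrow> real_L2 (toy_step n i)"
  using integral_toy_step(1)[of n i i]
  unfolding real_L2_def toy_step_def[abs_def] power2_eq_square
  by (auto intro!: measurable_restrict_space1)

lemma toy_vec_orthonormal:
  "n \<ge> 1 \<Longrightarrow> \<langle>toy_vec n \<sigma>, toy_vec n \<tau>\<rangle> = (if \<sigma> = \<tau> then 1 else 0)"
proof (induction \<sigma> arbitrary: \<tau>)
  case Nil
  then show ?case by (cases \<tau>) (auto simp: cinner_vacuum cinner_vacuum_tensor_left)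
next
  case (Cons i \<sigma>)
  show ?case
  proof (cases \<tau>)
    case Nil
    then show ?thesis
      using cinner_fock_commute[of "toy_vec n (i # \<sigma>)" "\<Omega>"]
      by (simp add: cinner_vacuum_tensor_left)
  next
    case (Cons j \<rho>)
    with Cons.IH[OF Cons.prems, of \<rho>] Cons.prems show ?thesis
      by (simp add: cinner_tensor_left real_L2_toy_step integral_toy_step(2))
  qed
qed

lemma toy_op_toy_vec:
  assumes "n \<ge> 1" "\<sigma> \<in> adapted"
  shows "toy_op n A (toy_vec n \<sigma>) = A \<sigma>"
proof -
  have "toy_op n A (toy_vec n \<sigma>) = (\<Sum>\<^sub>\<infinity>\<tau>\<in>{\<sigma>}. \<langle>toy_vec n \<tau>, toy_vec n \<sigma>\<rangle> *\<^sub>C A \<tau>)"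
    unfolding toy_op_def using assms
    by (intro infsum_cong_neutral) (auto simp: toy_vec_orthonormal)
  then show ?thesis using assms by (simp add: toy_vec_orthonormal scale_fock_one)
qed

lemma toy_op_orthogonal:
  "(\<And>G. G \<in> toy_fock n \<Longrightarrow> \<langle>G, F\<rangle> = 0) \<Longrightarrow> toy_op n A F = 0"
  unfolding toy_op_def toy_fock_def
  by (intro infsum_0) (auto intro!: subsetD[OF closure_subset] fock.span_base)

definition toy_plus :: "nat \<Rightarrow> nat \<Rightarrow> fock \<Rightarrow> fock" where
  "toy_plus n i = toy_op n (\<lambda>\<sigma>. case \<sigma> of
      [] \<Rightarrow> toy_vec n [i]
    | j # _ \<Rightarrow> if j \<noteq> i then toy_vec n (i # \<sigma>) else 0)"

definition toy_minus :: "nat \<Rightarrow> nat \<Rightarrow> fock \<Rightarrow> fock" where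
  "toy_minus n i = toy_op n (\<lambda>\<sigma>. case \<sigma> of
      [] \<Rightarrow> 0
    | j # \<rho> \<Rightarrow> if j = i then toy_vec n \<rho> else 0)"

definition toy_circ :: "nat \<Rightarrow> nat \<Rightarrow> fock \<Rightarrow> fock" where
  "toy_circ n i = toy_op n (\<lambda>\<sigma>. case \<sigma> of
      [] \<Rightarrow> 0
    | j # _ \<Rightarrow> if j = i then toy_vec n \<sigma> else 0)"

definition toy_times :: "nat \<Rightarrow> nat \<Rightarrow> fock \<Rightarrow> fock" where
  "toy_times n i = toy_op n (\<lambda>\<sigma>. case \<sigma> of
      [] \<Rightarrow> \<Omega>
    | j # _ \<Rightarrow> if j \<noteq> i then toy_vec n \<sigma> else 0)"

definition toy_Y :: "nat \<Rightarrow> nat \<Rightarrow> fock \<Rightarrow> fock" where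
  "toy_Y n i F = toy_plus n i F + toy_minus n i F
     + sqrt n *\<^sub>R toy_circ n i F + (1 / sqrt n) *\<^sub>R toy_times n i F"

definition toy_poisson :: "nat \<Rightarrow> real \<Rightarrow> fock \<Rightarrow> fock" where
  "toy_poisson n t F = (1 / sqrt n) *\<^sub>R (\<Sum>i = 0..nat \<lfloor>real n * t\<rfloor>. toy_Y n i F)"


section \<open>Random variables on the toy Fock space\<close>

text \<open>
  \<open>toy_bounded n\<close> is the algebra of bounded operators on \<open>toy_fock n\<close>, every operator being extended
  by 0 on the orthogonal complement. The unit of this algebra is therefore not the identity of the
  whole Fock space but the orthogonal projection \<open>toy_unit n\<close>.
\<close>

definition toy_bounded :: "nat \<Rightarrow> (fock \<Rightarrow> fock) set" where
  "toy_bounded n = {T. bounded_linear T \<and> (\<forall>c F. T (c *\<^sub>C F) = c *\<^sub>C T F) \<and>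
     range T \<subseteq> toy_fock n \<and> (\<forall>F. (\<forall>G\<in>toy_fock n. \<langle>G, F\<rangle> = 0) \<longrightarrow> T F = 0)}"

definition toy_unit :: "nat \<Rightarrow> fock \<Rightarrow> fock" where
  "toy_unit n = toy_op n (toy_vec n)"

fun toy_power :: "nat \<Rightarrow> (fock \<Rightarrow> fock) \<Rightarrow> nat \<Rightarrow> fock \<Rightarrow> fock" where
  "toy_power n T 0 = toy_unit n"
| "toy_power n T (Suc k) = T \<circ> toy_power n T k"

definition vacuum_state :: "(fock \<Rightarrow> fock) \<Rightarrow> complex" where
  "vacuum_state T = \<langle>\<Omega>, T \<Omega>\<rangle>"

definition self_adjoint :: "(fock \<Rightarrow> fock) \<Rightarrow> bool" where
  "self_adjoint T \<longleftrightarrow> (\<forall>F G. \<langle>T F, G\<rangle> = \<langle>F, T G\<rangle>)"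

definition has_distribution :: "nat \<Rightarrow> (fock \<Rightarrow> fock) \<Rightarrow> real measure \<Rightarrow> bool" where
  "has_distribution n Y \<mu> \<longleftrightarrow>
     Y \<in> toy_bounded n \<and> self_adjoint Y \<and>
     prob_space \<mu> \<and> sets \<mu> = sets borel \<and> (\<exists>K. compact K \<and> emeasure \<mu> (- K) = 0) \<and>
     (\<forall>k. vacuum_state (toy_power n Y k) = complex_of_real (\<integral>x. x ^ k \<partial>\<mu>))"

definition two_point_law :: "real \<Rightarrow> real \<Rightarrow> real \<Rightarrow> real measure" where
  "two_point_law p a b = distr (measure_pmf (bernoulli_pmf p)) borel (\<lambda>s. if s then a else b)"

lemma emeasure_two_point_law:
  assumes "0 \<le> p" "p \<le> 1" "A \<in> sets borel"
  shows "emeasure (two_point_law p a b) A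
     = ennreal p * indicator A a + ennreal (1 - p) * indicator A b"
proof -
  have sum_bool: "(\<Sum>s\<in>UNIV. g s) = g True + g False" for g :: "bool \<Rightarrow> real"
    by (simp add: UNIV_bool)
  have "emeasure (two_point_law p a b) A = emeasure (measure_pmf (bernoulli_pmf p)) {s. (if s then a else b) \<in> A}"
    unfolding two_point_law_def using assms(3) by (subst emeasure_distr) (auto simp: vimage_def)
  also have "\<dots> = ennreal (\<Sum>s\<in>{s. (if s then a else b) \<in> A}. pmf (bernoulli_pmf p) s)"
    by (subst emeasure_measure_pmf_finite) auto
  also have "(\<Sum>s\<in>{s. (if s then a else b) \<in> A}. pmf (bernoulli_pmf p) s)
      = (\<Sum>s\<in>UNIV. pmf (bernoulli_pmf p) s * indicator A (if s then a else b))"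
    by (rule sum.mono_neutral_cong_left) (auto simp: indicator_def)
  also have "\<dots> = p * indicator A a + (1 - p) * indicator A b"
    unfolding sum_bool using assms by simp
  finally show ?thesis
    using assms by (simp add: ennreal_plus ennreal_mult ennreal_indicator)
qed

inductive_set generated_algebra :: "(fock \<Rightarrow> fock) \<Rightarrow> (fock \<Rightarrow> fock) set \<Rightarrow> (fock \<Rightarrow> fock) set"
  for e :: "fock \<Rightarrow> fock" and S :: "(fock \<Rightarrow> fock) set" where
  unit: "e \<in> generated_algebra e S"
| generator: "T \<in> S \<Longrightarrow> T \<in> generated_algebra e S"
| add: "T \<in> generated_algebra e S \<Longrightarrow> U \<in> generated_algebra e S
    \<Longrightarrow> (\<lambda>F. T F + U F) \<in> generated_algebra e S"
| scale: "T \<in> generated_algebra e S \<Longrightarrow> (\<lambda>F. c *\<^sub>C T F) \<in> generated_algebra e S"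
| mult: "T \<in> generated_algebra e S \<Longrightarrow> U \<in> generated_algebra e S
    \<Longrightarrow> T \<circ> U \<in> generated_algebra e S"

definition free_subalgebras ::
    "((fock \<Rightarrow> fock) \<Rightarrow> complex) \<Rightarrow> ('i \<Rightarrow> (fock \<Rightarrow> fock) set) \<Rightarrow> 'i set \<Rightarrow> bool" where
  "free_subalgebras \<phi> \<A> I \<longleftrightarrow>
     (\<forall>m\<ge>1. \<forall>(j :: nat \<Rightarrow> 'i) b.
        (\<forall>k\<in>{1..m}. j k \<in> I \<and> b k \<in> \<A> (j k) \<and> \<phi> (b k) = 0) \<and>
        (\<forall>k. 1 \<le> k \<and> k < m \<longrightarrow> j k \<noteq> j (k + 1))
        \<longrightarrow> \<phi> (foldr (\<circ>) (map b [1..<m + 1]) id) = 0)"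

definition free_random_variables :: "nat \<Rightarrow> ('i \<Rightarrow> fock \<Rightarrow> fock) \<Rightarrow> 'i set \<Rightarrow> bool" where
  "free_random_variables n Y I \<longleftrightarrow>
     (\<forall>i\<in>I. Y i \<in> toy_bounded n) \<and>
     free_subalgebras vacuum_state (\<lambda>i. generated_algebra (toy_unit n) {Y i}) I"

end

theory Submission
  imports Defs
begin

text \<open>
  If \<open>i\<sigma>\<close> is adapted, \<open>Y\<^sub>i\<close> acts on the plane spanned by \<open>X\<^sub>\<sigma>\<close> and \<open>X\<^bsub>i\<sigma>\<^esub>\<close> by a matrix of rank one,
  hence \<open>Y\<^sub>i\<^sup>2 = (n + 1) / sqrt n \<cdot> Y\<^sub>i\<close>, and the vacuum moments follow. The algebra generated
  by \<open>Y\<^sub>i\<close> is spanned by the unit and \<open>Y\<^sub>i\<close>, so a centred element is a multiple of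
  \<open>Y\<^sub>i - 1 / sqrt n\<close>, which maps \<open>X\<^sub>\<sigma>\<close> to \<open>X\<^bsub>i\<sigma>\<^esub>\<close>. An alternating product of centred elements
  therefore maps the vacuum to a multiple of some \<open>X\<^sub>\<sigma>\<close> with \<open>\<sigma>\<close> non-empty, which is orthogonal to the vacuum.

  For the limit, put \<open>c = (\<lfloor>nt\<rfloor> + 1) / n\<close>. On the toy Fock space the operator \<open>N\<^sub>t\<^sup>(\<^sup>n\<^sup>)\<close> equals
  \<open>a\<^sup>+ + a\<^sup>- + a\<^sup>\<circ> + a\<^sup>\<times>\<close> for the indicator of \<open>[0, c)\<close>, up to terms of norm at most
  \<open>1 / sqrt n + 1 / n\<close> caused by the non-adapted words. Strong convergence then reduces to \<open>c \<longlonglongrightarrow> t\<close> and to the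
  strong convergence of the projections onto the toy Fock spaces to the identity. As everything is
  uniformly bounded, these are checked on tensor products of indicators of intervals \<open>[0, s)\<close>, whose
  span is dense. Completeness of the Fock space is needed for the series defining the toy operators
  to converge on all vectors.
\<close>

section \<open>Completeness\<close>

text \<open>On the plane of X_sigma and X_{i sigma} the matrix of Y_i has diagonal entries 1 / sqrt
  n and sqrt n and off-diagonal entries 1. The diagonal entries are reciprocal, so the determinant
  is 0, the only nonzero eigenvalue is the trace (n + 1) / sqrt n, and its eigenvector (1, sqrt n)
  has vacuum weight 1 / (n + 1). After the factor 1 / sqrt n in front of the sum, the same
  coefficients leave 1 for the gauge part and 1 / n, the length of a cell, for the time part.

  The obstacle to the limit is that the toy spaces are not nested in n and that creation leads out
  of them. Each discrete operator is therefore compared with a continuous one for [0, c), applied to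
  the projected vector. Annihilation and gauge agree exactly; creation errs because it would repeat
  a letter, and the time part misses 1 / n times the gauge.

  The projections need no discretization of functions of their own: discrete creation applied to the
  projection of F stays in the toy space and tends to step s tensor F, so convergence passes from F
  to one more tensor factor.\<close>

lemma square_integrable_diff:
  assumes "square_integrable M f" "square_integrable M g"
  shows "square_integrable M (\<lambda>x. f x - g x)"
  using square_integrable_add(1)[OF assms(1) square_integrable_scale(1)[OF assms(2), of "-1"]] by simp

text \<open>
  The weights \<open>2 ^ k\<close> make the consecutive differences of a fast Cauchy subsequence absolutely
  summable almost everywhere: \<open>y \<le> 2 powr - k + 2 ^ k * y\<^sup>2\<close> for \<open>y \<ge> 0\<close>.
\<close>

lemma square_integrable_complete:
  fixes f :: "nat \<Rightarrow> 'a \<Rightarrow> complex"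
  assumes f: "\<And>n. square_integrable M (f n)"
    and cauchy: "\<And>e. e > 0 \<Longrightarrow> \<exists>N. \<forall>m\<ge>N. \<forall>n\<ge>N. (\<integral>x. (cmod (f m x - f n x))\<^sup>2 \<partial>M) < e"
  obtains g where "square_integrable M g" "(\<lambda>n. \<integral>x. (cmod (f n x - g x))\<^sup>2 \<partial>M) \<longlonglongrightarrow> 0"
proof -
  have [measurable]: "f n \<in> borel_measurable M" for n
    using f by (simp add: square_integrable_def)
  have diff: "integrable M (\<lambda>x. (cmod (f m x - f n x))\<^sup>2)" for m n
    using square_integrable_diff[OF f f] by (simp add: square_integrable_def)
  \<comment> \<open>The threshold \<open>(1/4)^k\<close> survives the weight \<open>2^k\<close> as
    the summable \<open>(1/2)^k\<close>.\<close>
  have "\<exists>N. \<forall>k. \<forall>m\<ge>N k. \<forall>n\<ge>N k. (\<integral>x. (cmod (f m x - f n x))\<^sup>2 \<partial>M) < (1/4)^k"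
    by (intro choice allI cauchy) simp
  then obtain N where
    N: "\<And>k m n. m \<ge> N k \<Longrightarrow> n \<ge> N k \<Longrightarrow> (\<integral>x. (cmod (f m x - f n x))\<^sup>2 \<partial>M) < (1/4)^k"
    by blast
  \<comment> \<open>Summing makes both \<open>s k\<close> and \<open>s (Suc k)\<close> at least
    \<open>N k\<close>, although \<open>N\<close> need not be monotone; the summand \<open>k\<close>
    sends \<open>s\<close> to infinity.\<close>
  define s where "s k = (\<Sum>j\<le>k. N j) + k" for k
  have sN: "s k \<ge> N k" for k
    unfolding s_def using member_le_sum[of k "{..k}" N] by force
  have s_ge: "s k \<ge> k" for k by (simp add: s_def)
  have s_Suc: "s (Suc k) \<ge> N k" for k
    using sN[of k] by (simp add: s_def)
  define d where "d k x = f (s (Suc k)) x - f (s k) x" for k x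
  have d_le: "2 ^ k * (\<integral>x. (cmod (d k x))\<^sup>2 \<partial>M) \<le> (1/2)^k" for k
  proof -
    have "2 ^ k * (\<integral>x. (cmod (d k x))\<^sup>2 \<partial>M) \<le> 2 ^ k * (1/4)^k"
      unfolding d_def using N[OF s_Suc sN] by (intro mult_left_mono) (auto intro: less_imp_le)
    also have "\<dots> = (1/2)^k" by (simp flip: power_mult_distrib)
    finally show ?thesis .
  qed
  have "(\<integral>\<^sup>+x. (\<Sum>k. ennreal (2 ^ k * (cmod (d k x))\<^sup>2)) \<partial>M)
      = (\<Sum>k. \<integral>\<^sup>+x. ennreal (2 ^ k * (cmod (d k x))\<^sup>2) \<partial>M)"
    by (rule nn_integral_suminf) (simp add: d_def)
  also have "\<dots> = (\<Sum>k. ennreal (2 ^ k * (\<integral>x. (cmod (d k x))\<^sup>2 \<partial>M)))"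
  proof -
    have "(\<integral>\<^sup>+x. ennreal (2 ^ k * (cmod (d k x))\<^sup>2) \<partial>M)
        = ennreal (2 ^ k * (\<integral>x. (cmod (d k x))\<^sup>2 \<partial>M))" for k
      using diff by (subst nn_integral_eq_integral) (auto simp: d_def)
    then show ?thesis by simp
  qed
  also have "\<dots> \<le> (\<Sum>k. ennreal ((1/2)^k))"
    by (intro suminf_le ennreal_leI d_le) auto
  also have "\<dots> = ennreal (\<Sum>k. (1/2)^k)"
    by (rule suminf_ennreal2) (auto intro: summable_geometric)
  finally have fin: "(\<integral>\<^sup>+x. (\<Sum>k. ennreal (2 ^ k * (cmod (d k x))\<^sup>2)) \<partial>M) < \<infinity>"
    by (rule le_less_trans) simp
  then have "AE x in M. (\<Sum>k. ennreal (2 ^ k * (cmod (d k x))\<^sup>2)) \<noteq> \<infinity>"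
    by (intro nn_integral_PInf_AE) (auto simp: d_def)
  then have conv: "AE x in M. convergent (\<lambda>k. f (s k) x)"
  proof eventually_elim
    case (elim x)
    then have "summable (\<lambda>k. 2 ^ k * (cmod (d k x))\<^sup>2)"
      by (intro summable_suminf_not_top) auto
    then have "summable (\<lambda>k. (1/2)^k + 2 ^ k * (cmod (d k x))\<^sup>2)"
      by (intro summable_add summable_geometric) auto
    then have "summable (\<lambda>k. d k x)"
    proof (rule summable_comparison_test'[where N = 0])
      fix k :: nat
      show "cmod (d k x) \<le> (1/2)^k + 2 ^ k * (cmod (d k x))\<^sup>2"
      proof (cases "cmod (d k x) \<le> (1/2)^k")
        case False
        have "1 = (2::real) ^ k * (1/2)^k" by (simp flip: power_mult_distrib)
        also have "\<dots> \<le> 2 ^ k * cmod (d k x)" using False by (intro mult_left_mono) auto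
        finally have "cmod (d k x) * 1 \<le> cmod (d k x) * (2 ^ k * cmod (d k x))"
          by (intro mult_left_mono) auto
        then show ?thesis by (simp add: power2_eq_square mult.left_commute add_increasing)
      qed (simp add: add_increasing2)
    qed
    then have "convergent (\<lambda>n. f (s 0) x + (\<Sum>k<n. d k x))"
      by (intro convergent_add convergent_const) (simp add: summable_iff_convergent)
    moreover have "f (s 0) x + (\<Sum>k<n. d k x) = f (s n) x" for n
      unfolding d_def by (subst sum_lessThan_telescope) simp
    ultimately show ?case by simp
  qed
  define g where "g x = lim (\<lambda>k. f (s k) x)" for x
  have [measurable]: "g \<in> borel_measurable M"
    unfolding g_def[abs_def] by measurable
  have lim: "AE x in M. (\<lambda>k. f (s k) x) \<longlonglongrightarrow> g x"
    using conv by eventually_elim (simp add: g_def convergent_LIMSEQ_iff)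
  \<comment> \<open>Fatou along \<open>s\<close>: if \<open>f n\<close> is close to all late
    \<open>f m\<close>, it is as close to the limit \<open>g\<close>. Here \<open>n\<close> need not
    lie on the subsequence, so the whole sequence converges.\<close>
  have le: "(\<integral>\<^sup>+x. ennreal ((cmod (f n x - g x))\<^sup>2) \<partial>M) \<le> ennreal e"
    if "\<And>m. m \<ge> K \<Longrightarrow> (\<integral>x. (cmod (f n x - f m x))\<^sup>2 \<partial>M) < e" for n K e
  proof -
    have "(\<integral>\<^sup>+x. ennreal ((cmod (f n x - g x))\<^sup>2) \<partial>M)
        = (\<integral>\<^sup>+x. liminf (\<lambda>k. ennreal ((cmod (f n x - f (s k) x))\<^sup>2)) \<partial>M)"
    proof (rule nn_integral_cong_AE)
      show "AE x in M. ennreal ((cmod (f n x - g x))\<^sup>2)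
          = liminf (\<lambda>k. ennreal ((cmod (f n x - f (s k) x))\<^sup>2))"
        using lim
      proof eventually_elim
        case (elim x)
        have "(\<lambda>k. ennreal ((cmod (f n x - f (s k) x))\<^sup>2)) \<longlonglongrightarrow> ennreal ((cmod (f n x - g x))\<^sup>2)"
          by (intro tendsto_ennrealI tendsto_intros elim)
        then show ?case by (rule lim_imp_Liminf[symmetric, rotated]) simp
      qed
    qed
    also have "\<dots> \<le> liminf (\<lambda>k. \<integral>\<^sup>+x. ennreal ((cmod (f n x - f (s k) x))\<^sup>2) \<partial>M)"
      by (rule nn_integral_liminf) simp
    also have "\<dots> \<le> limsup (\<lambda>k. \<integral>\<^sup>+x. ennreal ((cmod (f n x - f (s k) x))\<^sup>2) \<partial>M)"
      by (rule Liminf_le_Limsup) simp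
    also have "\<dots> \<le> ennreal e"
    proof (rule Limsup_bounded)
      show "\<forall>\<^sub>F k in sequentially. (\<integral>\<^sup>+x. ennreal ((cmod (f n x - f (s k) x))\<^sup>2) \<partial>M) \<le> ennreal e"
        using eventually_ge_at_top[of K]
      proof eventually_elim
        case (elim k)
        then have "(\<integral>x. (cmod (f n x - f (s k) x))\<^sup>2 \<partial>M) < e"
          using s_ge[of k] by (intro that) simp
        then show ?case
          using diff by (subst nn_integral_eq_integral) (auto intro!: ennreal_leI)
      qed
    qed
    finally show ?thesis .
  qed
  have int: "integrable M (\<lambda>x. (cmod (f n x - g x))\<^sup>2)" if "\<And>m. m \<ge> K \<Longrightarrow> (\<integral>x. (cmod (f n x - f m x))\<^sup>2 \<partial>M) < e" for n K e
  proof (rule integrableI_bounded)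
    have "(\<integral>\<^sup>+x. ennreal ((cmod (f n x - g x))\<^sup>2) \<partial>M) \<le> ennreal e"
      using that by (rule le)
    then show "(\<integral>\<^sup>+x. ennreal (norm ((cmod (f n x - g x))\<^sup>2)) \<partial>M) < \<infinity>"
      by (simp add: le_less_trans)
  qed simp
  obtain K where K: "\<And>m n. m \<ge> K \<Longrightarrow> n \<ge> K \<Longrightarrow> (\<integral>x. (cmod (f m x - f n x))\<^sup>2 \<partial>M) < 1"
    using cauchy[of 1] by auto
  \<comment> \<open>No direct bound on \<open>g\<close> is at hand, but its difference from one late
    member is square integrable, hence so is \<open>g\<close>.\<close>
  have sq_K: "square_integrable M (\<lambda>x. f K x - g x)"
    using int[of K K 1, OF K[OF order_refl]] by (simp add: square_integrable_def)
  have g: "square_integrable M g"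
    using square_integrable_diff[OF f[of K] sq_K] by simp
  have "(\<lambda>n. \<integral>x. (cmod (f n x - g x))\<^sup>2 \<partial>M) \<longlonglongrightarrow> 0"
  proof (rule LIMSEQ_I)
    fix e :: real assume "e > 0"
    then obtain K where K: "\<And>m n. m \<ge> K \<Longrightarrow> n \<ge> K \<Longrightarrow> (\<integral>x. (cmod (f m x - f n x))\<^sup>2 \<partial>M) < e / 2"
      using cauchy[of "e / 2"] by auto
    have "norm ((\<integral>x. (cmod (f n x - g x))\<^sup>2 \<partial>M) - 0) < e" if "n \<ge> K" for n
    proof -
      have "(\<integral>\<^sup>+x. ennreal ((cmod (f n x - g x))\<^sup>2) \<partial>M) \<le> ennreal (e / 2)"
        using K[OF that] by (rule le)
      moreover have "integrable M (\<lambda>x. (cmod (f n x - g x))\<^sup>2)"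
        using K[OF that] by (rule int)
      ultimately have "(\<integral>x. (cmod (f n x - g x))\<^sup>2 \<partial>M) \<le> e / 2"
        using \<open>e > 0\<close> by (simp add: nn_integral_eq_integral ennreal_le_iff)
      with \<open>e > 0\<close> show ?thesis by simp
    qed
    then show "\<exists>K. \<forall>n\<ge>K. norm ((\<integral>x. (cmod (f n x - g x))\<^sup>2 \<partial>M) - 0) < e" by blast
  qed
  with g show ?thesis by (rule that)
qed

section \<open>The Fock norm computed on representatives\<close>

lemma fock_carrier_rel: "f \<in> fock_carrier \<Longrightarrow> fock_rel f f"
  by (simp add: fock_rel_def)

text \<open>The equivalence behind \<open>fock\<close> is partial, so membership of the
  representative in \<open>fock_carrier\<close> has to be recorded along with it.\<close>

lemma fock_cases:
  obtains f where "f \<in> fock_carrier" "F = abs_fock f"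
proof
  show "rep_fock F \<in> fock_carrier"
    using Quotient_rep_reflp[OF Quotient_fock, of F] by (simp add: fock_rel_def)
  show "F = abs_fock (rep_fock F)"
    by (rule Quotient_abs_rep[OF Quotient_fock, symmetric])
qed

lemma fock_carrier_diff:
  assumes "f \<in> fock_carrier" "g \<in> fock_carrier"
  shows "(\<lambda>m x. f m x - g m x) \<in> fock_carrier"
  using fock_carrier_add[OF assms(1) fock_carrier_scale[OF assms(2), of "-1"]] by simp

lemma abs_fock_diff:
  assumes "f \<in> fock_carrier" "g \<in> fock_carrier"
  shows "abs_fock f - abs_fock g = abs_fock (\<lambda>m x. f m x - g m x)"
proof -
  note r = fock_carrier_rel[OF assms(1)] fock_carrier_rel[OF assms(2)]
    fock_carrier_rel[OF fock_carrier_scale[OF assms(2), of "-1"]]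
  show ?thesis
    unfolding minus_fock_def uminus_fock_def scale_fock.abs_eq[OF r(2)] plus_fock.abs_eq[OF r(1,3)]
    by simp
qed

lemma norm_fock_square: "(norm F)\<^sup>2 = Re \<langle>F, F\<rangle>"
  unfolding norm_fock_def inner_fock_def by (rule real_sqrt_pow2) (rule cinner_fock_self_nonneg)

lemma norm_abs_fock_square:
  assumes "f \<in> fock_carrier"
  shows "(norm (abs_fock f))\<^sup>2 = (\<Sum>m. \<integral>x. (cmod (f m x))\<^sup>2 \<partial>half_line_pow m)"
  unfolding norm_fock_square cinner_fock.abs_eq[OF fock_carrier_rel[OF assms] fock_carrier_rel[OF assms]]
  by (rule Re_cinner_fock_self[OF assms])

text \<open>The squared norm is a sum of nonnegative contributions of the levels; hence a Cauchy
  sequence of vectors is Cauchy in every level.\<close>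

lemma component_le_norm_abs_fock:
  assumes "f \<in> fock_carrier"
  shows "(\<integral>x. (cmod (f m x))\<^sup>2 \<partial>half_line_pow m) \<le> (norm (abs_fock f))\<^sup>2"
proof -
  have "(\<Sum>k\<in>{m}. \<integral>x. (cmod (f k x))\<^sup>2 \<partial>half_line_pow k)
      \<le> (\<Sum>k. \<integral>x. (cmod (f k x))\<^sup>2 \<partial>half_line_pow k)"
    using assms by (intro sum_le_suminf) (auto simp: fock_carrier_def)
  then show ?thesis using norm_abs_fock_square[OF assms] by simp
qed

text \<open>The limit is built level by level from \<open>square_integrable_complete\<close>.
  Levelwise limits alone would let mass escape to high levels; \<open>partial\<close> excludes this
  by a bound on finitely many levels that does not depend on their number.\<close>

lemma convergent_if_Cauchy_fock:
  fixes X :: "nat \<Rightarrow> fock"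
  assumes X: "Cauchy X"
  shows "convergent X"
proof -
  have "\<exists>f. \<forall>k. f k \<in> fock_carrier \<and> X k = abs_fock (f k)"
    by (intro choice allI) (metis fock_cases)
  then obtain f where f: "\<And>k. f k \<in> fock_carrier" and Xf: "\<And>k. X k = abs_fock (f k)" by blast
  note fd = fock_carrier_diff[OF f f]
  have cau: "\<exists>N. \<forall>i\<ge>N. \<forall>j\<ge>N. (norm (X i - X j))\<^sup>2 < e" if "e > 0" for e
  proof -
    have "sqrt e > 0" using that by simp
    from CauchyD[OF X this] obtain N where N: "\<forall>i\<ge>N. \<forall>j\<ge>N. norm (X i - X j) < sqrt e" by blast
    have "(norm (X i - X j))\<^sup>2 < e" if "i \<ge> N" "j \<ge> N" for i j
      using N that \<open>e > 0\<close> power_strict_mono[of "norm (X i - X j)" "sqrt e" 2] by auto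
    then show ?thesis by blast
  qed
  have "\<exists>g. square_integrable (half_line_pow m) g \<and>
      (\<lambda>k. \<integral>x. (cmod (f k m x - g x))\<^sup>2 \<partial>half_line_pow m) \<longlonglongrightarrow> 0" for m
  proof -
    have sq: "square_integrable (half_line_pow m) (f k m)" for k
      using f by (simp add: fock_carrier_def)
    have "\<exists>N. \<forall>i\<ge>N. \<forall>j\<ge>N. (\<integral>x. (cmod (f i m x - f j m x))\<^sup>2 \<partial>half_line_pow m) < e" if e: "e > 0" for e
    proof -
      obtain N where N: "\<And>i j. i \<ge> N \<Longrightarrow> j \<ge> N \<Longrightarrow> (norm (X i - X j))\<^sup>2 < e"
        using cau[OF e] by blast
      have "(\<integral>x. (cmod (f i m x - f j m x))\<^sup>2 \<partial>half_line_pow m) < e" if "i \<ge> N" "j \<ge> N" for i j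
        using component_le_norm_abs_fock[OF fd] N[OF that]
        unfolding Xf abs_fock_diff[OF f f] by (rule le_less_trans)
      then show ?thesis by blast
    qed
    then obtain g where "square_integrable (half_line_pow m) g"
        "(\<lambda>k. \<integral>x. (cmod (f k m x - g x))\<^sup>2 \<partial>half_line_pow m) \<longlonglongrightarrow> 0"
      by (rule square_integrable_complete[OF sq])
    then show ?thesis by (intro exI conjI)
  qed
  then have "\<exists>g. \<forall>m. square_integrable (half_line_pow m) (g m) \<and>
      (\<lambda>k. \<integral>x. (cmod (f k m x - g m x))\<^sup>2 \<partial>half_line_pow m) \<longlonglongrightarrow> 0"
    by (intro choice allI)
  then obtain g where g: "\<And>m. square_integrable (half_line_pow m) (g m)"
    and lim: "\<And>m. (\<lambda>k. \<integral>x. (cmod (f k m x - g m x))\<^sup>2 \<partial>half_line_pow m) \<longlonglongrightarrow> 0"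
    by blast
  let ?I = "\<lambda>h m. \<integral>x. (cmod (h m x))\<^sup>2 \<partial>half_line_pow m"
  have partial: "(\<Sum>m<M. ?I (\<lambda>m x. f i m x - g m x) m) \<le> e * 2"
    if e: "\<forall>j\<ge>N. (norm (X i - X j))\<^sup>2 < e / 2" for i N M e
  proof (rule field_le_epsilon)
    fix e' :: real assume "e' > 0"
    \<comment> \<open>Only the levels below \<open>M\<close> occur, so a single \<open>j\<close>
      brings \<open>f j\<close> close to \<open>g\<close> on all of them; the slack
      \<open>e'\<close> absorbs the remainder.\<close>
    have "(\<lambda>j. \<Sum>m<M. ?I (\<lambda>m x. f j m x - g m x) m) \<longlonglongrightarrow> (\<Sum>m<M. 0)"
      by (intro tendsto_sum lim)
    then have "\<forall>\<^sub>F j in sequentially. (\<Sum>m<M. ?I (\<lambda>m x. f j m x - g m x) m) < e' / 2"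
      using \<open>e' > 0\<close> by (intro order_tendstoD) auto
    then have "\<forall>\<^sub>F j in sequentially. j \<ge> N \<and> (\<Sum>m<M. ?I (\<lambda>m x. f j m x - g m x) m) < e' / 2"
      using eventually_ge_at_top[of N] by eventually_elim simp
    then obtain j where j: "j \<ge> N" "(\<Sum>m<M. ?I (\<lambda>m x. f j m x - g m x) m) < e' / 2"
      using eventually_happens'[OF sequentially_bot] by blast
    have "(\<Sum>m<M. ?I (\<lambda>m x. f i m x - g m x) m)
        \<le> (\<Sum>m<M. 2 * (?I (\<lambda>m x. f i m x - f j m x) m + ?I (\<lambda>m x. f j m x - g m x) m))"
    proof (rule sum_mono)
      fix m
      have "square_integrable (half_line_pow m) (\<lambda>x. f i m x - f j m x)"
        "square_integrable (half_line_pow m) (\<lambda>x. f j m x - g m x)"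
        using f g by (auto intro!: square_integrable_diff simp: fock_carrier_def)
      from square_integrable_add(2)[OF this]
      show "?I (\<lambda>m x. f i m x - g m x) m
          \<le> 2 * (?I (\<lambda>m x. f i m x - f j m x) m + ?I (\<lambda>m x. f j m x - g m x) m)" by simp
    qed
    also have "\<dots> = 2 * ((\<Sum>m<M. ?I (\<lambda>m x. f i m x - f j m x) m) + (\<Sum>m<M. ?I (\<lambda>m x. f j m x - g m x) m))"
      by (simp add: sum_distrib_left sum.distrib)
    also have "(\<Sum>m<M. ?I (\<lambda>m x. f i m x - f j m x) m) \<le> (norm (X i - X j))\<^sup>2"
      unfolding Xf abs_fock_diff[OF f f] norm_abs_fock_square[OF fd]
      using fd[of i j] by (intro sum_le_suminf) (auto simp: fock_carrier_def)
    also have "(norm (X i - X j))\<^sup>2 \<le> e"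
    proof -
      have "(norm (X i - X j))\<^sup>2 < e / 2" using e j(1) by blast
      moreover from this have "0 < e / 2" by (rule le_less_trans[OF zero_le_power2])
      ultimately show ?thesis by simp
    qed
    also have "2 * (e + (\<Sum>m<M. ?I (\<lambda>m x. f j m x - g m x) m)) \<le> e * 2 + e'" using j(2) by simp
    finally show "(\<Sum>m<M. ?I (\<lambda>m x. f i m x - g m x) m) \<le> e * 2 + e'" by simp
  qed
  have carr: "(\<lambda>m x. f i m x - g m x) \<in> fock_carrier"
    if "\<forall>j\<ge>N. (norm (X i - X j))\<^sup>2 < e / 2" for i N e
    unfolding fock_carrier_def mem_Collect_eq
  proof (intro conjI allI)
    show "summable (?I (\<lambda>m x. f i m x - g m x))"
      using partial[OF that] by (intro summableI_nonneg_bounded) auto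
  qed (use f g in \<open>auto intro!: square_integrable_diff simp: fock_carrier_def\<close>)
  obtain N where N: "\<forall>i\<ge>N. \<forall>j\<ge>N. (norm (X i - X j))\<^sup>2 < 1 / 2" using cau[of "1/2"] by auto
  \<comment> \<open>Here \<open>e = 1\<close>; subtracting this difference from \<open>f N\<close>
    recovers \<open>g\<close>.\<close>
  have "(\<lambda>m x. f N m x - g m x) \<in> fock_carrier" using N by (intro carr[of N N 1]) simp
  from fock_carrier_diff[OF f[of N] this] have g_carr: "g \<in> fock_carrier" by simp
  have "X \<longlonglongrightarrow> abs_fock g"
  proof (rule LIMSEQ_I)
    fix r :: real assume "r > 0"
    \<comment> \<open>Chosen so that the bound \<open>e * 2\<close> from \<open>partial\<close> is
      half the square of \<open>r\<close>, hence strictly below it.\<close>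
    define e where "e = r\<^sup>2 / 4"
    have "e / 2 > 0" using \<open>r > 0\<close> by (simp add: e_def)
    from cau[OF this] obtain N where N: "\<forall>i\<ge>N. \<forall>j\<ge>N. (norm (X i - X j))\<^sup>2 < e / 2" by blast
    have "norm (X i - abs_fock g) < r" if "i \<ge> N" for i
    proof -
      from N that have Ni: "\<forall>j\<ge>N. (norm (X i - X j))\<^sup>2 < e / 2" by blast
      have "(norm (X i - abs_fock g))\<^sup>2 = (\<Sum>m. ?I (\<lambda>m x. f i m x - g m x) m)"
        unfolding Xf abs_fock_diff[OF f g_carr] by (rule norm_abs_fock_square[OF carr[OF Ni]])
      also have "\<dots> \<le> e * 2"
        using carr[OF Ni] partial[OF Ni] by (intro suminf_le_const) (auto simp: fock_carrier_def)
      also have "\<dots> < r\<^sup>2" using \<open>r > 0\<close> by (simp add: e_def)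
      finally show ?thesis using \<open>r > 0\<close> by (simp add: power_less_imp_less_base)
    qed
    then show "\<exists>N. \<forall>i\<ge>N. norm (X i - abs_fock g) < r" by blast
  qed
  then show ?thesis by (auto simp: convergent_def)
qed

instance fock :: complete_space
  by standard (rule convergent_if_Cauchy_fock)

section \<open>Bounded complex-linear operators\<close>

lemma cinner_add_left: "\<langle>F + G, H\<rangle> = \<langle>F, H\<rangle> + \<langle>G, H\<rangle>"
  by (subst (1 2 3) cinner_fock_commute) (simp add: cinner_fock_add_right)

lemma cinner_scale_left: "\<langle>c *\<^sub>C F, G\<rangle> = cnj c * \<langle>F, G\<rangle>"
  by (subst (1 2) cinner_fock_commute) (simp add: cinner_fock_scale_right)

lemma cinner_diff_right: "\<langle>F, G - H\<rangle> = \<langle>F, G\<rangle> - \<langle>F, H\<rangle>"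
proof -
  have "\<langle>F, G - H\<rangle> = \<langle>F, G + (-1) *\<^sub>C H\<rangle>" by simp
  also have "\<dots> = \<langle>F, G\<rangle> - \<langle>F, H\<rangle>"
    unfolding cinner_fock_add_right cinner_fock_scale_right by simp
  finally show ?thesis .
qed

lemma cinner_zero [simp]: "\<langle>F, 0\<rangle> = 0" "\<langle>0, F\<rangle> = 0"
  using cinner_fock_scale_right[of F 0 0] cinner_scale_left[of 0 0 F] by simp_all

lemma cinner_sum_left: "\<langle>\<Sum>i\<in>I. G i, F\<rangle> = (\<Sum>i\<in>I. \<langle>G i, F\<rangle>)"
  by (induction I rule: infinite_finite_induct) (simp_all add: cinner_add_left)

lemma cinner_self: "\<langle>F, F\<rangle> = complex_of_real ((norm F)\<^sup>2)"
proof (rule complex_eqI)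
  have "Im \<langle>F, F\<rangle> = - Im \<langle>F, F\<rangle>" by (subst (1) cinner_fock_commute) simp
  then show "Im \<langle>F, F\<rangle> = Im (complex_of_real ((norm F)\<^sup>2))" by simp
qed (simp add: norm_fock_square)

lemma norm_scale_fock: "norm (c *\<^sub>C F) = cmod c * norm F"
proof -
  have "complex_of_real ((norm (c *\<^sub>C F))\<^sup>2) = cnj c * (c * \<langle>F, F\<rangle>)"
    by (simp add: cinner_self[symmetric] cinner_scale_left cinner_fock_scale_right del: of_real_power)
  also have "\<dots> = complex_of_real ((cmod c * norm F)\<^sup>2)"
    by (simp add: cinner_self power_mult_distrib complex_norm_square mult_ac del: of_real_power)
  finally have "(norm (c *\<^sub>C F))\<^sup>2 = (cmod c * norm F)\<^sup>2" by (simp only: of_real_eq_iff)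
  then show ?thesis by simp
qed

text \<open>The real Cauchy-Schwarz inequality applies once \<open>G\<close> is multiplied by the
  phase \<open>c\<close> that makes the scalar product real and nonnegative.\<close>

lemma cmod_cinner_le: "cmod \<langle>F, G\<rangle> \<le> norm F * norm G"
proof (cases "\<langle>F, G\<rangle> = 0")
  case False
  define c where "c = cnj \<langle>F, G\<rangle> / complex_of_real (cmod \<langle>F, G\<rangle>)"
  have "cmod c = 1" using False by (simp add: c_def norm_divide)
  have "\<langle>F, c *\<^sub>C G\<rangle> = complex_of_real (cmod \<langle>F, G\<rangle>)"
    using False complex_norm_square[of "\<langle>F, G\<rangle>"]
    by (simp add: cinner_fock_scale_right c_def field_simps power2_eq_square)
  then have "cmod \<langle>F, G\<rangle> = F \<bullet> (c *\<^sub>C G)" by (simp add: inner_fock_def)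
  also have "\<dots> \<le> norm F * norm (c *\<^sub>C G)" by (rule norm_cauchy_schwarz)
  finally show ?thesis using \<open>cmod c = 1\<close> by (simp add: norm_scale_fock)
qed simp

lemma bounded_linear_cinner: "bounded_linear (\<lambda>G. \<langle>F, G\<rangle>)"
  by (rule bounded_linear_intro[of _ "norm F"])
    (auto simp: cinner_fock_add_right scaleR_fock_def cinner_fock_scale_right scaleR_conv_of_real
      cmod_cinner_le mult.commute[of _ "norm F"])

lemma bounded_linear_scale_fock: "bounded_linear (\<lambda>F. c *\<^sub>C F)"
  by (rule bounded_linear_intro[of _ "cmod c"])
    (auto simp: scaleR_fock_def scale_fock_add_right scale_fock_scale mult.commute norm_scale_fock)

lemma continuous_cinner [continuous_intros]:
  "continuous_on A f \<Longrightarrow> continuous_on A (\<lambda>x. \<langle>F, f x\<rangle>)"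
  by (rule bounded_linear.continuous_on[OF bounded_linear_cinner])

lemma continuous_cinner_left [continuous_intros]:
  assumes "continuous_on A f"
  shows "continuous_on A (\<lambda>x. \<langle>f x, F\<rangle>)"
  by (subst cinner_fock_commute) (intro continuous_intros assms)

text \<open>The type \<open>fock\<close> carries only a real inner product structure, so complex
  homogeneity is a separate condition. Without it, agreement on the basis would not extend to the
  complex span.\<close>

definition bounded_clinear :: "(fock \<Rightarrow> fock) \<Rightarrow> bool" where
  "bounded_clinear T \<longleftrightarrow> bounded_linear T \<and> (\<forall>c F. T (c *\<^sub>C F) = c *\<^sub>C T F)"

lemma bounded_clinearI:
  assumes "\<And>F G. T (F + G) = T F + T G" "\<And>c F. T (c *\<^sub>C F) = c *\<^sub>C T F"
    and "\<And>F. norm (T F) \<le> K * norm F"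
  shows "bounded_clinear T"
  unfolding bounded_clinear_def using assms
  by (auto intro!: bounded_linear_intro[of _ K] simp: scaleR_fock_def mult.commute)

lemma bounded_clinearD:
  assumes "bounded_clinear T"
  shows "bounded_linear T" "T (c *\<^sub>C F) = c *\<^sub>C T F" "T (F + G) = T F + T G" "T (F - G) = T F - T G"
    "T 0 = 0"
  using assms
  by (auto simp: bounded_clinear_def linear_simps)

lemma bounded_clinear_add:
  assumes "bounded_clinear T" "bounded_clinear S"
  shows "bounded_clinear (\<lambda>F. T F + S F)"
  using assms by (auto simp: bounded_clinear_def bounded_linear_add scale_fock_add_right)

lemma bounded_clinear_scale:
  assumes "bounded_clinear T"
  shows "bounded_clinear (\<lambda>F. c *\<^sub>C T F)"
  using assms bounded_linear_compose[OF bounded_linear_scale_fock]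
  by (auto simp: bounded_clinear_def scale_fock_scale mult.commute)

lemma bounded_clinear_scaleR: "bounded_clinear T \<Longrightarrow> bounded_clinear (\<lambda>F. r *\<^sub>R T F)"
  unfolding scaleR_fock_def by (rule bounded_clinear_scale)

lemma bounded_clinear_ident: "bounded_clinear (\<lambda>F. F)"
  by (simp add: bounded_clinear_def)

lemma bounded_clinear_zero: "bounded_clinear (\<lambda>F. 0)"
  by (simp add: bounded_clinear_def)

lemma bounded_clinear_diff:
  assumes "bounded_clinear T" "bounded_clinear S"
  shows "bounded_clinear (\<lambda>F. T F - S F)"
  using bounded_clinear_add[OF assms(1) bounded_clinear_scale[OF assms(2), of "-1"]]
  by simp

lemma bounded_clinear_compose:
  assumes "bounded_clinear T" "bounded_clinear S"
  shows "bounded_clinear (\<lambda>F. T (S F))"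
  using assms by (auto simp: bounded_clinear_def intro: bounded_linear_compose)

lemma bounded_clinear_sum:
  assumes "\<And>i. i \<in> I \<Longrightarrow> bounded_clinear (T i)"
  shows "bounded_clinear (\<lambda>F. \<Sum>i\<in>I. T i F)"
  using assms
  by (induction I rule: infinite_finite_induct) (auto intro: bounded_clinear_add bounded_clinear_zero)

lemma bounded_clinear_continuous_on: "bounded_clinear T \<Longrightarrow> continuous_on A T"
  by (simp add: bounded_clinear_def linear_continuous_on)

section \<open>The toy Fock space and its operators\<close>

lemma toy_vec_in_toy_fock: "\<sigma> \<in> adapted \<Longrightarrow> toy_vec n \<sigma> \<in> toy_fock n"
  unfolding toy_fock_def by (intro subsetD[OF closure_subset] fock.span_base imageI)

lemma closed_toy_fock: "closed (toy_fock n)"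
  by (simp add: toy_fock_def)

lemma toy_fock_add:
  assumes "F \<in> toy_fock n" "G \<in> toy_fock n"
  shows "F + G \<in> toy_fock n"
proof -
  from assms obtain u v where
    "\<forall>k. u k \<in> fock.span (toy_vec n ` adapted)" "u \<longlonglongrightarrow> F"
    "\<forall>k. v k \<in> fock.span (toy_vec n ` adapted)" "v \<longlonglongrightarrow> G"
    unfolding toy_fock_def closure_sequential by blast
  then have "\<forall>k. u k + v k \<in> fock.span (toy_vec n ` adapted)" "(\<lambda>k. u k + v k) \<longlonglongrightarrow> F + G"
    by (auto intro: fock.span_add tendsto_add)
  then show ?thesis
    unfolding toy_fock_def closure_sequential by (intro exI[of _ "\<lambda>k. u k + v k"] conjI)
qed

lemma toy_fock_scale: "F \<in> toy_fock n \<Longrightarrow> c *\<^sub>C F \<in> toy_fock n"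
proof -
  let ?S = "fock.span (toy_vec n ` adapted)"
  have "(\<lambda>F. c *\<^sub>C F) ` closure ?S \<subseteq> closure ?S"
  proof (rule image_closure_subset)
    show "(\<lambda>F. c *\<^sub>C F) ` ?S \<subseteq> closure ?S"
      using closure_subset[of ?S] by (auto intro: fock.span_scale)
  qed (auto intro: linear_continuous_on bounded_linear_scale_fock)
  then show "F \<in> toy_fock n \<Longrightarrow> c *\<^sub>C F \<in> toy_fock n" by (auto simp: toy_fock_def)
qed

lemma toy_fock_scaleR: "F \<in> toy_fock n \<Longrightarrow> r *\<^sub>R F \<in> toy_fock n"
  by (simp add: scaleR_fock_def toy_fock_scale)

lemma toy_fock_zero: "0 \<in> toy_fock n"
  using toy_fock_scale[OF toy_vec_in_toy_fock[of "[]" n], of 0] by simp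

lemma toy_fock_sum: "(\<And>i. i \<in> I \<Longrightarrow> F i \<in> toy_fock n) \<Longrightarrow> (\<Sum>i\<in>I. F i) \<in> toy_fock n"
  by (induction I rule: infinite_finite_induct) (auto intro: toy_fock_add toy_fock_zero)

lemma toy_fock_induct [consumes 1, case_names closed zero add scale basis]:
  assumes "F \<in> toy_fock n" "closed {F. P F}" "P 0" "\<And>F G. P F \<Longrightarrow> P G \<Longrightarrow> P (F + G)"
    "\<And>c F. P F \<Longrightarrow> P (c *\<^sub>C F)" "\<And>\<sigma>. \<sigma> \<in> adapted \<Longrightarrow> P (toy_vec n \<sigma>)"
  shows "P F"
proof -
  have "fock.subspace {F. P F}" using assms by (auto simp: fock.subspace_def)
  then have "fock.span (toy_vec n ` adapted) \<subseteq> {F. P F}"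
    using assms(6) by (intro fock.span_minimal) auto
  then have "toy_fock n \<subseteq> {F. P F}"
    unfolding toy_fock_def using assms(2) by (rule closure_minimal)
  with assms(1) show ?thesis by auto
qed

lemma bounded_clinear_eq_on_toy_fock:
  assumes "bounded_clinear T" "bounded_clinear S"
    and "\<And>\<sigma>. \<sigma> \<in> adapted \<Longrightarrow> T (toy_vec n \<sigma>) = S (toy_vec n \<sigma>)" and "F \<in> toy_fock n"
  shows "T F = S F"
  using assms(4)
proof (induction rule: toy_fock_induct)
  case closed
  show ?case using assms by (intro closed_Collect_eq bounded_clinear_continuous_on)
qed (use assms in \<open>auto simp: bounded_clinearD\<close>)

definition orthogonal_family :: "(nat list \<Rightarrow> fock) \<Rightarrow> bool" where
  "orthogonal_family A \<longleftrightarrow>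
     (\<forall>\<sigma>\<in>adapted. norm (A \<sigma>) \<le> 1 \<and> (\<forall>\<tau>\<in>adapted. \<sigma> \<noteq> \<tau> \<longrightarrow> \<langle>A \<sigma>, A \<tau>\<rangle> = 0))"

lemma norm_toy_vec: "n \<ge> 1 \<Longrightarrow> norm (toy_vec n \<sigma>) = 1"
  using norm_fock_square[of "toy_vec n \<sigma>"] by (simp add: toy_vec_orthonormal abs_square_eq_1 power2_eq_1_iff)

text \<open>\<open>toy_vec_orthonormal\<close> holds for all words, so \<open>g\<close> may lead out
  of the adapted ones; \<open>toy_diagonal\<close> relies on this.\<close>

lemma orthogonal_family_partial_toy_vec:
  assumes "n \<ge> 1" "inj_on g {\<sigma>\<in>adapted. Q \<sigma>}"
    and "\<And>\<sigma>. \<sigma> \<in> adapted \<Longrightarrow> A \<sigma> = (if Q \<sigma> then toy_vec n (g \<sigma>) else 0)"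
  shows "orthogonal_family A"
  unfolding orthogonal_family_def using assms
  by (auto simp: norm_toy_vec toy_vec_orthonormal inj_on_def)

lemma orthogonal_family_toy_vec: "n \<ge> 1 \<Longrightarrow> orthogonal_family (toy_vec n)"
  by (rule orthogonal_family_partial_toy_vec[where g = "\<lambda>\<sigma>. \<sigma>" and Q = "\<lambda>_. True"]) auto

lemma norm_sum_orthogonal_family:
  assumes A: "orthogonal_family A" and S: "finite S" "S \<subseteq> adapted"
  shows "(norm (\<Sum>\<sigma>\<in>S. c \<sigma> *\<^sub>C A \<sigma>))\<^sup>2 \<le> (\<Sum>\<sigma>\<in>S. (cmod (c \<sigma>))\<^sup>2)"
proof -
  have "pairwise (\<lambda>\<sigma> \<tau>. orthogonal (c \<sigma> *\<^sub>C A \<sigma>) (c \<tau> *\<^sub>C A \<tau>)) S"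
    using A S
    by (auto simp: pairwise_def orthogonal_def inner_fock_def cinner_scale_left cinner_fock_scale_right
        orthogonal_family_def subset_iff)
  then have "(norm (\<Sum>\<sigma>\<in>S. c \<sigma> *\<^sub>C A \<sigma>))\<^sup>2 = (\<Sum>\<sigma>\<in>S. (norm (c \<sigma> *\<^sub>C A \<sigma>))\<^sup>2)"
    using S(1) by (intro norm_sum_Pythagorean) (auto simp: pairwise_def)
  also have "\<dots> \<le> (\<Sum>\<sigma>\<in>S. (cmod (c \<sigma>))\<^sup>2)"
  proof (rule sum_mono)
    fix \<sigma> assume "\<sigma> \<in> S"
    then have "norm (A \<sigma>) \<le> 1" using A S by (auto simp: orthogonal_family_def)
    then have "cmod (c \<sigma>) * norm (A \<sigma>) \<le> cmod (c \<sigma>)" by (simp add: mult_left_le)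
    then show "(norm (c \<sigma> *\<^sub>C A \<sigma>))\<^sup>2 \<le> (cmod (c \<sigma>))\<^sup>2"
      unfolding norm_scale_fock by (intro power_mono) auto
  qed
  finally show ?thesis .
qed

text \<open>Pairing \<open>F\<close> with its partial sum \<open>?P\<close> gives exactly
  \<open>?s\<close>. Cauchy-Schwarz and the bound of the squared norm of \<open>?P\<close> by
  \<open>?s\<close> then yield that the square of \<open>?s\<close> is at most \<open>?s\<close>
  times the squared norm of \<open>F\<close>.\<close>

lemma Bessel_inequality:
  assumes n: "n \<ge> 1" and S: "finite S" "S \<subseteq> adapted"
  shows "(\<Sum>\<sigma>\<in>S. (cmod \<langle>toy_vec n \<sigma>, F\<rangle>)\<^sup>2) \<le> (norm F)\<^sup>2"
proof -
  let ?P = "\<Sum>\<sigma>\<in>S. \<langle>toy_vec n \<sigma>, F\<rangle> *\<^sub>C toy_vec n \<sigma>"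
  let ?s = "\<Sum>\<sigma>\<in>S. (cmod \<langle>toy_vec n \<sigma>, F\<rangle>)\<^sup>2"
  have s: "?s \<ge> 0" by (intro sum_nonneg) auto
  have P: "(norm ?P)\<^sup>2 \<le> ?s"
    by (rule norm_sum_orthogonal_family[OF orthogonal_family_toy_vec[OF n] S])
  have "\<langle>?P, F\<rangle> = complex_of_real ?s"
    by (simp add: cinner_sum_left cinner_scale_left mult.commute[of "cnj _"] complex_norm_square del: of_real_power)
  then have "?s = cmod \<langle>?P, F\<rangle>" using s by (simp only: norm_of_real abs_of_nonneg)
  also have "\<dots> \<le> norm ?P * norm F" by (rule cmod_cinner_le)
  finally have "?s\<^sup>2 \<le> (norm ?P * norm F)\<^sup>2" using s by (intro power_mono)
  also have "\<dots> \<le> ?s * (norm F)\<^sup>2" using P by (simp add: power_mult_distrib mult_right_mono)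
  finally show ?thesis using s by (cases "?s = 0") (auto simp: power2_eq_square[of ?s])
qed

text \<open>A finite partial sum is controlled by the square sum of its coefficients, so the net of
  partial sums is Cauchy; completeness supplies the limit.\<close>

lemma summable_on_orthogonal_family:
  assumes A: "orthogonal_family A" and c: "(\<lambda>\<sigma>. (cmod (c \<sigma>))\<^sup>2) summable_on adapted"
  shows "(\<lambda>\<sigma>. c \<sigma> *\<^sub>C A \<sigma>) summable_on adapted"
proof -
  let ?f = "\<lambda>\<sigma>. c \<sigma> *\<^sub>C A \<sigma>" and ?g = "\<lambda>\<sigma>. (cmod (c \<sigma>))\<^sup>2"
  let ?L = "infsum ?g adapted"
  have L: "(?g has_sum ?L) adapted" using c by simp
  have "\<exists>P. eventually P (finite_subsets_at_top adapted) \<and>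
      (\<forall>S S'. P S \<and> P S' \<longrightarrow> dist (sum ?f S) (sum ?f S') < e)" if "e > 0" for e
  proof -
    \<comment> \<open>The outer halving serves strictness: the approximation comes with \<le>, the
      Cauchy condition asks for <.\<close>
    have "(e / 2)\<^sup>2 / 2 > 0" using that by simp
    then obtain S0 where S0: "finite S0" "S0 \<subseteq> adapted" "dist (sum ?g S0) ?L \<le> (e / 2)\<^sup>2 / 2"
      using has_sum_finite_approximation[OF L] by blast
    have le: "dist (sum ?f S) (sum ?f S0) < e / 2" if S: "finite S" "S0 \<subseteq> S" "S \<subseteq> adapted" for S
    proof -
      have "(dist (sum ?f S) (sum ?f S0))\<^sup>2 = (norm (sum ?f (S - S0)))\<^sup>2"
        using S by (simp add: dist_norm sum_diff)
      also have "\<dots> \<le> sum ?g (S - S0)"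
        using S by (intro norm_sum_orthogonal_family A) auto
      also have "\<dots> = sum ?g S - sum ?g S0" using S by (simp add: sum_diff)
      also have "\<dots> \<le> ?L - sum ?g S0"
        using S by (intro diff_right_mono finite_sum_le_infsum c) auto
      also have "\<dots> \<le> (e / 2)\<^sup>2 / 2" using S0(3) unfolding dist_real_def by linarith
      also have "\<dots> < (e / 2)\<^sup>2" using \<open>e > 0\<close> by simp
      finally show ?thesis by (rule power_less_imp_less_base) (use \<open>e > 0\<close> in simp)
    qed
    have "dist (sum ?f S) (sum ?f S') < e"
      if "finite S" "S0 \<subseteq> S" "S \<subseteq> adapted" "finite S'" "S0 \<subseteq> S'" "S' \<subseteq> adapted" for S S'
      using le[OF that(1-3)] le[OF that(4-6)] by (rule dist_triangle_half_l)
    then show ?thesis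
      using S0 by (intro exI[of _ "\<lambda>S. finite S \<and> S0 \<subseteq> S \<and> S \<subseteq> adapted"])
        (auto simp: eventually_finite_subsets_at_top)
  qed
  then have cauchy: "cauchy_filter (filtermap (sum ?f) (finite_subsets_at_top adapted))"
    by (simp add: cauchy_filter_metric_filtermap)
  obtain L' where "filtermap (sum ?f) (finite_subsets_at_top adapted) \<le> nhds L'"
    using cauchy_filter_complete_converges[OF cauchy complete_UNIV_cuspace] by (auto simp: filtermap_bot_iff)
  then have "(sum ?f \<longlongrightarrow> L') (finite_subsets_at_top adapted)" by (simp add: filterlim_def)
  then show ?thesis by (auto simp: summable_on_def has_sum_def)
qed

lemma summable_on_toy_op:
  assumes "n \<ge> 1" "orthogonal_family A"
  shows "(\<lambda>\<sigma>. \<langle>toy_vec n \<sigma>, F\<rangle> *\<^sub>C A \<sigma>) summable_on adapted"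
proof (rule summable_on_orthogonal_family[OF assms(2)])
  show "(\<lambda>\<sigma>. (cmod \<langle>toy_vec n \<sigma>, F\<rangle>)\<^sup>2) summable_on adapted"
  proof (rule nonneg_bdd_above_summable_on)
    show "bdd_above (sum (\<lambda>\<sigma>. (cmod \<langle>toy_vec n \<sigma>, F\<rangle>)\<^sup>2) ` {S. S \<subseteq> adapted \<and> finite S})"
      by (rule bdd_aboveI2[where M = "(norm F)\<^sup>2"]) (use Bessel_inequality[OF assms(1)] in auto)
  qed simp
qed

lemma toy_op_tendsto:
  assumes "n \<ge> 1" "orthogonal_family A"
  shows "((\<lambda>S. \<Sum>\<sigma>\<in>S. \<langle>toy_vec n \<sigma>, F\<rangle> *\<^sub>C A \<sigma>) \<longlongrightarrow> toy_op n A F) (finite_subsets_at_top adapted)"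
  unfolding toy_op_def by (rule infsum_tendsto[OF summable_on_toy_op[OF assms]])

text \<open>The bound 1 is the same for all \<open>n\<close> and all families; it makes the
  projections uniformly bounded in the passage to the limit.\<close>

lemma norm_toy_op_le:
  assumes "n \<ge> 1" "orthogonal_family A"
  shows "norm (toy_op n A F) \<le> norm F"
proof (rule tendsto_upperbound[OF tendsto_norm[OF toy_op_tendsto[OF assms]]])
  show "\<forall>\<^sub>F S in finite_subsets_at_top adapted. norm (\<Sum>\<sigma>\<in>S. \<langle>toy_vec n \<sigma>, F\<rangle> *\<^sub>C A \<sigma>) \<le> norm F"
  proof (rule eventually_finite_subsets_at_top_weakI)
    fix S :: "nat list set" assume S: "finite S" "S \<subseteq> adapted"
    have "(norm (\<Sum>\<sigma>\<in>S. \<langle>toy_vec n \<sigma>, F\<rangle> *\<^sub>C A \<sigma>))\<^sup>2 \<le> (norm F)\<^sup>2"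
      using norm_sum_orthogonal_family[OF assms(2) S] Bessel_inequality[OF assms(1) S]
      by (rule order_trans)
    then show "norm (\<Sum>\<sigma>\<in>S. \<langle>toy_vec n \<sigma>, F\<rangle> *\<^sub>C A \<sigma>) \<le> norm F" by (rule power2_le_imp_le) simp
  qed
qed simp

lemma bounded_clinear_toy_op:
  assumes "n \<ge> 1" "orthogonal_family A"
  shows "bounded_clinear (toy_op n A)"
proof (rule bounded_clinearI[where K = 1])
  note s = summable_on_toy_op[OF assms]
  fix F G c
  show "toy_op n A (F + G) = toy_op n A F + toy_op n A G"
    unfolding toy_op_def infsum_add[OF s s, symmetric]
    by (simp add: cinner_fock_add_right scale_fock_add_left)
  show "toy_op n A (c *\<^sub>C F) = c *\<^sub>C toy_op n A F"
    unfolding toy_op_def using infsumI[OF has_sum_bounded_linear[OF bounded_linear_scale_fock has_sum_infsum[OF s]]]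
    by (simp add: cinner_fock_scale_right scale_fock_scale)
qed (use norm_toy_op_le[OF assms] in simp)

lemma toy_op_in_toy_fock:
  assumes "n \<ge> 1" "orthogonal_family A" "\<And>\<sigma>. \<sigma> \<in> adapted \<Longrightarrow> A \<sigma> \<in> toy_fock n"
  shows "toy_op n A F \<in> toy_fock n"
proof (rule Lim_in_closed_set[OF closed_toy_fock _ _ toy_op_tendsto[OF assms(1,2)]])
  show "\<forall>\<^sub>F S in finite_subsets_at_top adapted. (\<Sum>\<sigma>\<in>S. \<langle>toy_vec n \<sigma>, F\<rangle> *\<^sub>C A \<sigma>) \<in> toy_fock n"
    using assms(3)
    by (intro eventually_finite_subsets_at_top_weakI toy_fock_sum toy_fock_scale) auto
qed simp

section \<open>The algebra of operators living on the toy Fock space\<close>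

lemma toy_boundedI:
  assumes "bounded_clinear T" "\<And>F. T F \<in> toy_fock n"
    "\<And>F. (\<And>G. G \<in> toy_fock n \<Longrightarrow> \<langle>G, F\<rangle> = 0) \<Longrightarrow> T F = 0"
  shows "T \<in> toy_bounded n"
  using assms by (auto simp: toy_bounded_def bounded_clinear_def)

lemma toy_boundedD:
  assumes "T \<in> toy_bounded n"
  shows "bounded_clinear T" "T F \<in> toy_fock n" "(\<And>G. G \<in> toy_fock n \<Longrightarrow> \<langle>G, F\<rangle> = 0) \<Longrightarrow> T F = 0"
  using assms by (auto simp: toy_bounded_def bounded_clinear_def)

lemma toy_op_bounded:
  assumes "n \<ge> 1" "orthogonal_family A" "\<And>\<sigma>. \<sigma> \<in> adapted \<Longrightarrow> A \<sigma> \<in> toy_fock n"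
  shows "toy_op n A \<in> toy_bounded n"
  using assms
  by (intro toy_boundedI bounded_clinear_toy_op toy_op_in_toy_fock toy_op_orthogonal) auto

lemma toy_bounded_add:
  "T \<in> toy_bounded n \<Longrightarrow> S \<in> toy_bounded n \<Longrightarrow> (\<lambda>F. T F + S F) \<in> toy_bounded n"
  by (intro toy_boundedI bounded_clinear_add toy_fock_add) (auto simp: toy_boundedD)

lemma toy_bounded_scale: "T \<in> toy_bounded n \<Longrightarrow> (\<lambda>F. c *\<^sub>C T F) \<in> toy_bounded n"
  by (intro toy_boundedI bounded_clinear_scale toy_fock_scale) (auto simp: toy_boundedD)

lemma toy_bounded_compose:
  assumes T: "T \<in> toy_bounded n" and S: "S \<in> toy_bounded n"
  shows "T \<circ> S \<in> toy_bounded n"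
  unfolding comp_def
proof (rule toy_boundedI)
  show "bounded_clinear (\<lambda>F. T (S F))"
    by (rule bounded_clinear_compose[OF toy_boundedD(1)[OF T] toy_boundedD(1)[OF S]])
  show "T (S F) \<in> toy_fock n" for F by (rule toy_boundedD(2)[OF T])
  show "T (S F) = 0" if "\<And>G. G \<in> toy_fock n \<Longrightarrow> \<langle>G, F\<rangle> = 0" for F
    using toy_boundedD(3)[OF S that] bounded_clinearD(5)[OF toy_boundedD(1)[OF T]] by simp
qed

lemma toy_unit_bounded: "n \<ge> 1 \<Longrightarrow> toy_unit n \<in> toy_bounded n"
  unfolding toy_unit_def
  by (intro toy_op_bounded orthogonal_family_toy_vec toy_vec_in_toy_fock)

lemma toy_unit_toy_vec: "n \<ge> 1 \<Longrightarrow> \<sigma> \<in> adapted \<Longrightarrow> toy_unit n (toy_vec n \<sigma>) = toy_vec n \<sigma>"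
  by (simp add: toy_unit_def toy_op_toy_vec)

lemma norm_toy_unit_le: "n \<ge> 1 \<Longrightarrow> norm (toy_unit n F) \<le> norm F"
  unfolding toy_unit_def by (intro norm_toy_op_le orthogonal_family_toy_vec)

lemma toy_unit_toy_fock:
  assumes "n \<ge> 1" "F \<in> toy_fock n"
  shows "toy_unit n F = F"
  by (rule bounded_clinear_eq_on_toy_fock[OF toy_boundedD(1)[OF toy_unit_bounded] bounded_clinear_ident])
    (use assms in \<open>simp_all add: toy_unit_toy_vec\<close>)

text \<open>Since \<open>toy_unit n\<close> maps into the toy Fock space, this identifies it as the
  orthogonal projection onto that space.\<close>

lemma cinner_toy_unit_diff:
  assumes n: "n \<ge> 1" and "G \<in> toy_fock n"
  shows "\<langle>G, F - toy_unit n F\<rangle> = 0"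
  using assms(2)
proof (induction rule: toy_fock_induct)
  case closed
  show ?case by (intro closed_Collect_eq continuous_intros)
next
  case (basis \<sigma>)
  have "\<langle>toy_vec n \<sigma>, toy_unit n F\<rangle> = (\<Sum>\<^sub>\<infinity>\<tau>\<in>adapted. \<langle>toy_vec n \<tau>, F\<rangle> * \<langle>toy_vec n \<sigma>, toy_vec n \<tau>\<rangle>)"
    unfolding toy_unit_def toy_op_def
    using infsumI[OF has_sum_bounded_linear[OF bounded_linear_cinner
          has_sum_infsum[OF summable_on_toy_op[OF n orthogonal_family_toy_vec[OF n]]]]]
    by (simp add: cinner_fock_scale_right)
  also have "\<dots> = (\<Sum>\<^sub>\<infinity>\<tau>\<in>{\<sigma>}. \<langle>toy_vec n \<tau>, F\<rangle> * \<langle>toy_vec n \<sigma>, toy_vec n \<tau>\<rangle>)"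
    using basis n by (intro infsum_cong_neutral) (auto simp: toy_vec_orthonormal)
  finally show ?case using n by (simp add: cinner_diff_right toy_vec_orthonormal)
qed (auto simp: cinner_add_left cinner_scale_left)

text \<open>The difference \<open>F - toy_unit n F\<close> is orthogonal to the toy Fock space and
  is therefore killed by \<open>T\<close>. This reduces identities on the whole space to identities
  on basis vectors.\<close>

lemma toy_bounded_toy_unit:
  assumes "n \<ge> 1" "T \<in> toy_bounded n"
  shows "T (toy_unit n F) = T F"
proof -
  have "T (F - toy_unit n F) = 0"
    using assms by (intro toy_boundedD(3)) (auto simp: cinner_toy_unit_diff)
  then show ?thesis using toy_boundedD(1)[OF assms(2)] by (simp add: bounded_clinearD)
qed

lemma toy_bounded_eqI:
  assumes n: "n \<ge> 1" and T: "T \<in> toy_bounded n" and S: "S \<in> toy_bounded n"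
    and eq: "\<And>\<sigma>. \<sigma> \<in> adapted \<Longrightarrow> T (toy_vec n \<sigma>) = S (toy_vec n \<sigma>)"
  shows "T = S"
proof
  fix F
  have "T (toy_unit n F) = S (toy_unit n F)"
    using T S eq toy_boundedD(2)[OF toy_unit_bounded[OF n]]
    by (rule bounded_clinear_eq_on_toy_fock[OF toy_boundedD(1) toy_boundedD(1)])
  then show "T F = S F" using n T S by (simp add: toy_bounded_toy_unit)
qed

text \<open>Symmetry spreads from the basis to its closed span one argument at a time. General
  vectors are reached because both sides depend only on the projections of \<open>F\<close> and
  \<open>G\<close>.\<close>

lemma self_adjoint_toy_bounded:
  assumes n: "n \<ge> 1" and T: "T \<in> toy_bounded n"
    and sym: "\<And>\<sigma> \<tau>. \<sigma> \<in> adapted \<Longrightarrow> \<tau> \<in> adapted \<Longrightarrow>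
      \<langle>T (toy_vec n \<sigma>), toy_vec n \<tau>\<rangle> = \<langle>toy_vec n \<sigma>, T (toy_vec n \<tau>)\<rangle>"
  shows "self_adjoint T"
  unfolding self_adjoint_def
proof (intro allI)
  note bc = toy_boundedD(1)[OF T]
  note cont = continuous_intros bounded_clinear_continuous_on[OF bc]
  have basis_left: "\<langle>T (toy_vec n \<sigma>), G\<rangle> = \<langle>toy_vec n \<sigma>, T G\<rangle>" if "G \<in> toy_fock n" "\<sigma> \<in> adapted" for \<sigma> G
    using that(1)
  proof (induction rule: toy_fock_induct)
    case closed
    show ?case by (intro closed_Collect_eq cont)
  qed (use that(2) sym in \<open>auto simp: bounded_clinearD[OF bc] cinner_fock_add_right cinner_fock_scale_right\<close>)
  have on_toy: "\<langle>T F, G\<rangle> = \<langle>F, T G\<rangle>" if "F \<in> toy_fock n" "G \<in> toy_fock n" for F G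
    using that(1)
  proof (induction rule: toy_fock_induct)
    case closed
    show ?case by (intro closed_Collect_eq cont)
  qed (use that(2) basis_left in \<open>auto simp: bounded_clinearD[OF bc] cinner_add_left cinner_scale_left\<close>)
  have unit: "toy_unit n F \<in> toy_fock n" for F
    by (rule toy_boundedD(2)[OF toy_unit_bounded[OF n]])
  have right: "\<langle>T F, G\<rangle> = \<langle>T F, toy_unit n G\<rangle>" for F G
    using cinner_toy_unit_diff[OF n toy_boundedD(2)[OF T]] by (simp add: cinner_diff_right)
  fix F G
  have "\<langle>T F, G\<rangle> = \<langle>T F, toy_unit n G\<rangle>" by (rule right)
  also have "\<dots> = \<langle>T (toy_unit n F), toy_unit n G\<rangle>"
    unfolding toy_bounded_toy_unit[OF n T] ..
  also have "\<dots> = \<langle>toy_unit n F, T (toy_unit n G)\<rangle>" by (rule on_toy[OF unit unit])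
  \<comment> \<open>Conjugate symmetry turns the scalar product around, so that
    \<open>right\<close>, which concerns the second argument, applies to \<open>F\<close>.\<close>
  also have "\<dots> = cnj \<langle>T G, toy_unit n F\<rangle>"
    unfolding toy_bounded_toy_unit[OF n T] by (rule cinner_fock_commute)
  also have "\<dots> = cnj \<langle>T G, F\<rangle>" by (simp only: right[of G F, symmetric])
  also have "\<dots> = \<langle>F, T G\<rangle>" by (rule cinner_fock_commute[symmetric])
  finally show "\<langle>T F, G\<rangle> = \<langle>F, T G\<rangle>" .
qed

section \<open>Distribution and freeness\<close>

lemma toy_op_bounded_partial:
  assumes "n \<ge> 1" "inj_on g {\<sigma>\<in>adapted. Q \<sigma>}"
    and "\<And>\<sigma>. \<sigma> \<in> adapted \<Longrightarrow> A \<sigma> = (if Q \<sigma> then toy_vec n (g \<sigma>) else 0)"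
    and "\<And>\<sigma>. \<sigma> \<in> adapted \<Longrightarrow> Q \<sigma> \<Longrightarrow> g \<sigma> \<in> adapted"
  shows "toy_op n A \<in> toy_bounded n"
proof (rule toy_op_bounded[OF assms(1) orthogonal_family_partial_toy_vec[OF assms(1-3)]])
  show "A \<sigma> \<in> toy_fock n" if "\<sigma> \<in> adapted" for \<sigma>
    using assms(3,4)[OF that] toy_vec_in_toy_fock[of "g \<sigma>" n] toy_fock_zero[of n] by auto
qed

lemma toy_plus_bounded: "n \<ge> 1 \<Longrightarrow> toy_plus n i \<in> toy_bounded n"
  unfolding toy_plus_def
  by (rule toy_op_bounded_partial[where g = "(#) i" and Q = "\<lambda>\<sigma>. \<sigma> = [] \<or> hd \<sigma> \<noteq> i"])
    (auto simp: inj_on_def distinct_adj_Cons split: list.splits)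

lemma toy_minus_bounded: "n \<ge> 1 \<Longrightarrow> toy_minus n i \<in> toy_bounded n"
  unfolding toy_minus_def
  by (rule toy_op_bounded_partial[where g = tl and Q = "\<lambda>\<sigma>. \<sigma> \<noteq> [] \<and> hd \<sigma> = i"])
    (auto simp: inj_on_def distinct_adj_Cons neq_Nil_conv split: list.splits)

lemma toy_circ_bounded: "n \<ge> 1 \<Longrightarrow> toy_circ n i \<in> toy_bounded n"
  unfolding toy_circ_def
  by (rule toy_op_bounded_partial[where g = "\<lambda>\<sigma>. \<sigma>" and Q = "\<lambda>\<sigma>. \<sigma> \<noteq> [] \<and> hd \<sigma> = i"])
    (auto split: list.splits)

lemma toy_times_bounded: "n \<ge> 1 \<Longrightarrow> toy_times n i \<in> toy_bounded n"
  unfolding toy_times_def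
  by (rule toy_op_bounded_partial[where g = "\<lambda>\<sigma>. \<sigma>" and Q = "\<lambda>\<sigma>. \<sigma> = [] \<or> hd \<sigma> \<noteq> i"])
    (auto split: list.splits)

lemma toy_Y_bounded:
  assumes "n \<ge> 1"
  shows "toy_Y n i \<in> toy_bounded n"
proof -
  have "(\<lambda>F. toy_plus n i F + toy_minus n i F + complex_of_real (sqrt n) *\<^sub>C toy_circ n i F
      + complex_of_real (1 / sqrt n) *\<^sub>C toy_times n i F) \<in> toy_bounded n"
    by (intro toy_bounded_add toy_bounded_scale toy_plus_bounded toy_minus_bounded
        toy_circ_bounded toy_times_bounded assms)
  then show ?thesis unfolding toy_Y_def[abs_def] scaleR_fock_def .
qed

text \<open>For fixed \<open>i\<close> the adapted words fall into pairs \<open>\<sigma>\<close>,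
  \<open>i # \<sigma>\<close>. The toy space thus splits into planes, each of which
  \<open>Y_i\<close> preserves.\<close>

lemma adapted_cases:
  assumes "\<sigma> \<in> adapted"
  obtains "i # \<sigma> \<in> adapted" | \<tau> where "\<sigma> = i # \<tau>" "i # \<tau> \<in> adapted"
proof (cases \<sigma>)
  case (Cons j \<tau>)
  with assms that show ?thesis by (cases "i = j") auto
qed (use that in auto)

text \<open>These are the two columns of the matrix on such a plane. On \<open>\<sigma>\<close> only
  creation and the time operator act, on \<open>i # \<sigma>\<close> only annihilation and
  gauge.\<close>

lemma toy_Y_toy_vec:
  assumes n: "n \<ge> 1" and i: "i # \<sigma> \<in> adapted"
  shows "toy_Y n i (toy_vec n \<sigma>) = toy_vec n (i # \<sigma>) + complex_of_real (1 / sqrt n) *\<^sub>C toy_vec n \<sigma>"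
    and "toy_Y n i (toy_vec n (i # \<sigma>)) = toy_vec n \<sigma> + complex_of_real (sqrt n) *\<^sub>C toy_vec n (i # \<sigma>)"
proof -
  have \<sigma>: "\<sigma> \<in> adapted" using i by (auto dest: distinct_adj_ConsD)
  show "toy_Y n i (toy_vec n \<sigma>) = toy_vec n (i # \<sigma>) + complex_of_real (1 / sqrt n) *\<^sub>C toy_vec n \<sigma>"
    unfolding toy_Y_def toy_plus_def toy_minus_def toy_circ_def toy_times_def scaleR_fock_def
      toy_op_toy_vec[OF n \<sigma>]
    using i by (cases \<sigma>) (auto simp del: of_real_divide)
  show "toy_Y n i (toy_vec n (i # \<sigma>)) = toy_vec n \<sigma> + complex_of_real (sqrt n) *\<^sub>C toy_vec n (i # \<sigma>)"
    unfolding toy_Y_def toy_plus_def toy_minus_def toy_circ_def toy_times_def scaleR_fock_def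
      toy_op_toy_vec[OF n i]
    by (simp del: toy_vec.simps)
qed

text \<open>Cayley-Hamilton for a 2x2 matrix of determinant 0: its square is the trace times the
  matrix.\<close>

lemma toy_Y_square:
  assumes n: "n \<ge> 1"
  shows "toy_Y n i (toy_Y n i F) = complex_of_real ((real n + 1) / sqrt n) *\<^sub>C toy_Y n i F"
proof -
  let ?a = "complex_of_real ((real n + 1) / sqrt n)"
  let ?r = "complex_of_real (sqrt n)" and ?s = "complex_of_real (1 / sqrt n)"
  note Y = toy_Y_bounded[OF n, of i]
  note lin = bounded_clinearD[OF toy_boundedD(1)[OF Y]]
  have one: "1 = complex_of_real 1" by simp
  have "sqrt n * sqrt n = real n" "sqrt n > 0" using n by auto
  \<comment> \<open>Entrywise comparison of the squared matrix with the matrix scaled by its trace,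
    done over the reals and then transferred to complex scalars.\<close>
  then have "1 + 1 / sqrt n * (1 / sqrt n) = (real n + 1) / sqrt n * (1 / sqrt n)"
    "sqrt n + 1 / sqrt n = (real n + 1) / sqrt n" "1 / sqrt n + sqrt n = (real n + 1) / sqrt n"
    "1 + sqrt n * sqrt n = (real n + 1) / sqrt n * sqrt n"
    by (simp_all add: field_simps)
  then have s: "1 + ?s * ?s = ?a * ?s" "?r + ?s = ?a" "?s + ?r = ?a" "1 + ?r * ?r = ?a * ?r"
    unfolding one of_real_mult[symmetric] of_real_add[symmetric] by (simp_all only:)
  have "toy_Y n i \<circ> toy_Y n i = (\<lambda>F. ?a *\<^sub>C toy_Y n i F)"
  proof (rule toy_bounded_eqI[OF n toy_bounded_compose[OF Y Y] toy_bounded_scale[OF Y]])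
    fix \<sigma> assume "\<sigma> \<in> adapted"
    then show "(toy_Y n i \<circ> toy_Y n i) (toy_vec n \<sigma>) = ?a *\<^sub>C toy_Y n i (toy_vec n \<sigma>)"
    proof (cases rule: adapted_cases[where i = i])
      case 1
      let ?u = "toy_vec n \<sigma>" and ?v = "toy_vec n (i # \<sigma>)"
      have "toy_Y n i (toy_Y n i ?u) = (1 + ?s * ?s) *\<^sub>C ?u + (?r + ?s) *\<^sub>C ?v"
        unfolding toy_Y_toy_vec[OF n 1] lin
        by (simp only: scale_fock_add_right scale_fock_add_left scale_fock_scale scale_fock_one add_ac)
      also have "\<dots> = ?a *\<^sub>C toy_Y n i ?u"
        unfolding toy_Y_toy_vec[OF n 1] s
        by (simp only: scale_fock_add_right scale_fock_scale add_ac)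
      finally show ?thesis by simp
    next
      case (2 \<tau>)
      let ?u = "toy_vec n \<tau>" and ?v = "toy_vec n (i # \<tau>)"
      have "toy_Y n i (toy_Y n i ?v) = (?s + ?r) *\<^sub>C ?u + (1 + ?r * ?r) *\<^sub>C ?v"
        unfolding toy_Y_toy_vec[OF n 2(2)] lin
        by (simp only: scale_fock_add_right scale_fock_add_left scale_fock_scale scale_fock_one add_ac)
      also have "\<dots> = ?a *\<^sub>C toy_Y n i ?v"
        unfolding toy_Y_toy_vec[OF n 2(2)] s
        by (simp only: scale_fock_add_right scale_fock_scale add_ac)
      finally show ?thesis using 2(1) by simp
    qed
  qed
  then show ?thesis by (simp add: fun_eq_iff)
qed

lemma self_adjoint_toy_Y:
  assumes n: "n \<ge> 1"
  shows "self_adjoint (toy_Y n i)"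
proof (rule self_adjoint_toy_bounded[OF n toy_Y_bounded[OF n]])
  fix \<sigma> \<tau> assume \<sigma>: "\<sigma> \<in> adapted" and \<tau>: "\<tau> \<in> adapted"
  note simps = toy_Y_toy_vec[OF n] cinner_add_left cinner_scale_left cinner_fock_add_right
    cinner_fock_scale_right toy_vec_orthonormal[OF n]
  show "\<langle>toy_Y n i (toy_vec n \<sigma>), toy_vec n \<tau>\<rangle> = \<langle>toy_vec n \<sigma>, toy_Y n i (toy_vec n \<tau>)\<rangle>"
    using \<sigma>
  proof (cases rule: adapted_cases[where i = i])
    case 1
    show ?thesis using \<tau>
    proof (cases rule: adapted_cases[where i = i])
      case 1
      with \<open>i # \<sigma> \<in> adapted\<close> show ?thesis by (auto simp: simps simp del: toy_vec.simps)
    next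
      case (2 \<tau>')
      with \<open>i # \<sigma> \<in> adapted\<close> show ?thesis by (auto simp: simps simp del: toy_vec.simps)
    qed
  next
    case (2 \<sigma>')
    note \<sigma>_eq = 2
    show ?thesis using \<tau>
    proof (cases rule: adapted_cases[where i = i])
      case 1
      with \<sigma>_eq show ?thesis by (auto simp: simps simp del: toy_vec.simps)
    next
      case (2 \<tau>')
      with \<sigma>_eq show ?thesis by (auto simp: simps simp del: toy_vec.simps)
    qed
  qed
qed

text \<open>The formula starts at exponent 1, since the zeroth power is the projection
  \<open>toy_unit n\<close> and not a multiple of \<open>Y_i\<close>.\<close>

lemma toy_power_toy_Y:
  assumes n: "n \<ge> 1"
  shows "toy_power n (toy_Y n i) (Suc k) F
     = complex_of_real (((real n + 1) / sqrt n) ^ k) *\<^sub>C toy_Y n i F"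
proof (induction k)
  case 0
  show ?case using n by (simp add: toy_bounded_toy_unit toy_Y_bounded scale_fock_one)
next
  case (Suc k)
  have "toy_power n (toy_Y n i) (Suc (Suc k)) F
      = toy_Y n i (complex_of_real (((real n + 1) / sqrt n) ^ k) *\<^sub>C toy_Y n i F)"
    using Suc.IH by simp
  also have "\<dots> = complex_of_real (((real n + 1) / sqrt n) ^ Suc k) *\<^sub>C toy_Y n i F"
    unfolding bounded_clinearD(2)[OF toy_boundedD(1)[OF toy_Y_bounded[OF n]]] toy_Y_square[OF n]
      scale_fock_scale power_Suc of_real_mult by (simp only: mult.commute)
  finally show ?case .
qed

lemma toy_Y_vacuum: "n \<ge> 1 \<Longrightarrow> toy_Y n i \<Omega> = toy_vec n [i] + complex_of_real (1 / sqrt n) *\<^sub>C \<Omega>"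
  using toy_Y_toy_vec(1)[of n i "[]"] by simp

lemma vacuum_state_toy_Y:
  assumes "n \<ge> 1"
  shows "vacuum_state (toy_Y n i) = complex_of_real (1 / sqrt n)"
  using assms
  by (simp add: vacuum_state_def toy_Y_vacuum cinner_fock_add_right cinner_fock_scale_right
      cinner_vacuum cinner_vacuum_tensor_left del: of_real_divide)

lemma vacuum_state_toy_unit: "n \<ge> 1 \<Longrightarrow> vacuum_state (toy_unit n) = 1"
  using toy_unit_toy_vec[of n "[]"] by (simp add: vacuum_state_def cinner_vacuum)

section \<open>The distribution of a single variable\<close>

lemma integral_two_point_law:
  fixes f :: "real \<Rightarrow> real"
  assumes [measurable]: "f \<in> borel_measurable borel" and p: "0 \<le> p" "p \<le> 1"
  shows "(\<integral>x. f x \<partial>two_point_law p a b) = p * f a + (1 - p) * f b"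
proof -
  have "(\<integral>x. f x \<partial>two_point_law p a b)
      = (\<integral>s. f (if s then a else b) \<partial>measure_pmf (bernoulli_pmf p))"
    unfolding two_point_law_def by (subst integral_distr) auto
  also have "\<dots> = (\<Sum>s\<in>UNIV. f (if s then a else b) * pmf (bernoulli_pmf p) s)"
    by (subst integral_measure_pmf_real[where A = UNIV]) auto
  finally show ?thesis using p by (simp add: UNIV_bool)
qed

lemma has_distribution_toy_Y:
  assumes n: "n \<ge> 1"
  shows "has_distribution n (toy_Y n i)
    (two_point_law (1 / (real n + 1)) ((real n + 1) / sqrt (real n)) 0)"
proof -
  let ?p = "1 / (real n + 1)" and ?a = "(real n + 1) / sqrt (real n)"
  let ?\<mu> = "two_point_law ?p ?a 0"
  have p: "0 \<le> ?p" "?p \<le> 1" by auto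
  have prob: "prob_space ?\<mu>"
    unfolding two_point_law_def by (intro prob_space.prob_space_distr measure_pmf.prob_space_axioms) auto
  have "emeasure ?\<mu> (- {?a, 0}) = 0"
    by (subst emeasure_two_point_law[OF p]) auto
  then have supp: "\<exists>K. compact K \<and> emeasure ?\<mu> (- K) = 0"
    by (intro exI[of _ "{?a, 0}"]) (auto intro: finite_imp_compact)
  have moment: "vacuum_state (toy_power n (toy_Y n i) k) = complex_of_real (\<integral>x. x ^ k \<partial>?\<mu>)" for k
  proof (cases k)
    case 0
    interpret prob_space ?\<mu> by (rule prob)
    show ?thesis using n by (simp add: 0 vacuum_state_toy_unit prob_space)
  next
    case (Suc j)
    have "vacuum_state (toy_power n (toy_Y n i) k) = complex_of_real (?a ^ j) * complex_of_real (1 / sqrt n)"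
      using vacuum_state_toy_Y[OF n, of i]
      unfolding Suc vacuum_state_def toy_power_toy_Y[OF n] cinner_fock_scale_right by simp
    also have "\<dots> = complex_of_real (?a ^ j * (1 / sqrt n))" by (simp only: of_real_mult)
    \<comment> \<open>The vacuum mean is the weight times the nonzero atom, so every positive moment
      is \<open>?p * ?a ^ k\<close>; the atom at 0 counts only in the zeroth.\<close>
    also have "1 / sqrt n = ?p * ?a" using n by (simp add: field_simps)
    also have "?a ^ j * (?p * ?a) = (\<integral>x. x ^ k \<partial>?\<mu>)"
      unfolding Suc by (subst integral_two_point_law[OF _ p]) auto
    finally show ?thesis .
  qed
  show ?thesis
    unfolding has_distribution_def
    using toy_Y_bounded[OF n] self_adjoint_toy_Y[OF n] prob supp moment
    by (auto simp: two_point_law_def)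
qed

section \<open>Freeness\<close>

lemma generated_algebra_toy_Y:
  assumes n: "n \<ge> 1" and T: "T \<in> generated_algebra (toy_unit n) {toy_Y n i}"
  obtains a b where "T = (\<lambda>F. a *\<^sub>C toy_unit n F + b *\<^sub>C toy_Y n i F)"
proof -
  have "\<exists>a b. T = (\<lambda>F. a *\<^sub>C toy_unit n F + b *\<^sub>C toy_Y n i F)"
    using T
  proof induction
    case unit
    show ?case by (intro exI[of _ 1] exI[of _ 0]) (simp add: scale_fock_one)
  next
    case (generator T)
    then show ?case by (intro exI[of _ 0] exI[of _ 1]) (auto simp: scale_fock_one)
  next
    case (add T U)
    then obtain a b c d where "T = (\<lambda>F. a *\<^sub>C toy_unit n F + b *\<^sub>C toy_Y n i F)"
      "U = (\<lambda>F. c *\<^sub>C toy_unit n F + d *\<^sub>C toy_Y n i F)" by blast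
    then show ?case
      by (intro exI[of _ "a + c"] exI[of _ "b + d"]) (simp add: scale_fock_add_left add_ac)
  next
    case (scale T c)
    then obtain a b where "T = (\<lambda>F. a *\<^sub>C toy_unit n F + b *\<^sub>C toy_Y n i F)" by blast
    then show ?case
      by (intro exI[of _ "c * a"] exI[of _ "c * b"]) (simp add: scale_fock_add_right scale_fock_scale)
  next
    case (mult T U)
    then obtain a b c d where TU: "T = (\<lambda>F. a *\<^sub>C toy_unit n F + b *\<^sub>C toy_Y n i F)"
      "U = (\<lambda>F. c *\<^sub>C toy_unit n F + d *\<^sub>C toy_Y n i F)" by blast
    let ?e = "complex_of_real ((real n + 1) / sqrt n)"
    note Y = toy_Y_bounded[OF n, of i] and P = toy_unit_bounded[OF n]
    note lin = bounded_clinearD(2,3)[OF toy_boundedD(1)[OF Y]] bounded_clinearD(2,3)[OF toy_boundedD(1)[OF P]]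
    \<comment> \<open>\<open>toy_unit n\<close> is neutral on both sides of \<open>Y_i\<close>, so
      only the term with \<open>b * d\<close> involves the square of \<open>Y_i\<close>, which is
      \<open>?e\<close> times \<open>Y_i\<close>.\<close>
    have "(T \<circ> U) F = (a * c) *\<^sub>C toy_unit n F + (a * d + b * c + b * d * ?e) *\<^sub>C toy_Y n i F" for F
      unfolding TU comp_def lin toy_unit_toy_fock[OF n toy_boundedD(2)[OF P]]
        toy_unit_toy_fock[OF n toy_boundedD(2)[OF Y]] toy_bounded_toy_unit[OF n Y] toy_Y_square[OF n]
      by (simp only: scale_fock_add_right scale_fock_add_left scale_fock_scale mult.assoc add_ac)
    then show ?case by blast
  qed
  with that show ?thesis by blast
qed

text \<open>The coefficient \<open>1 / sqrt n\<close> of X_sigma in Y_i X_sigma is the same for the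
  vacuum and for every other word that \<open>i\<close> may precede. Centring at the vacuum
  therefore removes it for all these words at once.\<close>

lemma centred_generated_algebra_toy_Y:
  assumes n: "n \<ge> 1" and T: "T \<in> generated_algebra (toy_unit n) {toy_Y n i}" and "vacuum_state T = 0"
  obtains b where "\<And>\<sigma>. i # \<sigma> \<in> adapted \<Longrightarrow> T (toy_vec n \<sigma>) = b *\<^sub>C toy_vec n (i # \<sigma>)"
    "bounded_clinear T"
proof -
  obtain a b where ab: "T = (\<lambda>F. a *\<^sub>C toy_unit n F + b *\<^sub>C toy_Y n i F)"
    using generated_algebra_toy_Y[OF n T] .
  let ?s = "complex_of_real (1 / sqrt n)"
  have "vacuum_state T = a * vacuum_state (toy_unit n) + b * vacuum_state (toy_Y n i)"
    by (simp add: ab vacuum_state_def cinner_fock_add_right cinner_fock_scale_right)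
  then have a: "a + b * ?s = 0"
    using assms by (simp add: vacuum_state_toy_Y vacuum_state_toy_unit)
  show ?thesis
  proof (rule that[of b])
    fix \<sigma> assume i: "i # \<sigma> \<in> adapted"
    then have \<sigma>: "\<sigma> \<in> adapted" by (auto dest: distinct_adj_ConsD)
    have "T (toy_vec n \<sigma>) = b *\<^sub>C toy_vec n (i # \<sigma>) + (a + b * ?s) *\<^sub>C toy_vec n \<sigma>"
      unfolding ab toy_Y_toy_vec(1)[OF n i] toy_unit_toy_vec[OF n \<sigma>]
      by (simp only: scale_fock_add_right scale_fock_add_left scale_fock_scale add_ac)
    then show "T (toy_vec n \<sigma>) = b *\<^sub>C toy_vec n (i # \<sigma>)" unfolding a by simp
  next
    show "bounded_clinear T"
      unfolding ab by (intro bounded_clinear_add bounded_clinear_scale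
        toy_boundedD(1)[OF toy_unit_bounded[OF n]] toy_boundedD(1)[OF toy_Y_bounded[OF n]])
  qed
qed

text \<open>The last factor acts first, so the word grows at its front and ends up as
  \<open>map j ks\<close>. As neighbouring letters differ, every intermediate word is adapted, which
  the action of a centred element requires.\<close>

lemma foldr_centred_vacuum:
  assumes n: "n \<ge> 1"
    and b: "\<And>k. k \<in> set ks \<Longrightarrow> b k \<in> generated_algebra (toy_unit n) {toy_Y n (j k)} \<and> vacuum_state (b k) = 0"
    and "distinct_adj (map j ks)"
  shows "\<exists>c. foldr (\<circ>) (map b ks) id \<Omega> = c *\<^sub>C toy_vec n (map j ks)"
  using b assms(3)
proof (induction ks)
  case Nil
  show ?case by (intro exI[of _ 1]) (simp add: scale_fock_one)
next
  case (Cons k ks)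
  have "distinct_adj (map j ks)" using Cons.prems(2) by (auto dest: distinct_adj_ConsD)
  from Cons.IH[OF Cons.prems(1)[OF list.set_intros(2)] this] obtain c where
    c: "foldr (\<circ>) (map b ks) id \<Omega> = c *\<^sub>C toy_vec n (map j ks)" by blast
  obtain d where d: "\<And>\<sigma>. j k # \<sigma> \<in> adapted \<Longrightarrow> b k (toy_vec n \<sigma>) = d *\<^sub>C toy_vec n (j k # \<sigma>)"
    "bounded_clinear (b k)"
    using centred_generated_algebra_toy_Y[OF n, of "b k" "j k"] Cons.prems(1)[of k] by auto
  have "foldr (\<circ>) (map b (k # ks)) id \<Omega> = b k (c *\<^sub>C toy_vec n (map j ks))"
    using c by simp
  also have "\<dots> = c *\<^sub>C d *\<^sub>C toy_vec n (map j (k # ks))"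
    using d(1)[of "map j ks"] Cons.prems(2) bounded_clinearD(2)[OF d(2)] by simp
  finally show ?case unfolding scale_fock_scale by blast
qed

lemma free_random_variables_toy_Y:
  assumes n: "n \<ge> 1"
  shows "free_random_variables n (toy_Y n) UNIV"
  unfolding free_random_variables_def free_subalgebras_def
proof (intro conjI ballI allI impI toy_Y_bounded[OF n])
  fix m :: nat and j :: "nat \<Rightarrow> nat" and b
  assume m: "1 \<le> m"
    and "(\<forall>k\<in>{1..m}. j k \<in> UNIV \<and> b k \<in> generated_algebra (toy_unit n) {toy_Y n (j k)} \<and>
        vacuum_state (b k) = 0) \<and> (\<forall>k. 1 \<le> k \<and> k < m \<longrightarrow> j k \<noteq> j (k + 1))"
  then have b: "\<And>k. k \<in> set [1..<m + 1] \<Longrightarrow>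
      b k \<in> generated_algebra (toy_unit n) {toy_Y n (j k)} \<and> vacuum_state (b k) = 0"
    and adj: "\<And>k. 1 \<le> k \<Longrightarrow> k < m \<Longrightarrow> j k \<noteq> j (k + 1)" by auto
  have "distinct_adj (map j [1..<m + 1])"
    unfolding distinct_adj_conv_nth using adj by (auto simp del: upt_Suc)
  from foldr_centred_vacuum[OF n b this] obtain c where
    c: "foldr (\<circ>) (map b [1..<m + 1]) id \<Omega> = c *\<^sub>C toy_vec n (map j [1..<m + 1])" by blast
  \<comment> \<open>\<open>m\<close> being at least 1 matters here: the empty product would return
    the vacuum itself.\<close>
  have "map j [1..<m + 1] \<noteq> []" using m by (simp del: upt_Suc)
  then have "\<langle>\<Omega>, toy_vec n (map j [1..<m + 1])\<rangle> = 0"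
    using toy_vec_orthonormal[OF n, of "[]"] by fastforce
  then show "vacuum_state (foldr (\<circ>) (map b [1..<m + 1]) id) = 0"
    unfolding vacuum_state_def c cinner_fock_scale_right by simp
qed

section \<open>Density of the step tensors\<close>

lemma square_integrable_indicator:
  assumes "A \<in> sets M" "emeasure M A \<noteq> \<infinity>"
  shows "square_integrable M (indicator A)"
proof -
  have "(\<lambda>x. (cmod (indicator A x))\<^sup>2) = (\<lambda>x. indicator A x :: real)"
    by (auto simp: indicator_def fun_eq_iff)
  then show ?thesis
    using assms by (simp add: square_integrable_def less_top)
qed

text \<open>A monotone class scheme: a pi-system yields all measurable sets, these yield simple
  functions and their limits. When the measure is infinite, complements leave the square integrable
  class; hence all sets are cut by the exhausting sets \<open>R k\<close> of finite measure.\<close>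

lemma square_integrable_induct [consumes 6, case_names indicator add scale lim]:
  fixes P :: "('a \<Rightarrow> complex) \<Rightarrow> bool"
  assumes g: "square_integrable M g"
    and E: "sets M = sigma_sets (space M) E" "E \<subseteq> Pow (space M)" "Int_stable E"
    and fin: "\<And>A. A \<in> E \<Longrightarrow> emeasure M A \<noteq> \<infinity>"
    and R: "range R \<subseteq> E \<and> incseq R \<and> (\<Union>k::nat. R k) = space M"
    and indicator: "\<And>A. A \<in> E \<Longrightarrow> P (indicator A)"
    and add: "\<And>f g. square_integrable M f \<Longrightarrow> square_integrable M g \<Longrightarrow> P f \<Longrightarrow> P g
      \<Longrightarrow> P (\<lambda>x. f x + g x)"
    and scale: "\<And>f c. square_integrable M f \<Longrightarrow> P f \<Longrightarrow> P (\<lambda>x. c * f x)"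
    and lim: "\<And>u g. (\<And>k::nat. square_integrable M (u k)) \<Longrightarrow> (\<And>k. P (u k)) \<Longrightarrow>
      square_integrable M g \<Longrightarrow> (\<lambda>k. \<integral>x. (cmod (u k x - g x))\<^sup>2 \<partial>M) \<longlonglongrightarrow> 0 \<Longrightarrow> P g"
  shows "P g"
proof -
  have R_E: "R k \<in> E" for k using R by auto
  have R_sets [measurable]: "R k \<in> sets M" for k
    using R_E[of k] E(1) by (auto intro: sigma_sets.Basic)
  have R_fin: "emeasure M (R k) \<noteq> \<infinity>" for k by (rule fin[OF R_E])
  have sq_ind: "square_integrable M (indicator (A \<inter> R k))" if "A \<in> sets M" for A k
  proof (rule square_integrable_indicator)
    have "emeasure M (A \<inter> R k) \<le> emeasure M (R k)"
      using that by (intro emeasure_mono) auto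
    then show "emeasure M (A \<inter> R k) \<noteq> \<infinity>" using R_fin[of k] by (auto simp: top_unique)
  qed (use that in auto)
  have P_0: "P (\<lambda>_. 0)"
    using scale[OF square_integrable_indicator[OF R_sets R_fin] indicator[OF R_E], of 0 0] by simp
  have P_sum: "P (\<lambda>x. \<Sum>i\<in>I. f i x) \<and> square_integrable M (\<lambda>x. \<Sum>i\<in>I. f i x)"
    if "finite I" "\<And>i. i \<in> I \<Longrightarrow> P (f i) \<and> square_integrable M (f i)" for I :: "'b set" and f
    using that
    by (induction I rule: finite_induct) (auto intro: P_0 add square_integrable_add(1))
  \<comment> \<open>Values outside \<open>space M\<close> do not affect the integral, so a constant
    sequence in \<open>lim\<close> transfers \<open>P\<close>.\<close>
  have P_cong: "P f" if "square_integrable M f'" "square_integrable M f" "P f'"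
      "\<And>x. x \<in> space M \<Longrightarrow> f' x = f x" for f f'
  proof (rule lim[of "\<lambda>_. f'"])
    have "(\<integral>x. (cmod (f' x - f x))\<^sup>2 \<partial>M) = (\<integral>x. 0 \<partial>M)"
      using that(4) by (intro Bochner_Integration.integral_cong) auto
    then show "(\<lambda>k. \<integral>x. (cmod (f' x - f x))\<^sup>2 \<partial>M) \<longlonglongrightarrow> 0" by simp
  qed (use that in auto)
  \<comment> \<open>Dynkin's argument with \<open>R k\<close> fixed: complements are taken relative
    to \<open>R k\<close>, whose indicator is square integrable and dominates all the
    others.\<close>
  have P_ind: "P (indicator (A \<inter> R k))" if "A \<in> sets M" for A k
  proof -
    from that have "A \<in> sigma_sets (space M) E" using E(1) by simp
    with E(3,2) show ?thesis
    proof (induction rule: sigma_sets_induct_disjoint)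
      case (basic A)
      then show ?case using E(3) R_E[of k] by (intro indicator) (auto simp: Int_stable_def)
    next
      case empty
      then show ?case using P_0 by (simp add: indicator_def[abs_def])
    next
      case (compl A)
      then have A: "A \<in> sets M" using E(1) by simp
      have "P (\<lambda>x. indicator (space M \<inter> R k) x + (-1) * indicator (A \<inter> R k) x)"
      proof (intro add scale compl.IH sq_ind square_integrable_scale(1) A)
        show "P (indicator (space M \<inter> R k))"
          using indicator[OF R_E[of k]] sets.sets_into_space[OF R_sets[of k]] by (simp add: Int_absorb1)
      qed auto
      also have "(\<lambda>x. indicator (space M \<inter> R k) x + (-1) * indicator (A \<inter> R k) x)
          = (indicator ((space M - A) \<inter> R k) :: 'a \<Rightarrow> complex)"
        using sets.sets_into_space[OF A] sets.sets_into_space[OF R_sets[of k]]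
        by (auto simp: fun_eq_iff indicator_def)
      finally show ?case .
    next
      case (union F)
      then have F [measurable]: "F i \<in> sets M" for i using E(1) by auto
      have eq: "(\<lambda>x. \<Sum>i<j. indicator (F i \<inter> R k) x) = (indicator ((\<Union>i<j. F i) \<inter> R k) :: 'a \<Rightarrow> complex)" for j
      proof
        fix x
        have "(\<Sum>i<j. indicator (F i \<inter> R k) x) = (indicator (\<Union>i<j. F i \<inter> R k) x :: complex)"
          using union(1) by (intro indicator_UN_disjoint[symmetric])
            (auto simp: disjoint_family_on_def)
        also have "(\<Union>i<j. F i \<inter> R k) = (\<Union>i<j. F i) \<inter> R k" by auto
        finally show "(\<Sum>i<j. indicator (F i \<inter> R k) x) = (indicator ((\<Union>i<j. F i) \<inter> R k) x :: complex)" .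
      qed
      show ?case
      proof (rule lim[of "\<lambda>j. indicator ((\<Union>i<j. F i) \<inter> R k)"])
        show "P (indicator ((\<Union>i<j. F i) \<inter> R k))" for j
          using P_sum[of "{..<j}" "\<lambda>i. indicator (F i \<inter> R k)"] union sq_ind[OF F] unfolding eq by auto
        have "(\<lambda>j. \<integral>x. (cmod (indicator ((\<Union>i<j. F i) \<inter> R k) x - indicator ((\<Union>i. F i) \<inter> R k) x))\<^sup>2 \<partial>M)
            \<longlonglongrightarrow> (\<integral>x. 0 \<partial>M)"
        proof (rule integral_dominated_convergence[where w = "indicator (R k)"])
          show "integrable M (indicator (R k) :: 'a \<Rightarrow> real)"
            using R_fin[of k] by (simp add: less_top)
          show "AE x in M. (\<lambda>j. (cmod (indicator ((\<Union>i<j. F i) \<inter> R k) x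
              - indicator ((\<Union>i. F i) \<inter> R k) x))\<^sup>2) \<longlonglongrightarrow> 0"
          proof (rule AE_I2, rule tendsto_eventually)
            fix x
            show "\<forall>\<^sub>F j in sequentially. (cmod (indicator ((\<Union>i<j. F i) \<inter> R k) x
                - indicator ((\<Union>i. F i) \<inter> R k) x))\<^sup>2 = 0"
            proof (cases "x \<in> (\<Union>i. F i)")
              case True
              then obtain i where i: "x \<in> F i" by auto
              show ?thesis
                using eventually_gt_at_top[of i] by (rule eventually_mono) (use i in \<open>auto simp: indicator_def\<close>)
            qed (auto simp: indicator_def)
          qed
        qed (auto simp: indicator_def)
        then show "(\<lambda>j. \<integral>x. (cmod (indicator ((\<Union>i<j. F i) \<inter> R k) x - indicator ((\<Union>i. F i) \<inter> R k) x))\<^sup>2 \<partial>M)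
            \<longlonglongrightarrow> 0" by simp
      qed (auto intro!: sq_ind)
    qed
  qed
  have g_meas [measurable]: "g \<in> borel_measurable M"
    and g_int: "integrable M (\<lambda>x. (cmod (g x))\<^sup>2)" using g by (auto simp: square_integrable_def)
  obtain s where s: "\<And>i. simple_function M (s i)" "\<And>x. x \<in> space M \<Longrightarrow> (\<lambda>i. s i x) \<longlonglongrightarrow> g x"
    and s_le: "\<And>i x. x \<in> space M \<Longrightarrow> norm (s i x) \<le> 2 * norm (g x)"
  proof -
    from borel_measurable_implies_sequence_metric[OF g_meas, of 0] obtain s where
      "\<forall>i. simple_function M (s i)" "\<forall>x\<in>space M. (\<lambda>i. s i x) \<longlonglongrightarrow> g x"
      "\<forall>i. \<forall>x\<in>space M. dist (s i x) 0 \<le> 2 * dist (g x) 0" by blast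
    then show ?thesis by (intro that[of s]) auto
  qed
  have s_meas [measurable]: "s i \<in> borel_measurable M" for i
    using s(1) by (rule borel_measurable_simple_function)
  have le_g: "(cmod (s k x * indicator (R k) x))\<^sup>2 \<le> 4 * (cmod (g x))\<^sup>2" if "x \<in> space M" for k x
  proof -
    have "cmod (s k x * indicator (R k) x) \<le> 2 * cmod (g x)"
      using s_le[OF that, of k] by (auto simp: indicator_def)
    then have "(cmod (s k x * indicator (R k) x))\<^sup>2 \<le> (2 * cmod (g x))\<^sup>2"
      by (intro power_mono) auto
    then show ?thesis by (simp add: power_mult_distrib)
  qed
  have sq_u: "square_integrable M (\<lambda>x. s k x * indicator (R k) x)" for k
    unfolding square_integrable_def
  proof
    have "integrable M (\<lambda>x. 4 * (cmod (g x))\<^sup>2)" using g_int by simp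
    then show "integrable M (\<lambda>x. (cmod (s k x * indicator (R k) x))\<^sup>2)"
      by (rule Bochner_Integration.integrable_bound) (use le_g in auto)
  qed measurable
  show ?thesis
  proof (rule lim[of "\<lambda>k x. s k x * indicator (R k) x"])
    \<comment> \<open>The cut-off simple function is a finite combination of the indicators treated
      in \<open>P_ind\<close>. At each point the cut disappears for large \<open>k\<close>.\<close>
    show "P (\<lambda>x. s k x * indicator (R k) x)" for k
    proof (rule P_cong[of "\<lambda>x. \<Sum>y\<in>s k ` space M. y * indicator (s k -` {y} \<inter> space M \<inter> R k) x"])
      have set: "s k -` {y} \<inter> space M \<in> sets M" for y
        using s(1) by (rule simple_functionD)
      have "P (\<lambda>x. \<Sum>y\<in>s k ` space M. y * indicator (s k -` {y} \<inter> space M \<inter> R k) x) \<and>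
        square_integrable M (\<lambda>x. \<Sum>y\<in>s k ` space M. y * indicator (s k -` {y} \<inter> space M \<inter> R k) x)"
        by (rule P_sum) (use s(1) set in \<open>auto intro!: scale square_integrable_scale(1) P_ind sq_ind
            simp: simple_function_def\<close>)
      then show "P (\<lambda>x. \<Sum>y\<in>s k ` space M. y * indicator (s k -` {y} \<inter> space M \<inter> R k) x)"
        "square_integrable M (\<lambda>x. \<Sum>y\<in>s k ` space M. y * indicator (s k -` {y} \<inter> space M \<inter> R k) x)"
        by auto
      fix x assume x: "x \<in> space M"
      have "(\<Sum>y\<in>s k ` space M. y * indicator (s k -` {y} \<inter> space M \<inter> R k) x)
          = (\<Sum>y\<in>s k ` space M. if y = s k x then s k x * indicator (R k) x else 0)"
        using x by (intro sum.cong) (auto simp: indicator_def)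
      also have "\<dots> = s k x * indicator (R k) x"
        using s(1)[of k] x by (auto simp: simple_function_def)
      finally show "(\<Sum>y\<in>s k ` space M. y * indicator (s k -` {y} \<inter> space M \<inter> R k) x)
          = s k x * indicator (R k) x" .
    qed (rule sq_u)
    \<comment> \<open>The constant 10 is 2 * (4 + 1): the 4 comes from \<open>le_g\<close>, the
      outer 2 from \<open>cmod_add_sq_le\<close>.\<close>
    have "(\<lambda>k. \<integral>x. (cmod (s k x * indicator (R k) x - g x))\<^sup>2 \<partial>M) \<longlonglongrightarrow> (\<integral>x. 0 \<partial>M)"
    proof (rule integral_dominated_convergence[where w = "\<lambda>x. 10 * (cmod (g x))\<^sup>2"])
      show "AE x in M. (\<lambda>k. (cmod (s k x * indicator (R k) x - g x))\<^sup>2) \<longlonglongrightarrow> 0"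
      proof (rule AE_I2)
        fix x assume x: "x \<in> space M"
        then obtain j where j: "x \<in> R j" using R by auto
        have "s k x = s k x * indicator (R k) x" if "k \<ge> j" for k
        proof -
          have "R j \<subseteq> R k" using R that by (simp add: incseq_def)
          with j show ?thesis by (auto simp: indicator_def)
        qed
        then have "\<forall>\<^sub>F k in sequentially. s k x = s k x * indicator (R k) x"
          using eventually_ge_at_top[of j] by (rule eventually_mono[rotated])
        then have "(\<lambda>k. s k x * indicator (R k) x) \<longlonglongrightarrow> g x"
          by (rule Lim_transform_eventually[OF s(2)[OF x]])
        then have "(\<lambda>k. (cmod (s k x * indicator (R k) x - g x))\<^sup>2) \<longlonglongrightarrow> (cmod (g x - g x))\<^sup>2"
          by (intro tendsto_intros)
        then show "(\<lambda>k. (cmod (s k x * indicator (R k) x - g x))\<^sup>2) \<longlonglongrightarrow> 0" by simp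
      qed
      show "AE x in M. norm ((cmod (s k x * indicator (R k) x - g x))\<^sup>2) \<le> 10 * (cmod (g x))\<^sup>2" for k
      proof (rule AE_I2)
        fix x assume "x \<in> space M"
        from le_g[OF this, of k] cmod_add_sq_le[of "s k x * indicator (R k) x" "- g x"]
        show "norm ((cmod (s k x * indicator (R k) x - g x))\<^sup>2) \<le> 10 * (cmod (g x))\<^sup>2" by simp
      qed
    qed (use g_int in auto)
    then show "(\<lambda>k. \<integral>x. (cmod (s k x * indicator (R k) x - g x))\<^sup>2 \<partial>M) \<longlonglongrightarrow> 0" by simp
  qed (rule sq_u g)+
qed

text \<open>The lower corner is kept at the origin so that the indicator is a tensor product of the
  very functions that define the processes. Such boxes are still stable under intersection and
  generate the product sigma-algebra.\<close>

definition step_box :: "nat \<Rightarrow> (nat \<Rightarrow> real) \<Rightarrow> (nat \<Rightarrow> real) set" where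
  "step_box m s = (\<Pi>\<^sub>E i\<in>{..<m}. {0..<s i})"

lemma atLeastLessThan_in_sets_half_line: "{0..<s} \<in> sets half_line"
  by (subst sets_restrict_space_iff) auto

lemma emeasure_half_line_atLeastLessThan: "emeasure half_line {0..<s} = ennreal (max 0 s)"
  by (subst emeasure_restrict_space) (auto simp: max_def ennreal_neg)

lemma step_box_in_sets [measurable]: "step_box m s \<in> sets (half_line_pow m)"
  unfolding step_box_def half_line_pow_def
  by (intro sets_PiM_I_finite atLeastLessThan_in_sets_half_line) auto

lemma emeasure_step_box_finite: "emeasure (half_line_pow m) (step_box m s) \<noteq> \<infinity>"
proof -
  have "emeasure (half_line_pow m) (step_box m s) = (\<Prod>i<m. ennreal (max 0 (s i)))"
    unfolding step_box_def half_line_pow_def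
    by (subst half_line_prod.emeasure_PiM)
      (simp_all add: atLeastLessThan_in_sets_half_line emeasure_half_line_atLeastLessThan)
  also have "\<dots> = ennreal (\<Prod>i<m. max 0 (s i))" by (rule prod_ennreal) simp
  finally show ?thesis by simp
qed

text \<open>The sets where a coordinate is below \<open>a\<close> generate the coordinate
  sigma-algebras. Each is a countable union of boxes with side \<open>a\<close> in direction
  \<open>i\<close> and side \<open>k\<close> in the others.\<close>

lemma sets_half_line_pow: "sets (half_line_pow m) = sigma_sets (space (half_line_pow m)) (range (step_box m))"
proof (rule antisym)
  let ?\<Omega> = "space (half_line_pow m)"
  have sub: "range (step_box m) \<subseteq> Pow ?\<Omega>"
    using sets.sets_into_space[OF step_box_in_sets] by blast
  show "sigma_sets ?\<Omega> (range (step_box m)) \<subseteq> sets (half_line_pow m)"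
    by (rule sets.sigma_sets_subset) auto
  let ?N = "sigma ?\<Omega> (range (step_box m))"
  have N: "space ?N = ?\<Omega>" "sets ?N = sigma_sets ?\<Omega> (range (step_box m))"
    using sub by (simp_all add: space_measure_of_conv sets_measure_of)
  have "sets (half_line_pow m) \<subseteq> sets ?N"
    unfolding half_line_pow_def
  proof (rule sets_PiM_in_sets)
    show "space (sigma (space (Pi\<^sub>M {..<m} (\<lambda>_. half_line))) (range (step_box m)))
        = (\<Pi>\<^sub>E i\<in>{..<m}. space half_line)"
      by (simp add: space_measure_of_conv space_PiM)
    fix i A assume i: "i \<in> {..<m}" and A: "A \<in> sets half_line"
    have "(\<lambda>x. x i) \<in> ?N \<rightarrow>\<^sub>M half_line"
    proof (rule measurable_restrict_space2)
      show "(\<lambda>x. x i) \<in> space ?N \<rightarrow> {0..}"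
        using i by (auto simp: space_measure_of_conv half_line_pow_def space_PiM space_restrict_space)
      have "(\<lambda>x. x i) \<in> borel_measurable ?N"
      proof (rule borel_measurableI_less)
        fix a :: real
        have "{x \<in> space ?N. x i < a} = (\<Union>k::nat. step_box m (\<lambda>j. if j = i then a else real k))"
        proof (intro equalityI subsetI)
          fix x assume "x \<in> {x \<in> space ?N. x i < a}"
          then have x: "x \<in> (\<Pi>\<^sub>E i\<in>{..<m}. {0..})" "x i < a"
            by (auto simp: space_measure_of_conv half_line_pow_def space_PiM space_restrict_space)
          \<comment> \<open>The sum of the moduli bounds every coordinate, so one \<open>k\<close>
            serves for all.\<close>
          obtain k :: nat where k: "(\<Sum>j<m. \<bar>x j\<bar>) < real k" using reals_Archimedean2 by blast
          have "x j < real k" if "j < m" for j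
            using member_le_sum[of j "{..<m}" "\<lambda>j. \<bar>x j\<bar>"] k that by auto
          then have "x \<in> step_box m (\<lambda>j. if j = i then a else real k)"
            using x by (auto simp: step_box_def PiE_iff)
          then show "x \<in> (\<Union>k::nat. step_box m (\<lambda>j. if j = i then a else real k))" by blast
        next
          fix x assume "x \<in> (\<Union>k::nat. step_box m (\<lambda>j. if j = i then a else real k))"
          then obtain k :: nat where x: "x \<in> step_box m (\<lambda>j. if j = i then a else real k)" by blast
          then have "x \<in> ?\<Omega>" using sub by blast
          moreover have "x i < a"
            using PiE_mem[OF x[unfolded step_box_def] i] by simp
          ultimately show "x \<in> {x \<in> space ?N. x i < a}"
            by (simp add: space_measure_of_conv)
        qed
        also have "\<dots> \<in> sets ?N"
          unfolding N by (intro sigma_sets.Union sigma_sets.Basic rangeI)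
        finally show "{x \<in> space ?N. x i < a} \<in> sets ?N" .
      qed
      then show "(\<lambda>x. x i) \<in> ?N \<rightarrow>\<^sub>M lborel" by simp
    qed
    then have "(\<lambda>x. x i) -` A \<inter> space ?N \<in> sets ?N" using A by (rule measurable_sets)
    also have "(\<lambda>x. x i) -` A \<inter> space ?N = {x \<in> space ?N. x i \<in> A}" by auto
    finally show "{x \<in> space (sigma (space (Pi\<^sub>M {..<m} (\<lambda>_. half_line))) (range (step_box m))). x i \<in> A}
        \<in> sets (sigma (space (Pi\<^sub>M {..<m} (\<lambda>_. half_line))) (range (step_box m)))"
      unfolding half_line_pow_def .
  qed
  then show "sets (half_line_pow m) \<subseteq> sigma_sets ?\<Omega> (range (step_box m))" unfolding N .
qed

definition component_fun :: "nat \<Rightarrow> ((nat \<Rightarrow> real) \<Rightarrow> complex) \<Rightarrow> fock_fun" where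
  "component_fun m g = (\<lambda>k x. if k = m then g x else 0)"

lemma component_fun_carrier:
  assumes "square_integrable (half_line_pow m) g"
  shows "component_fun m g \<in> fock_carrier"
proof -
  have "square_integrable (half_line_pow k) (component_fun m g k)" for k
    using assms by (cases "k = m") (simp_all add: component_fun_def)
  moreover have "summable (\<lambda>k. \<integral>x. (cmod (component_fun m g k x))\<^sup>2 \<partial>half_line_pow k)"
    by (rule summable_finite[of "{m}"]) (auto simp: component_fun_def)
  ultimately show ?thesis by (simp add: fock_carrier_def)
qed

lemma norm_component_diff_square:
  assumes "square_integrable (half_line_pow m) g" "square_integrable (half_line_pow m) h"
  shows "(norm (abs_fock (component_fun m g) - abs_fock (component_fun m h)))\<^sup>2
    = (\<integral>x. (cmod (g x - h x))\<^sup>2 \<partial>half_line_pow m)"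
proof -
  note c = component_fun_carrier[OF assms(1)] component_fun_carrier[OF assms(2)]
  have "(norm (abs_fock (component_fun m g) - abs_fock (component_fun m h)))\<^sup>2
    = (\<Sum>k. \<integral>x. (cmod (component_fun m g k x - component_fun m h k x))\<^sup>2 \<partial>half_line_pow k)"
    unfolding abs_fock_diff[OF c] by (rule norm_abs_fock_square[OF fock_carrier_diff[OF c]])
  also have "\<dots> = (\<Sum>k\<in>{m}. \<integral>x. (cmod (component_fun m g k x - component_fun m h k x))\<^sup>2 \<partial>half_line_pow k)"
    by (rule suminf_finite) (auto simp: component_fun_def)
  finally show ?thesis by (simp add: component_fun_def)
qed

lemma abs_fock_cong:
  assumes "f \<in> fock_carrier" "g \<in> fock_carrier" "\<And>m. AE x in half_line_pow m. f m x = g m x"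
  shows "abs_fock f = abs_fock g"
  using assms by (intro Quotient_rel_abs[OF Quotient_fock]) (simp add: fock_rel_def)

lemma abs_fock_add:
  assumes "f \<in> fock_carrier" "g \<in> fock_carrier"
  shows "abs_fock f + abs_fock g = abs_fock (\<lambda>m x. f m x + g m x)"
  by (rule plus_fock.abs_eq) (intro fock_carrier_rel assms)+

lemma abs_fock_scale:
  assumes "f \<in> fock_carrier"
  shows "c *\<^sub>C abs_fock f = abs_fock (\<lambda>m x. c * f m x)"
  by (rule scale_fock.abs_eq) (intro fock_carrier_rel assms)

lemma tensor_left_abs_fock:
  assumes "real_L2 h" "f \<in> fock_carrier"
  shows "h \<otimes>\<^sub>L abs_fock f = abs_fock (tensor_fun h f)"
  using tensor_left.abs_eq[OF fock_carrier_rel[OF assms(2)], of h] assms(1) by simp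

lemma real_L2_step: "real_L2 (indicator {0..<s})"
proof -
  have "(\<lambda>x. (indicator {0..<s} x)\<^sup>2) = (indicator {0..<s} :: real \<Rightarrow> real)"
    by (auto simp: indicator_def fun_eq_iff)
  then show ?thesis
    using atLeastLessThan_in_sets_half_line emeasure_half_line_atLeastLessThan[of s]
    unfolding real_L2_def by (auto simp: less_top[symmetric])
qed

text \<open>A box indicator is a product over the coordinates, so one more tensor factor raises the
  level by one. This links all boxes to the vacuum by induction.\<close>

lemma tensor_left_step_box:
  "indicator {0..<s 0} \<otimes>\<^sub>L abs_fock (component_fun m (indicator (step_box m (\<lambda>i. s (Suc i)))))
     = abs_fock (component_fun (Suc m) (indicator (step_box (Suc m) s)))"
proof -
  have c: "component_fun k (indicator (step_box k r)) \<in> fock_carrier" for k r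
    by (intro component_fun_carrier square_integrable_indicator step_box_in_sets emeasure_step_box_finite)
  show ?thesis
    unfolding tensor_left_abs_fock[OF real_L2_step c]
  proof (rule abs_fock_cong[OF fock_carrier_tensor_fun[OF real_L2_step c] c], rule AE_I2)
    fix k y assume y: "y \<in> space (half_line_pow k)"
    show "tensor_fun (indicator {0..<s 0}) (component_fun m (indicator (step_box m (\<lambda>i. s (Suc i))))) k y
        = component_fun (Suc m) (indicator (step_box (Suc m) s)) k y"
    proof (cases "k = Suc m")
      case True
      with y have "y \<in> extensional {..<Suc m}"
        by (simp add: half_line_pow_def space_PiM PiE_def)
      then have "y \<in> step_box (Suc m) s \<longleftrightarrow> y 0 \<in> {0..<s 0} \<and> pt_tl m y \<in> step_box m (\<lambda>i. s (Suc i))"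
        by (auto simp: step_box_def pt_tl_def PiE_iff less_Suc_eq_0_disj)
      with True show ?thesis
        by (simp add: tensor_fun_def component_fun_def indicator_def)
    qed (auto simp: tensor_fun_def component_fun_def split: nat.splits)
  qed
qed

lemma component_step_box_0: "abs_fock (component_fun 0 (indicator (step_box 0 s))) = \<Omega>"
proof -
  have v: "(\<lambda>m (_ :: nat \<Rightarrow> real). if m = 0 then 1 else 0 :: complex) \<in> fock_carrier"
    using vacuum.rsp by (simp add: fock_rel_def eq_onp_def)
  have c: "component_fun 0 (indicator (step_box 0 s)) \<in> fock_carrier"
    by (intro component_fun_carrier square_integrable_indicator step_box_in_sets emeasure_step_box_finite)
  show ?thesis
    unfolding vacuum_def
  proof (rule abs_fock_cong[OF c v], rule AE_I2)
    fix m x assume "x \<in> space (half_line_pow m)"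
    then show "component_fun 0 (indicator (step_box 0 s)) m x = (if m = 0 then 1 else 0)"
      by (auto simp: component_fun_def step_box_def half_line_pow_def space_PiM)
  qed
qed

lemma LIMSEQ_if_norm_diff_square:
  fixes X :: "nat \<Rightarrow> 'a::real_normed_vector"
  assumes "(\<lambda>k. (norm (X k - G))\<^sup>2) \<longlonglongrightarrow> 0"
  shows "X \<longlonglongrightarrow> G"
  using tendsto_real_sqrt[OF assms] by (simp add: tendsto_norm_zero_iff LIM_zero_iff)

text \<open>Density in the form of an induction principle: tensoring reaches all boxes, boxes
  generate each level, and finitely many levels approximate any vector.\<close>

lemma step_tensors_dense [case_names closed add scale vacuum tensor]:
  assumes closed: "closed {F. P F}"
    and add: "\<And>F G. P F \<Longrightarrow> P G \<Longrightarrow> P (F + G)" and scale: "\<And>c F. P F \<Longrightarrow> P (c *\<^sub>C F)"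
    and vac: "P \<Omega>" and tensor: "\<And>s F. s \<ge> 0 \<Longrightarrow> P F \<Longrightarrow> P (indicator {0..<s} \<otimes>\<^sub>L F)"
  shows "P F"
proof -
  have tensor': "P (indicator {0..<s} \<otimes>\<^sub>L F)" if "P F" for s F
  proof -
    \<comment> \<open>A negative endpoint gives the empty interval, as 0 does.\<close>
    have "{0..<s} = {0..<max s 0}" by auto
    then show ?thesis using tensor[OF _ that, of "max s 0"] by simp
  qed
  have P_0: "P 0" using scale[OF vac, of 0] by simp
  have P_lim: "P G" if "\<And>k. P (X k)" "X \<longlonglongrightarrow> G" for X G
    using closed that unfolding closed_sequential_limits by blast
  have P_box: "P (abs_fock (component_fun m (indicator (step_box m s))))" for m s
  proof (induction m arbitrary: s)
    case 0
    show ?case unfolding component_step_box_0 by (rule vac)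
  next
    case (Suc m)
    from tensor'[OF Suc.IH[of "\<lambda>i. s (Suc i)"], of "s 0"] show ?case by (simp only: tensor_left_step_box)
  qed
  have P_component: "P (abs_fock (component_fun m g))" if g: "square_integrable (half_line_pow m) g" for m g
  proof (rule square_integrable_induct[OF g sets_half_line_pow, where R = "\<lambda>k::nat. step_box m (\<lambda>_. real k)"])
    show "range (step_box m) \<subseteq> Pow (space (half_line_pow m))"
      using sets.sets_into_space[OF step_box_in_sets] by blast
    show "Int_stable (range (step_box m))"
    proof (rule Int_stableI)
      fix A B assume "A \<in> range (step_box m)" "B \<in> range (step_box m)"
      then obtain s r where "A = step_box m s" "B = step_box m r" by blast
      then have "A \<inter> B = step_box m (\<lambda>i. min (s i) (r i))"
        by (simp add: step_box_def PiE_Int)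
      then show "A \<inter> B \<in> range (step_box m)" by blast
    qed
    show "emeasure (half_line_pow m) A \<noteq> \<infinity>" if "A \<in> range (step_box m)" for A
      using that emeasure_step_box_finite by blast
    have "(\<Union>k::nat. step_box m (\<lambda>_. real k)) = space (half_line_pow m)"
    proof (intro equalityI subsetI)
      fix x assume "x \<in> space (half_line_pow m)"
      then have x: "x \<in> (\<Pi>\<^sub>E i\<in>{..<m}. {0..})"
        by (auto simp: half_line_pow_def space_PiM space_restrict_space)
      obtain k :: nat where k: "(\<Sum>j<m. \<bar>x j\<bar>) < real k" using reals_Archimedean2 by blast
      have "x j < real k" if "j < m" for j
        using member_le_sum[of j "{..<m}" "\<lambda>j. \<bar>x j\<bar>"] k that by auto
      then have "x \<in> step_box m (\<lambda>_. real k)"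
        using x by (auto simp: step_box_def PiE_iff)
      then show "x \<in> (\<Union>k::nat. step_box m (\<lambda>_. real k))" by blast
    qed (use sets.sets_into_space[OF step_box_in_sets] in blast)
    moreover have "incseq (\<lambda>k::nat. step_box m (\<lambda>_. real k))"
      unfolding incseq_def step_box_def by (auto intro!: PiE_mono)
    ultimately show "range (\<lambda>k. step_box m (\<lambda>_. real k)) \<subseteq> range (step_box m) \<and>
      incseq (\<lambda>k::nat. step_box m (\<lambda>_. real k)) \<and> (\<Union>k::nat. step_box m (\<lambda>_. real k)) = space (half_line_pow m)"
      by blast
  next
    show "P (abs_fock (component_fun m (indicator A)))" if "A \<in> range (step_box m)" for A
      using that P_box by blast
  next
    fix f g :: "(nat \<Rightarrow> real) \<Rightarrow> complex"
    assume fg: "square_integrable (half_line_pow m) f" "square_integrable (half_line_pow m) g"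
      "P (abs_fock (component_fun m f))" "P (abs_fock (component_fun m g))"
    have "component_fun m (\<lambda>x. f x + g x) = (\<lambda>k x. component_fun m f k x + component_fun m g k x)"
      by (auto simp: component_fun_def fun_eq_iff)
    then show "P (abs_fock (component_fun m (\<lambda>x. f x + g x)))"
      using add[OF fg(3,4)] component_fun_carrier[OF fg(1)] component_fun_carrier[OF fg(2)]
      by (simp add: abs_fock_add)
  next
    fix f :: "(nat \<Rightarrow> real) \<Rightarrow> complex" and c
    assume f: "square_integrable (half_line_pow m) f" "P (abs_fock (component_fun m f))"
    have "component_fun m (\<lambda>x. c * f x) = (\<lambda>k x. c * component_fun m f k x)"
      by (auto simp: component_fun_def fun_eq_iff)
    then show "P (abs_fock (component_fun m (\<lambda>x. c * f x)))"
      using scale[OF f(2), of c] component_fun_carrier[OF f(1)]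
      by (simp add: abs_fock_scale)
  next
    fix u :: "nat \<Rightarrow> (nat \<Rightarrow> real) \<Rightarrow> complex" and g
    assume lim: "\<And>k. square_integrable (half_line_pow m) (u k)" "\<And>k. P (abs_fock (component_fun m (u k)))"
      "square_integrable (half_line_pow m) g"
      "(\<lambda>k. \<integral>x. (cmod (u k x - g x))\<^sup>2 \<partial>half_line_pow m) \<longlonglongrightarrow> 0"
    have "(\<lambda>k. (norm (abs_fock (component_fun m (u k)) - abs_fock (component_fun m g)))\<^sup>2) \<longlonglongrightarrow> 0"
      unfolding norm_component_diff_square[OF lim(1,3)] by (rule lim(4))
    then have "(\<lambda>k. abs_fock (component_fun m (u k))) \<longlonglongrightarrow> abs_fock (component_fun m g)"
      by (rule LIMSEQ_if_norm_diff_square)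
    with lim(2) show "P (abs_fock (component_fun m g))" by (rule P_lim)
  qed
  obtain f where f: "f \<in> fock_carrier" and F: "F = abs_fock f" by (rule fock_cases)
  have sq: "square_integrable (half_line_pow m) (f m)" for m
    using f by (simp add: fock_carrier_def)
  let ?p = "\<lambda>N k x. if k < N then f k x else 0"
  have p_carr: "?p N \<in> fock_carrier" for N
  proof -
    have "square_integrable (half_line_pow k) (?p N k)" for k
      using sq by (cases "k < N") simp_all
    moreover have "summable (\<lambda>k. \<integral>x. (cmod (?p N k x))\<^sup>2 \<partial>half_line_pow k)"
      by (rule summable_finite[of "{..<N}"]) auto
    ultimately show ?thesis by (simp add: fock_carrier_def)
  qed
  have P_p: "P (abs_fock (?p N))" for N
  proof (induction N)
    case 0
    have "abs_fock (?p 0) = 0" by (simp add: zero_fock_def)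
    then show ?case using P_0 by simp
  next
    case (Suc N)
    have "?p (Suc N) = (\<lambda>k x. ?p N k x + component_fun N (f N) k x)"
      by (auto simp: component_fun_def fun_eq_iff less_Suc_eq)
    then have "abs_fock (?p (Suc N)) = abs_fock (?p N) + abs_fock (component_fun N (f N))"
      by (simp only: abs_fock_add[OF p_carr component_fun_carrier[OF sq]])
    then show ?case using add[OF Suc.IH P_component[OF sq]] by simp
  qed
  let ?n = "\<lambda>k. \<integral>x. (cmod (f k x))\<^sup>2 \<partial>half_line_pow k"
  have summ: "summable ?n" using f by (simp add: fock_carrier_def)
  have "(norm (F - abs_fock (?p N)))\<^sup>2 = (\<Sum>k. ?n k) - (\<Sum>k<N. ?n k)" for N
  proof -
    have "(norm (F - abs_fock (?p N)))\<^sup>2 = (\<Sum>k. \<integral>x. (cmod (f k x - ?p N k x))\<^sup>2 \<partial>half_line_pow k)"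
      unfolding F abs_fock_diff[OF f p_carr] by (rule norm_abs_fock_square[OF fock_carrier_diff[OF f p_carr]])
    also have "\<dots> = (\<Sum>k. ?n k - (if k < N then ?n k else 0))"
      by (intro arg_cong[where f = suminf] ext) auto
    also have "\<dots> = (\<Sum>k. ?n k) - (\<Sum>k. if k < N then ?n k else 0)"
      by (rule suminf_diff[symmetric, OF summ summable_finite[of "{..<N}"]]) auto
    also have "(\<Sum>k. if k < N then ?n k else 0) = (\<Sum>k<N. if k < N then ?n k else 0)"
      by (rule suminf_finite) auto
    finally show ?thesis by simp
  qed
  moreover have "(\<lambda>N. (\<Sum>k. ?n k) - (\<Sum>k<N. ?n k)) \<longlonglongrightarrow> (\<Sum>k. ?n k) - (\<Sum>k. ?n k)"
    by (intro tendsto_intros summable_LIMSEQ summ)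
  ultimately have "(\<lambda>N. (norm (F - abs_fock (?p N)))\<^sup>2) \<longlonglongrightarrow> 0" by simp
  then have "(\<lambda>N. abs_fock (?p N)) \<longlonglongrightarrow> F"
    unfolding norm_minus_commute[of F] by (rule LIMSEQ_if_norm_diff_square)
  with P_p show ?thesis by (rule P_lim)
qed

section \<open>Creation, annihilation and gauge operators as bounded operators\<close>

lemma norm_tensor_left_square:
  assumes "real_L2 h"
  shows "(norm (h \<otimes>\<^sub>L F))\<^sup>2 = (\<integral>x. h x * h x \<partial>half_line) * (norm F)\<^sup>2"
  using cinner_tensor_left[OF assms assms, of F F]
  unfolding cinner_self scaleR_conv_of_real of_real_mult[symmetric] of_real_eq_iff .

lemma bounded_clinear_tensor_left:
  assumes h: "real_L2 h"
  shows "bounded_clinear (\<lambda>F. h \<otimes>\<^sub>L F)"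
proof (rule bounded_clinearI)
  fix F G c
  obtain f g where f: "f \<in> fock_carrier" "F = abs_fock f" and g: "g \<in> fock_carrier" "G = abs_fock g"
    by (metis fock_cases)
  note t = fock_carrier_tensor_fun[OF h f(1)] fock_carrier_tensor_fun[OF h g(1)]
  have "tensor_fun h (\<lambda>m x. f m x + g m x) = (\<lambda>m x. tensor_fun h f m x + tensor_fun h g m x)"
    by (auto simp: tensor_fun_def fun_eq_iff algebra_simps split: nat.splits)
  then show "h \<otimes>\<^sub>L (F + G) = h \<otimes>\<^sub>L F + h \<otimes>\<^sub>L G"
    unfolding f(2) g(2) abs_fock_add[OF f(1) g(1)] tensor_left_abs_fock[OF h f(1)] tensor_left_abs_fock[OF h g(1)]
      tensor_left_abs_fock[OF h fock_carrier_add[OF f(1) g(1)]] abs_fock_add[OF t] by (rule arg_cong)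
  have "tensor_fun h (\<lambda>m x. c * f m x) = (\<lambda>m x. c * tensor_fun h f m x)"
    by (auto simp: tensor_fun_def fun_eq_iff split: nat.splits)
  then show "h \<otimes>\<^sub>L (c *\<^sub>C F) = c *\<^sub>C h \<otimes>\<^sub>L F"
    unfolding f(2) abs_fock_scale[OF f(1)] tensor_left_abs_fock[OF h f(1)]
      tensor_left_abs_fock[OF h fock_carrier_scale[OF f(1)]] abs_fock_scale[OF t(1)] by (rule arg_cong)
  have "norm (h \<otimes>\<^sub>L F) = sqrt ((\<integral>x. h x * h x \<partial>half_line) * (norm F)\<^sup>2)"
    unfolding norm_tensor_left_square[OF h, symmetric] by simp
  then show "norm (h \<otimes>\<^sub>L F) \<le> sqrt (\<integral>x. h x * h x \<partial>half_line) * norm F"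
    by (simp add: real_sqrt_mult)
qed

lemma real_L2_iff: "real_L2 h \<longleftrightarrow> square_integrable half_line (\<lambda>x. complex_of_real (h x))"
proof -
  have "h \<in> borel_measurable half_line \<longleftrightarrow> (\<lambda>x. complex_of_real (h x)) \<in> borel_measurable half_line"
  proof
    assume "(\<lambda>x. complex_of_real (h x)) \<in> borel_measurable half_line"
    from measurable_compose[OF this borel_measurable_Re] show "h \<in> borel_measurable half_line" by simp
  qed simp
  then show ?thesis unfolding real_L2_def square_integrable_def norm_of_real power2_abs by (rule conj_cong) simp
qed

lemma real_L2_add: "real_L2 h \<Longrightarrow> real_L2 k \<Longrightarrow> real_L2 (\<lambda>x. h x + k x)"
  unfolding real_L2_iff of_real_add by (rule square_integrable_add(1))

lemma real_L2_scale: "real_L2 h \<Longrightarrow> real_L2 (\<lambda>x. r * h x)"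
  unfolding real_L2_iff of_real_mult by (rule square_integrable_scale(1))

lemma real_L2_zero: "real_L2 (\<lambda>x. 0)"
  by (simp add: real_L2_def)

lemma tensor_left_add_fun:
  assumes h: "real_L2 h" and k: "real_L2 k"
  shows "(\<lambda>x. h x + k x) \<otimes>\<^sub>L F = h \<otimes>\<^sub>L F + k \<otimes>\<^sub>L F"
proof -
  obtain f where f: "f \<in> fock_carrier" "F = abs_fock f" by (rule fock_cases)
  have "tensor_fun (\<lambda>x. h x + k x) f = (\<lambda>m x. tensor_fun h f m x + tensor_fun k f m x)"
    by (auto simp: tensor_fun_def fun_eq_iff algebra_simps split: nat.splits)
  then show ?thesis
    unfolding f(2) tensor_left_abs_fock[OF h f(1)] tensor_left_abs_fock[OF k f(1)]
      tensor_left_abs_fock[OF real_L2_add[OF h k] f(1)]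
      abs_fock_add[OF fock_carrier_tensor_fun[OF h f(1)] fock_carrier_tensor_fun[OF k f(1)]]
    by (rule arg_cong)
qed

lemma tensor_left_scale_fun:
  assumes h: "real_L2 h"
  shows "(\<lambda>x. r * h x) \<otimes>\<^sub>L F = complex_of_real r *\<^sub>C h \<otimes>\<^sub>L F"
proof -
  obtain f where f: "f \<in> fock_carrier" "F = abs_fock f" by (rule fock_cases)
  have "tensor_fun (\<lambda>x. r * h x) f = (\<lambda>m x. complex_of_real r * tensor_fun h f m x)"
    by (auto simp: tensor_fun_def fun_eq_iff split: nat.splits)
  then show ?thesis
    unfolding f(2) tensor_left_abs_fock[OF h f(1)] tensor_left_abs_fock[OF real_L2_scale[OF h] f(1)]
      abs_fock_scale[OF fock_carrier_tensor_fun[OF h f(1)]]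
    by (rule arg_cong)
qed

lemma tensor_left_zero_fun: "(\<lambda>x. 0) \<otimes>\<^sub>L F = 0"
  using tensor_left_scale_fun[OF real_L2_zero, of 0 F] by simp

lemma tensor_left_sum_fun:
  assumes "\<And>i. i \<in> I \<Longrightarrow> real_L2 (h i)"
  shows "real_L2 (\<lambda>x. \<Sum>i\<in>I. h i x)" "(\<lambda>x. \<Sum>i\<in>I. h i x) \<otimes>\<^sub>L F = (\<Sum>i\<in>I. h i \<otimes>\<^sub>L F)"
proof -
  have "real_L2 (\<lambda>x. \<Sum>i\<in>I. h i x) \<and> (\<lambda>x. \<Sum>i\<in>I. h i x) \<otimes>\<^sub>L F = (\<Sum>i\<in>I. h i \<otimes>\<^sub>L F)"
    using assms
    by (induction I rule: infinite_finite_induct)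
      (auto simp: tensor_left_zero_fun real_L2_zero tensor_left_add_fun real_L2_add)
  then show "real_L2 (\<lambda>x. \<Sum>i\<in>I. h i x)" "(\<lambda>x. \<Sum>i\<in>I. h i x) \<otimes>\<^sub>L F = (\<Sum>i\<in>I. h i \<otimes>\<^sub>L F)" by auto
qed

section \<open>Annihilation operators\<close>

lemma annihilation_abs_fock:
  assumes "real_L2 h" "f \<in> fock_carrier"
  shows "annihilation h (abs_fock f) = abs_fock (annihilate_fun h f)"
  using annihilation.abs_eq[OF fock_carrier_rel[OF assms(2)], of h] assms(1) by simp

text \<open>Additivity of the integral needs integrable sections, and these exist only for almost
  every \<open>w\<close>; so annihilation is additive on classes rather than pointwise on
  representatives.\<close>

lemma AE_integrable_annihilate:
  assumes h: "real_L2 h" and f: "square_integrable (half_line_pow (Suc m)) f"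
  shows "AE w in half_line_pow m. integrable half_line (\<lambda>x. complex_of_real (h x) * f (pt_cons m x w))"
proof -
  have [measurable]: "f \<in> borel_measurable (half_line_pow (Suc m))"
    and if': "integrable (half_line_pow (Suc m)) (\<lambda>y. (cmod (f y))\<^sup>2)"
    using f by (auto simp: square_integrable_def)
  let ?k = "\<lambda>w x. (cmod (f (pt_cons m x w)))\<^sup>2"
  have meas_f: "(\<lambda>p. f (pt_cons m (snd p) (fst p))) \<in> borel_measurable (half_line_pow m \<Otimes>\<^sub>M half_line)"
    by measurable
  have meas_f2: "(\<lambda>y. (cmod (f y))\<^sup>2) \<in> borel_measurable (half_line_pow (Suc m))" by measurable
  have int_k: "integrable (half_line_pow m \<Otimes>\<^sub>M half_line) (case_prod ?k)"
    using if' unfolding integrable_half_line_pow_Suc_iff[OF meas_f2] by (simp add: case_prod_beta')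
  show ?thesis
    using half_line_pair.AE_integrable_fst[OF int_k] AE_space
  proof eventually_elim
    case (elim w)
    have "(\<lambda>x. f (pt_cons m x w)) \<in> borel_measurable half_line"
      using measurable_Pair2[OF meas_f elim(2)] by simp
    with elim(1) have "square_integrable half_line (\<lambda>x. f (pt_cons m x w))"
      by (simp add: square_integrable_def)
    from square_integrable_cnj_mult(1)[OF h[unfolded real_L2_iff] this] show ?case by simp
  qed
qed

text \<open>The constant is inherited from \<open>annihilate_fun_sq\<close> and is not sharp. What
  matters is that it stays bounded while the function runs through steps of bounded length.\<close>

lemma annihilation_properties:
  assumes h: "real_L2 h"
  shows annihilation_add: "annihilation h (F + G) = annihilation h F + annihilation h G"
    and annihilation_scale: "annihilation h (c *\<^sub>C F) = c *\<^sub>C annihilation h F"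
    and norm_annihilation_le: "norm (annihilation h F) \<le> sqrt (1 + (\<integral>x. (h x)\<^sup>2 \<partial>half_line)) * norm F"
proof -
  obtain f g where f: "f \<in> fock_carrier" "F = abs_fock f" and g: "g \<in> fock_carrier" "G = abs_fock g"
    by (metis fock_cases)
  note t = fock_carrier_annihilate_fun[OF h f(1)] fock_carrier_annihilate_fun[OF h g(1)]
  have sq: "square_integrable (half_line_pow m) (f m)" "square_integrable (half_line_pow m) (g m)" for m
    using f(1) g(1) by (auto simp: fock_carrier_def)
  have "abs_fock (annihilate_fun h (\<lambda>m x. f m x + g m x))
      = abs_fock (\<lambda>m x. annihilate_fun h f m x + annihilate_fun h g m x)"
  proof (rule abs_fock_cong[OF fock_carrier_annihilate_fun[OF h fock_carrier_add[OF f(1) g(1)]] fock_carrier_add[OF t]])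
    fix m
    show "AE w in half_line_pow m. annihilate_fun h (\<lambda>m x. f m x + g m x) m w
        = annihilate_fun h f m w + annihilate_fun h g m w"
      using AE_integrable_annihilate[OF h sq(1)] AE_integrable_annihilate[OF h sq(2)]
      by eventually_elim (simp add: annihilate_fun_def distrib_left)
  qed
  then show "annihilation h (F + G) = annihilation h F + annihilation h G"
    unfolding f(2) g(2) abs_fock_add[OF f(1) g(1)] annihilation_abs_fock[OF h f(1)] annihilation_abs_fock[OF h g(1)]
      annihilation_abs_fock[OF h fock_carrier_add[OF f(1) g(1)]] abs_fock_add[OF t] .
  have "annihilate_fun h (\<lambda>m x. c * f m x) = (\<lambda>m x. c * annihilate_fun h f m x)"
    by (auto simp: annihilate_fun_def fun_eq_iff mult.left_commute)
  then show "annihilation h (c *\<^sub>C F) = c *\<^sub>C annihilation h F"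
    unfolding f(2) abs_fock_scale[OF f(1)] annihilation_abs_fock[OF h f(1)]
      annihilation_abs_fock[OF h fock_carrier_scale[OF f(1)]] abs_fock_scale[OF t(1)] by (rule arg_cong)
  let ?n = "\<lambda>f m. \<integral>x. (cmod (f m x))\<^sup>2 \<partial>half_line_pow m"
  let ?C = "1 + (\<integral>x. (h x)\<^sup>2 \<partial>half_line)"
  have C: "?C \<ge> 0" by (intro add_nonneg_nonneg integral_nonneg_AE) auto
  have s: "summable (?n f)" "summable (?n (annihilate_fun h f))"
    using f(1) t(1) by (auto simp: fock_carrier_def)
  have s': "summable (\<lambda>m. ?n f (Suc m))" using s(1) by (subst summable_Suc_iff)
  have "(norm (annihilation h F))\<^sup>2 = (\<Sum>m. ?n (annihilate_fun h f) m)"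
    unfolding f(2) annihilation_abs_fock[OF h f(1)] by (rule norm_abs_fock_square[OF t(1)])
  also have "\<dots> \<le> (\<Sum>m. ?C * ?n f (Suc m))"
    by (intro suminf_le annihilate_fun_sq(2)[where f = f, OF h sq(1)] s(2) summable_mult s')
  also have "\<dots> = ?C * (\<Sum>m. ?n f (Suc m))" by (rule suminf_mult[OF s'])
  also have "(\<Sum>m. ?n f (Suc m)) = (\<Sum>m. ?n f m) - ?n f 0" by (rule suminf_split_head[OF s(1)])
  also have "?C * \<dots> \<le> ?C * (norm F)\<^sup>2"
    using C unfolding f(2) norm_abs_fock_square[OF f(1)] by (intro mult_left_mono) auto
  finally have "norm (annihilation h F) \<le> sqrt (?C * (norm F)\<^sup>2)" by (rule real_le_rsqrt)
  then show "norm (annihilation h F) \<le> sqrt ?C * norm F" by (simp add: real_sqrt_mult)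
qed

lemma bounded_clinear_annihilation:
  assumes "real_L2 h"
  shows "bounded_clinear (annihilation h)"
  by (rule bounded_clinearI annihilation_properties assms)+

lemma vacuum_abs_fock: "\<Omega> = abs_fock (\<lambda>m _. if m = 0 then 1 else 0)"
  and vacuum_carrier: "(\<lambda>m (_ :: nat \<Rightarrow> real). if m = 0 then 1 else 0 :: complex) \<in> fock_carrier"
  using vacuum.rsp by (simp_all add: vacuum_def fock_rel_def eq_onp_def)

lemma annihilation_vacuum:
  assumes h: "real_L2 h"
  shows "annihilation h \<Omega> = 0"
proof -
  have "annihilate_fun h (\<lambda>m _. if m = 0 then 1 else 0) = (\<lambda>_ _. 0)"
    by (auto simp: annihilate_fun_def fun_eq_iff)
  then show ?thesis
    unfolding vacuum_abs_fock annihilation_abs_fock[OF h vacuum_carrier] zero_fock_def by (rule arg_cong)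
qed

text \<open>The free relation a^-(h) a^+(k) = <h, k> Id: integrating out the first coordinate undoes
  its insertion.\<close>

lemma annihilation_tensor_left:
  assumes h: "real_L2 h" and k: "real_L2 k"
  shows "annihilation h (k \<otimes>\<^sub>L F) = complex_of_real (\<integral>x. h x * k x \<partial>half_line) *\<^sub>C F"
proof -
  obtain f where f: "f \<in> fock_carrier" "F = abs_fock f" by (rule fock_cases)
  note t = fock_carrier_tensor_fun[OF k f(1)]
  show ?thesis
    unfolding f(2) tensor_left_abs_fock[OF k f(1)] annihilation_abs_fock[OF h t] abs_fock_scale[OF f(1)]
  proof (rule abs_fock_cong[OF fock_carrier_annihilate_fun[OF h t] fock_carrier_scale[OF f(1)]], rule AE_I2)
    fix m w assume w: "w \<in> space (half_line_pow m)"
    have "annihilate_fun h (tensor_fun k f) m w = (\<integral>x. complex_of_real (h x * k x) * f m w \<partial>half_line)"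
      by (simp add: annihilate_fun_def tensor_fun_def pt_tl_cons[OF w] mult.assoc)
    also have "\<dots> = complex_of_real (\<integral>x. h x * k x \<partial>half_line) * f m w"
      by (simp only: integral_mult_left_zero integral_complex_of_real)
    finally show "annihilate_fun h (tensor_fun k f) m w
        = complex_of_real (\<integral>x. h x * k x \<partial>half_line) * f m w" .
  qed
qed

section \<open>Indicators of initial intervals and their gauge operators\<close>

abbreviation step :: "real \<Rightarrow> real \<Rightarrow> real" where
  "step c \<equiv> indicator {0..<c}"

lemma real_Linf_step: "real_Linf (step c)"
  unfolding real_Linf_def
proof
  show "step c \<in> borel_measurable half_line"
    using real_L2_step[of c] by (simp add: real_L2_def)
qed (auto intro!: exI[of _ 1] simp: indicator_def)

lemma gauge_op_abs_fock:
  assumes "f \<in> fock_carrier"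
  shows "gauge_op (step c) (abs_fock f) = abs_fock (gauge_fun (step c) f)"
  using gauge_op.abs_eq[OF fock_carrier_rel[OF assms], of "step c"] real_Linf_step[of c] by simp

lemma gauge_op_step_properties:
  shows gauge_op_step_add: "gauge_op (step c) (F + G) = gauge_op (step c) F + gauge_op (step c) G"
    and gauge_op_step_scale: "gauge_op (step c) (a *\<^sub>C F) = a *\<^sub>C gauge_op (step c) F"
    and norm_gauge_op_step_le: "norm (gauge_op (step c) F) \<le> norm F"
proof -
  obtain f g where f: "f \<in> fock_carrier" "F = abs_fock f" and g: "g \<in> fock_carrier" "G = abs_fock g"
    by (metis fock_cases)
  note t = fock_carrier_gauge_fun[OF real_Linf_step f(1), of c] fock_carrier_gauge_fun[OF real_Linf_step g(1), of c]
  have "gauge_fun (step c) (\<lambda>m x. f m x + g m x) = (\<lambda>m x. gauge_fun (step c) f m x + gauge_fun (step c) g m x)"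
    by (auto simp: gauge_fun_def fun_eq_iff algebra_simps)
  then show "gauge_op (step c) (F + G) = gauge_op (step c) F + gauge_op (step c) G"
    unfolding f(2) g(2) abs_fock_add[OF f(1) g(1)] gauge_op_abs_fock[OF f(1)] gauge_op_abs_fock[OF g(1)]
      gauge_op_abs_fock[OF fock_carrier_add[OF f(1) g(1)]] abs_fock_add[OF t] by (rule arg_cong)
  have "gauge_fun (step c) (\<lambda>m x. a * f m x) = (\<lambda>m x. a * gauge_fun (step c) f m x)"
    by (auto simp: gauge_fun_def fun_eq_iff)
  then show "gauge_op (step c) (a *\<^sub>C F) = a *\<^sub>C gauge_op (step c) F"
    unfolding f(2) abs_fock_scale[OF f(1)] gauge_op_abs_fock[OF f(1)]
      gauge_op_abs_fock[OF fock_carrier_scale[OF f(1)]] abs_fock_scale[OF t(1)] by (rule arg_cong)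
  have "(norm (gauge_op (step c) F))\<^sup>2 = (\<Sum>m. \<integral>x. (cmod (gauge_fun (step c) f m x))\<^sup>2 \<partial>half_line_pow m)"
    unfolding f(2) gauge_op_abs_fock[OF f(1)] by (rule norm_abs_fock_square[OF t(1)])
  also have "\<dots> \<le> (\<Sum>m. \<integral>x. (cmod (f m x))\<^sup>2 \<partial>half_line_pow m)"
  proof (intro suminf_le integral_mono)
    show "(cmod (gauge_fun (step c) f m x))\<^sup>2 \<le> (cmod (f m x))\<^sup>2" for m x
      by (auto simp: gauge_fun_def indicator_def)
  qed (use t(1) f(1) in \<open>auto simp: fock_carrier_def square_integrable_def\<close>)
  also have "\<dots> = (norm F)\<^sup>2" unfolding f(2) by (rule norm_abs_fock_square[OF f(1), symmetric])
  finally show "norm (gauge_op (step c) F) \<le> norm F" by (rule power2_le_imp_le) simp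
qed

lemma bounded_clinear_gauge_op_step: "bounded_clinear (gauge_op (step c))"
  using norm_gauge_op_step_le by (intro bounded_clinearI[where K = 1] gauge_op_step_properties) simp

lemma gauge_op_step_vacuum: "gauge_op (step c) \<Omega> = 0"
proof -
  have "gauge_fun (step c) (\<lambda>m _. if m = 0 then 1 else 0) = (\<lambda>_ _. 0)"
    by (auto simp: gauge_fun_def fun_eq_iff)
  then show ?thesis
    unfolding vacuum_abs_fock gauge_op_abs_fock[OF vacuum_carrier] zero_fock_def by (rule arg_cong)
qed

lemma gauge_op_step_tensor_left:
  assumes h: "real_L2 h" and sh: "real_L2 (\<lambda>x. step c x * h x)"
  shows "gauge_op (step c) (h \<otimes>\<^sub>L F) = (\<lambda>x. step c x * h x) \<otimes>\<^sub>L F"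
proof -
  obtain f where f: "f \<in> fock_carrier" "F = abs_fock f" by (rule fock_cases)
  have "gauge_fun (step c) (tensor_fun h f) = tensor_fun (\<lambda>x. step c x * h x) f"
    by (auto simp: gauge_fun_def tensor_fun_def fun_eq_iff split: nat.splits)
  then show ?thesis
    unfolding f(2) tensor_left_abs_fock[OF h f(1)] tensor_left_abs_fock[OF sh f(1)]
      gauge_op_abs_fock[OF fock_carrier_tensor_fun[OF h f(1)]] by (rule arg_cong)
qed

lemma step_mult_step: "step c x * step d x = step (min c d) x"
  by (auto simp: indicator_def)

lemma integral_step: "c \<ge> 0 \<Longrightarrow> (\<integral>x. step c x \<partial>half_line) = c"
  using emeasure_half_line_atLeastLessThan[of c]
  by (simp add: measure_def space_restrict_space Int_absorb2 subset_eq)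

text \<open>Two steps have the smaller length as scalar product, and
  \<open>c + d - 2 * min c d\<close> equals \<open>\<bar>c - d\<bar>\<close>.\<close>

lemma norm_step_tensor_diff_square:
  assumes "c \<ge> 0" "d \<ge> 0"
  shows "(norm (step c \<otimes>\<^sub>L F - step d \<otimes>\<^sub>L F))\<^sup>2 = \<bar>c - d\<bar> * (norm F)\<^sup>2"
proof -
  have i: "\<langle>step a \<otimes>\<^sub>L F, step b \<otimes>\<^sub>L F\<rangle> = complex_of_real (min a b * (norm F)\<^sup>2)"
    if "a \<ge> 0" "b \<ge> 0" for a b
  proof -
    have "min a b \<ge> 0" using that by simp
    then show ?thesis
      unfolding cinner_tensor_left[OF real_L2_step real_L2_step] step_mult_step
      by (simp only: integral_step cinner_self scaleR_conv_of_real of_real_mult)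
  qed
  have "step a \<otimes>\<^sub>L F \<bullet> step b \<otimes>\<^sub>L F = min a b * (norm F)\<^sup>2" if "a \<ge> 0" "b \<ge> 0" for a b
    unfolding inner_fock_def i[OF that] by simp
  then show ?thesis
    using assms by (simp add: power2_norm_eq_inner inner_diff_left inner_diff_right min_def algebra_simps abs_if)
qed

section \<open>The toy Poisson process on the toy Fock space\<close>

text \<open>Each cell is a difference of two initial intervals, so the sum telescopes. The index
  \<open>K\<close> is included, which puts the endpoint at \<open>(K + 1) / n\<close>.\<close>

lemma step_eq_sum_toy_step:
  assumes n: "n \<ge> 1"
  shows "step ((real K + 1) / real n) = (\<lambda>x. (1 / sqrt n) * (\<Sum>i=0..K. toy_step n i x))"
proof
  fix x
  have c: "toy_step n i x = sqrt n * (step ((real i + 1) / real n) x - step (real i / real n) x)" for i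
  proof -
    have "real i / real n \<le> (real i + 1) / real n" "0 \<le> real i / real n"
      using n by (auto intro: divide_right_mono)
    moreover from this(2) have "real i / real n \<le> x \<longrightarrow> 0 \<le> x" by linarith
    ultimately show ?thesis by (auto simp: toy_step_def indicator_def)
  qed
  have "(\<Sum>i=0..K. toy_step n i x) = sqrt n * step ((real K + 1) / real n) x"
  proof (induction K)
    case 0
    show ?case unfolding c by simp
  next
    case (Suc K)
    then show ?case unfolding sum.atLeast0_atMost_Suc c by (simp add: algebra_simps)
  qed
  then show "step ((real K + 1) / real n) x = (1 / sqrt n) * (\<Sum>i=0..K. toy_step n i x)"
    using n by simp
qed

lemma step_tensor_left_eq_sum:
  assumes n: "n \<ge> 1"
  shows "step ((real K + 1) / real n) \<otimes>\<^sub>L F = (1 / sqrt n) *\<^sub>R (\<Sum>i=0..K. toy_step n i \<otimes>\<^sub>L F)"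
  unfolding step_eq_sum_toy_step[OF n] scaleR_fock_def
  using n by (simp only: tensor_left_scale_fun[OF tensor_left_sum_fun(1)] tensor_left_sum_fun(2) real_L2_toy_step)

lemma integral_step_toy_step:
  assumes n: "n \<ge> 1"
  shows "(\<integral>x. step ((real K + 1) / real n) x * toy_step n j x \<partial>half_line) = (if j \<le> K then 1 / sqrt n else 0)"
proof -
  have "(\<integral>x. step ((real K + 1) / real n) x * toy_step n j x \<partial>half_line)
      = (\<integral>x. (1 / sqrt n) * (\<Sum>i=0..K. toy_step n i x * toy_step n j x) \<partial>half_line)"
    unfolding step_eq_sum_toy_step[OF n] sum_distrib_right mult.assoc ..
  also have "\<dots> = (1 / sqrt n) * (\<Sum>i=0..K. if i = j then 1 else 0)"
    by (simp only: integral_mult_right_zero Bochner_Integration.integral_sum[OF integral_toy_step(1)[OF n]]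
        integral_toy_step(2)[OF n])
  finally show ?thesis by simp
qed

lemma step_mult_toy_step:
  assumes n: "n \<ge> 1"
  shows "(\<lambda>x. step ((real K + 1) / real n) x * toy_step n j x) = (if j \<le> K then toy_step n j else (\<lambda>x. 0))"
proof -
  have "(real j + 1) / real n \<le> (real K + 1) / real n" if "j \<le> K"
    using that by (intro divide_right_mono) auto
  moreover have "(real K + 1) / real n \<le> real j / real n" if "\<not> j \<le> K"
    using that by (intro divide_right_mono) auto
  moreover have "\<forall>x. real j / real n \<le> x \<longrightarrow> 0 \<le> x"
    by (auto intro: order_trans[of 0 "real j / real n"])
  ultimately show ?thesis by (auto simp: toy_step_def indicator_def fun_eq_iff)
qed

text \<open>The first letter is doubled, so the values are orthogonal to the toy Fock space. The
  operator is thus a contraction but does not belong to \<open>toy_bounded n\<close>.\<close>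

definition toy_diagonal :: "nat \<Rightarrow> nat \<Rightarrow> fock \<Rightarrow> fock" where
  "toy_diagonal n K = toy_op n (\<lambda>\<sigma>. case \<sigma> of
      [] \<Rightarrow> 0
    | j # _ \<Rightarrow> if j \<le> K then toy_vec n (j # \<sigma>) else 0)"

lemma orthogonal_family_toy_diagonal:
  "n \<ge> 1 \<Longrightarrow> orthogonal_family (\<lambda>\<sigma>. case \<sigma> of
      [] \<Rightarrow> 0
    | j # _ \<Rightarrow> if j \<le> K then toy_vec n (j # \<sigma>) else 0)"
  by (rule orthogonal_family_partial_toy_vec[where g = "\<lambda>\<sigma>. hd \<sigma> # \<sigma>" and Q = "\<lambda>\<sigma>. \<sigma> \<noteq> [] \<and> hd \<sigma> \<le> K"])
    (auto simp: inj_on_def split: list.splits)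

lemma bounded_clinear_toy_diagonal: "n \<ge> 1 \<Longrightarrow> bounded_clinear (toy_diagonal n K)"
  unfolding toy_diagonal_def by (intro bounded_clinear_toy_op orthogonal_family_toy_diagonal)

lemma norm_toy_diagonal_le: "n \<ge> 1 \<Longrightarrow> norm (toy_diagonal n K F) \<le> norm F"
  unfolding toy_diagonal_def by (intro norm_toy_op_le orthogonal_family_toy_diagonal)

text \<open>
  The words \<open>i\<sigma>\<close> that \<open>a\<^sub>i\<^sup>+\<close> suppresses because they are not adapted contribute only
  \<open>toy_diagonal n K / sqrt n\<close>.
\<close>

lemma sum_toy_plus:
  assumes n: "n \<ge> 1" and G: "G \<in> toy_fock n"
  shows "(1 / sqrt n) *\<^sub>R (\<Sum>i=0..K. toy_plus n i G)
    = step ((real K + 1) / real n) \<otimes>\<^sub>L G - (1 / sqrt n) *\<^sub>R toy_diagonal n K G"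
  using _ _ _ G
proof (rule bounded_clinear_eq_on_toy_fock)
  show "bounded_clinear (\<lambda>G. (1 / sqrt n) *\<^sub>R (\<Sum>i=0..K. toy_plus n i G))"
    by (intro bounded_clinear_scaleR bounded_clinear_sum toy_boundedD(1)[OF toy_plus_bounded] n)
  show "bounded_clinear (\<lambda>G. step ((real K + 1) / real n) \<otimes>\<^sub>L G - (1 / sqrt n) *\<^sub>R toy_diagonal n K G)"
    by (intro bounded_clinear_scaleR bounded_clinear_diff bounded_clinear_toy_diagonal
        bounded_clinear_tensor_left real_L2_step n)
  fix \<sigma> assume \<sigma>: "\<sigma> \<in> adapted"
  have "(\<Sum>i=0..K. toy_plus n i (toy_vec n \<sigma>))
      = (\<Sum>i=0..K. toy_step n i \<otimes>\<^sub>L toy_vec n \<sigma>) - toy_diagonal n K (toy_vec n \<sigma>)"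
  proof (cases \<sigma>)
    case Nil
    then show ?thesis
      unfolding toy_plus_def toy_diagonal_def toy_op_toy_vec[OF n \<sigma>] by simp
  next
    case (Cons j \<rho>)
    \<comment> \<open>Exactly one letter is forbidden, \<open>i = j\<close>, and it is met only if
      \<open>j\<close> is at most \<open>K\<close>.\<close>
    have "(\<Sum>i=0..K. toy_plus n i (toy_vec n \<sigma>))
        = (\<Sum>i=0..K. toy_vec n (i # \<sigma>) - (if i = j then toy_vec n (j # \<sigma>) else 0))"
      unfolding toy_plus_def toy_op_toy_vec[OF n \<sigma>] unfolding Cons by (intro sum.cong) auto
    also have "\<dots> = (\<Sum>i=0..K. toy_vec n (i # \<sigma>)) - (if j \<le> K then toy_vec n (j # \<sigma>) else 0)"
      by (simp add: sum_subtractf del: toy_vec.simps)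
    finally show ?thesis
      unfolding toy_diagonal_def toy_op_toy_vec[OF n \<sigma>] by (simp add: Cons)
  qed
  then show "(1 / sqrt n) *\<^sub>R (\<Sum>i=0..K. toy_plus n i (toy_vec n \<sigma>))
      = step ((real K + 1) / real n) \<otimes>\<^sub>L toy_vec n \<sigma> - (1 / sqrt n) *\<^sub>R toy_diagonal n K (toy_vec n \<sigma>)"
    unfolding step_tensor_left_eq_sum[OF n] by (simp only: scaleR_diff_right)
qed

text \<open>There is no error term: the step has scalar product \<open>1 / sqrt n\<close> with each
  of its cells, and deleting the first letter keeps a word adapted.\<close>

lemma sum_toy_minus:
  assumes n: "n \<ge> 1" and G: "G \<in> toy_fock n"
  shows "(1 / sqrt n) *\<^sub>R (\<Sum>i=0..K. toy_minus n i G) = annihilation (step ((real K + 1) / real n)) G"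
  using _ _ _ G
proof (rule bounded_clinear_eq_on_toy_fock)
  show "bounded_clinear (\<lambda>G. (1 / sqrt n) *\<^sub>R (\<Sum>i=0..K. toy_minus n i G))"
    by (intro bounded_clinear_scaleR bounded_clinear_sum toy_boundedD(1)[OF toy_minus_bounded] n)
  show "bounded_clinear (annihilation (step ((real K + 1) / real n)))"
    by (intro bounded_clinear_annihilation real_L2_step)
  fix \<sigma> assume \<sigma>: "\<sigma> \<in> adapted"
  show "(1 / sqrt n) *\<^sub>R (\<Sum>i=0..K. toy_minus n i (toy_vec n \<sigma>))
      = annihilation (step ((real K + 1) / real n)) (toy_vec n \<sigma>)"
    unfolding toy_minus_def toy_op_toy_vec[OF n \<sigma>]
  proof (cases \<sigma>)
    case (Cons j \<rho>)
    show "(1 / sqrt n) *\<^sub>R (\<Sum>i=0..K. case \<sigma> of [] \<Rightarrow> 0 | j # \<rho> \<Rightarrow> if j = i then toy_vec n \<rho> else 0)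
        = annihilation (step ((real K + 1) / real n)) (toy_vec n \<sigma>)"
      unfolding Cons toy_vec.simps annihilation_tensor_left[OF real_L2_step real_L2_toy_step[OF n]]
        integral_step_toy_step[OF n] by (simp add: scaleR_fock_def)
  qed (simp add: annihilation_vacuum real_L2_step)
qed

lemma gauge_op_step_toy_vec:
  assumes n: "n \<ge> 1"
  shows "gauge_op (step ((real K + 1) / real n)) (toy_vec n (j # \<rho>)) = (if j \<le> K then toy_vec n (j # \<rho>) else 0)"
  using gauge_op_step_tensor_left[OF real_L2_toy_step[OF n, of j], of "(real K + 1) / real n"]
  unfolding step_mult_toy_step[OF n] by (simp add: tensor_left_zero_fun real_L2_zero real_L2_toy_step[OF n])

text \<open>The step is constant on every cell, so its gauge operator is diagonal in the basis and
  agrees with the discrete sum exactly.\<close>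

lemma sum_toy_circ:
  assumes n: "n \<ge> 1" and G: "G \<in> toy_fock n"
  shows "(\<Sum>i=0..K. toy_circ n i G) = gauge_op (step ((real K + 1) / real n)) G"
  using _ _ _ G
proof (rule bounded_clinear_eq_on_toy_fock)
  show "bounded_clinear (\<lambda>G. \<Sum>i=0..K. toy_circ n i G)"
    by (intro bounded_clinear_sum toy_boundedD(1)[OF toy_circ_bounded] n)
  show "bounded_clinear (gauge_op (step ((real K + 1) / real n)))"
    by (rule bounded_clinear_gauge_op_step)
  fix \<sigma> assume \<sigma>: "\<sigma> \<in> adapted"
  show "(\<Sum>i=0..K. toy_circ n i (toy_vec n \<sigma>)) = gauge_op (step ((real K + 1) / real n)) (toy_vec n \<sigma>)"
  proof (cases \<sigma>)
    case Nil
    show ?thesis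
      unfolding toy_circ_def toy_op_toy_vec[OF n \<sigma>] unfolding Nil by (simp add: gauge_op_step_vacuum)
  next
    case (Cons j \<rho>)
    show ?thesis
      unfolding toy_circ_def toy_op_toy_vec[OF n \<sigma>] unfolding Cons gauge_op_step_toy_vec[OF n]
      by (simp del: toy_vec.simps)
  qed
qed

text \<open>On the toy space the two operators are complementary projections; summing over
  \<open>i\<close> thus turns the time part into a multiple of the identity minus a gauge
  term.\<close>

lemma toy_times_eq:
  assumes n: "n \<ge> 1" and G: "G \<in> toy_fock n"
  shows "toy_times n i G = G - toy_circ n i G"
  using _ _ _ G
proof (rule bounded_clinear_eq_on_toy_fock)
  show "bounded_clinear (toy_times n i)" by (intro toy_boundedD(1)[OF toy_times_bounded] n)
  show "bounded_clinear (\<lambda>G. G - toy_circ n i G)"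
    by (intro bounded_clinear_diff bounded_clinear_ident toy_boundedD(1)[OF toy_circ_bounded] n)
  fix \<sigma> assume \<sigma>: "\<sigma> \<in> adapted"
  show "toy_times n i (toy_vec n \<sigma>) = toy_vec n \<sigma> - toy_circ n i (toy_vec n \<sigma>)"
    unfolding toy_times_def toy_circ_def toy_op_toy_vec[OF n \<sigma>] by (auto split: list.splits)
qed

text \<open>The creation sum is left in discrete form because \<open>toy_plus_limit\<close> treats
  it separately; that limit also drives the convergence of the projections.\<close>

lemma toy_poisson_eq:
  fixes F :: fock
  assumes n: "n \<ge> 1" and K: "K = nat \<lfloor>real n * t\<rfloor>"
  defines "c \<equiv> (real K + 1) / real n" and "G \<equiv> toy_unit n F"
  shows "toy_poisson n t F = (1 / sqrt n) *\<^sub>R (\<Sum>i=0..K. toy_plus n i G) + annihilation (step c) G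
    + gauge_op (step c) G + (c *\<^sub>R G - (1 / real n) *\<^sub>R gauge_op (step c) G)"
proof -
  have G: "G \<in> toy_fock n"
    unfolding G_def by (rule toy_boundedD(2)[OF toy_unit_bounded[OF n]])
  have s: "1 / sqrt n * sqrt n = 1" "1 / sqrt n * (1 / sqrt n) = 1 / real n" using n by auto
  have times: "(1 / real n) *\<^sub>R (\<Sum>i=0..K. toy_times n i G) = c *\<^sub>R G - (1 / real n) *\<^sub>R gauge_op (step c) G"
  proof -
    \<comment> \<open>The identity occurs once for each of the \<open>Suc K\<close> indices, and
      division by \<open>n\<close> turns this number into \<open>c\<close>.\<close>
    have "(\<Sum>i=0..K. toy_times n i G) = real (Suc K) *\<^sub>R G - gauge_op (step c) G"
      unfolding c_def sum_toy_circ[OF n G, symmetric] toy_times_eq[OF n G] sum_subtractf sum_constant_scaleR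
      by simp
    then show ?thesis by (simp add: c_def scaleR_diff_right add.commute)
  qed
  have "toy_poisson n t F = (1 / sqrt n) *\<^sub>R (\<Sum>i=0..K. toy_Y n i G)"
    unfolding toy_poisson_def K G_def toy_bounded_toy_unit[OF n toy_Y_bounded[OF n]] ..
  also have "(\<Sum>i=0..K. toy_Y n i G) = (\<Sum>i=0..K. toy_plus n i G) + (\<Sum>i=0..K. toy_minus n i G)
      + sqrt n *\<^sub>R (\<Sum>i=0..K. toy_circ n i G) + (1 / sqrt n) *\<^sub>R (\<Sum>i=0..K. toy_times n i G)"
    unfolding toy_Y_def sum.distrib scaleR_sum_right ..
  also have "(1 / sqrt n) *\<^sub>R \<dots> = (1 / sqrt n) *\<^sub>R (\<Sum>i=0..K. toy_plus n i G)
      + (1 / sqrt n) *\<^sub>R (\<Sum>i=0..K. toy_minus n i G)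
      + (\<Sum>i=0..K. toy_circ n i G) + (1 / real n) *\<^sub>R (\<Sum>i=0..K. toy_times n i G)"
    unfolding scaleR_add_right scaleR_scaleR s by simp
  also have "\<dots> = (1 / sqrt n) *\<^sub>R (\<Sum>i=0..K. toy_plus n i G) + annihilation (step c) G
    + gauge_op (step c) G + (c *\<^sub>R G - (1 / real n) *\<^sub>R gauge_op (step c) G)"
    unfolding sum_toy_minus[OF n G] sum_toy_circ[OF n G] times c_def[symmetric] ..
  finally show ?thesis .
qed

section \<open>Strong convergence\<close>

text \<open>The bound \<open>C\<close> is uniform in \<open>k\<close>, so replacing \<open>L\<close>
  by a nearby \<open>X j\<close> costs little for all \<open>k\<close> simultaneously.\<close>

lemma closed_strong_limit:
  assumes T: "\<And>k::nat. bounded_clinear (T k)" "\<And>k F. norm (T k F) \<le> C * norm F"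
    and S: "bounded_clinear S"
  shows "closed {F. (\<lambda>k. T k F) \<longlonglongrightarrow> S F}"
  unfolding closed_sequential_limits
proof (intro allI impI, elim conjE)
  fix X L assume X: "\<forall>j. X j \<in> {F. (\<lambda>k. T k F) \<longlonglongrightarrow> S F}" "X \<longlonglongrightarrow> L"
  obtain B where B: "B > 0" "\<And>F. norm (S F) \<le> norm F * B"
    using bounded_linear.pos_bounded[OF bounded_clinearD(1)[OF S]] by blast
  have "(\<lambda>k. T k L) \<longlonglongrightarrow> S L"
  proof (rule LIMSEQ_I)
    fix e :: real assume e: "e > 0"
    \<comment> \<open>The modulus of \<open>C\<close> keeps \<open>D\<close> positive whatever the
      sign of \<open>C\<close>; \<open>D\<close> times the distance bounds the replacement error for
      \<open>T k\<close> and \<open>S\<close> together.\<close>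
    define D where "D = \<bar>C\<bar> + B"
    have D: "D > 0" using B by (simp add: D_def)
    then have "e / (2 * D) > 0" using e by simp
    from LIMSEQ_D[OF X(2) this] obtain j where j: "norm (X j - L) < e / (2 * D)" by blast
    have "(\<lambda>k. T k (X j)) \<longlonglongrightarrow> S (X j)" using X(1) by blast
    from LIMSEQ_D[OF this, of "e / 2"] e obtain N where
      N: "\<And>k. k \<ge> N \<Longrightarrow> norm (T k (X j) - S (X j)) < e / 2" by auto
    have "norm (T k L - S L) < e" if "k \<ge> N" for k
    proof -
      have "norm (T k (X j - L) - S (X j - L)) \<le> norm (T k (X j - L)) + norm (S (X j - L))"
        by (rule norm_triangle_ineq4)
      also have "\<dots> \<le> \<bar>C\<bar> * norm (X j - L) + norm (X j - L) * B"
        by (intro add_mono B order_trans[OF T(2)] mult_right_mono) auto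
      also have "\<dots> = D * norm (X j - L)" by (simp add: D_def algebra_simps)
      also have "\<dots> < e / 2" using j D by (simp add: field_simps)
      finally have "norm (T k (X j - L) - S (X j - L)) < e / 2" .
      moreover have "T k L - S L = (T k (X j) - S (X j)) - (T k (X j - L) - S (X j - L))"
        using T(1)[of k] S by (simp add: bounded_clinearD)
      ultimately show ?thesis
        using N[OF that] norm_triangle_ineq4[of "T k (X j) - S (X j)" "T k (X j - L) - S (X j - L)"]
        by simp
    qed
    then show "\<exists>N. \<forall>k\<ge>N. norm (T k L - S L) < e" by blast
  qed
  then show "L \<in> {F. (\<lambda>k. T k F) \<longlonglongrightarrow> S F}" by simp
qed

text \<open>The tensor premise may use the limit at \<open>F\<close> as induction hypothesis;
  \<open>toy_unit_tendsto\<close> depends on it.\<close>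

lemma strong_limit_dense:
  assumes T: "\<And>k::nat. bounded_clinear (T k)" "\<And>k F. norm (T k F) \<le> C * norm F"
    and S: "bounded_clinear S" and vacuum: "(\<lambda>k. T k \<Omega>) \<longlonglongrightarrow> S \<Omega>"
    and tensor: "\<And>s F. s \<ge> 0 \<Longrightarrow> (\<lambda>k. T k F) \<longlonglongrightarrow> S F \<Longrightarrow>
      (\<lambda>k. T k (step s \<otimes>\<^sub>L F)) \<longlonglongrightarrow> S (step s \<otimes>\<^sub>L F)"
  shows "(\<lambda>k. T k F) \<longlonglongrightarrow> S F"
proof (rule step_tensors_dense[where P = "\<lambda>F. (\<lambda>k. T k F) \<longlonglongrightarrow> S F"])
  show "closed {F. (\<lambda>k. T k F) \<longlonglongrightarrow> S F}" by (rule closed_strong_limit[OF T S])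
  show "(\<lambda>k. T k (F + G)) \<longlonglongrightarrow> S (F + G)" if "(\<lambda>k. T k F) \<longlonglongrightarrow> S F" "(\<lambda>k. T k G) \<longlonglongrightarrow> S G" for F G
    unfolding bounded_clinearD(3)[OF T(1)] bounded_clinearD(3)[OF S] by (intro tendsto_add that)
  show "(\<lambda>k. T k (c *\<^sub>C F)) \<longlonglongrightarrow> S (c *\<^sub>C F)" if "(\<lambda>k. T k F) \<longlonglongrightarrow> S F" for c F
    unfolding bounded_clinearD(2)[OF T(1)] bounded_clinearD(2)[OF S]
    by (rule bounded_linear.tendsto[OF bounded_linear_scale_fock that])
qed (fact vacuum tensor)+

text \<open>The operator and its argument move together; the uniform bound makes the change of
  argument negligible.\<close>

lemma strong_limit_compose:
  assumes T: "\<And>k::nat. bounded_clinear (T k)" "\<And>k F. norm (T k F) \<le> C * norm F"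
    and F: "(\<lambda>k. T k F) \<longlonglongrightarrow> L" and G: "G \<longlonglongrightarrow> F"
  shows "(\<lambda>k. T k (G k)) \<longlonglongrightarrow> L"
proof -
  have "(\<lambda>k. C * norm (G k - F)) \<longlonglongrightarrow> C * 0"
    by (intro tendsto_mult tendsto_const tendsto_norm_zero LIM_zero G)
  then have lim: "(\<lambda>k. C * norm (G k - F)) \<longlonglongrightarrow> 0" by simp
  have "(\<lambda>k. T k (G k - F)) \<longlonglongrightarrow> 0"
    by (rule Lim_null_comparison[OF _ lim]) (use T(2) in auto)
  from tendsto_add[OF F this] show ?thesis
    using T(1) by (simp add: bounded_clinearD(4))
qed

lemma step_tensor_limit:
  assumes c: "c \<longlonglongrightarrow> t" "\<And>k. 0 \<le> c k" "\<And>k. c k \<le> B" and t: "t \<ge> 0" and G: "G \<longlonglongrightarrow> F"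
  shows "(\<lambda>k. step (c k) \<otimes>\<^sub>L G k) \<longlonglongrightarrow> step t \<otimes>\<^sub>L F"
proof (rule strong_limit_compose[OF _ _ _ G])
  show "bounded_clinear (\<lambda>F. step (c k) \<otimes>\<^sub>L F)" for k
    by (intro bounded_clinear_tensor_left real_L2_step)
  show "norm (step (c k) \<otimes>\<^sub>L F) \<le> sqrt B * norm F" for k F
  proof -
    have "(norm (step (c k) \<otimes>\<^sub>L F))\<^sup>2 = c k * (norm F)\<^sup>2"
      unfolding norm_tensor_left_square[OF real_L2_step] step_mult_step min.idem integral_step[OF c(2)] ..
    also have "\<dots> \<le> B * (norm F)\<^sup>2" by (intro mult_right_mono c) simp
    finally have "norm (step (c k) \<otimes>\<^sub>L F) \<le> sqrt (B * (norm F)\<^sup>2)" by (rule real_le_rsqrt)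
    then show ?thesis by (simp add: real_sqrt_mult)
  qed
  show "(\<lambda>k. step (c k) \<otimes>\<^sub>L F) \<longlonglongrightarrow> step t \<otimes>\<^sub>L F"
  proof (rule LIMSEQ_if_norm_diff_square)
    have "(\<lambda>k. \<bar>c k - t\<bar> * (norm F)\<^sup>2) \<longlonglongrightarrow> \<bar>t - t\<bar> * (norm F)\<^sup>2" by (intro tendsto_intros c)
    then show "(\<lambda>k. (norm (step (c k) \<otimes>\<^sub>L F - step t \<otimes>\<^sub>L F))\<^sup>2) \<longlonglongrightarrow> 0"
      unfolding norm_step_tensor_diff_square[OF c(2) t] by simp
  qed
qed

text \<open>On \<open>step s \<otimes>\<^sub>L F\<close> the gauge operator merely shortens the step
  to \<open>min a s\<close>, so the claim there is continuity of the step in its endpoint.\<close>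

lemma gauge_op_step_limit:
  assumes c: "c \<longlonglongrightarrow> t" "\<And>k. 0 \<le> c k" and t: "t \<ge> 0" and G: "G \<longlonglongrightarrow> F"
  shows "(\<lambda>k. gauge_op (step (c k)) (G k)) \<longlonglongrightarrow> gauge_op (step t) F"
proof (rule strong_limit_compose[OF bounded_clinear_gauge_op_step _ _ G])
  show bound: "norm (gauge_op (step (c k)) F) \<le> 1 * norm F" for k F
    using norm_gauge_op_step_le by simp
  show "(\<lambda>k. gauge_op (step (c k)) F) \<longlonglongrightarrow> gauge_op (step t) F"
  proof (rule strong_limit_dense[OF bounded_clinear_gauge_op_step bound bounded_clinear_gauge_op_step])
    show "(\<lambda>k. gauge_op (step (c k)) \<Omega>) \<longlonglongrightarrow> gauge_op (step t) \<Omega>"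
      by (simp add: gauge_op_step_vacuum)
    fix s :: real and F assume s: "s \<ge> 0"
    have eq: "gauge_op (step a) (step s \<otimes>\<^sub>L F) = step (min a s) \<otimes>\<^sub>L F" for a
      using gauge_op_step_tensor_left[OF real_L2_step, of a s F] real_L2_step[of "min a s"]
      unfolding step_mult_step by simp
    show "(\<lambda>k. gauge_op (step (c k)) (step s \<otimes>\<^sub>L F)) \<longlonglongrightarrow> gauge_op (step t) (step s \<otimes>\<^sub>L F)"
      unfolding eq
      by (rule step_tensor_limit[where B = s]) (use c s t in \<open>auto intro: tendsto_min\<close>)
  qed
qed

text \<open>On \<open>step s \<otimes>\<^sub>L F\<close> annihilation leaves the scalar
  \<open>min a s\<close>, which is continuous in \<open>a\<close>.\<close>

lemma annihilation_step_limit: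
  assumes c: "c \<longlonglongrightarrow> t" "\<And>k. 0 \<le> c k" "\<And>k. c k \<le> B" and t: "t \<ge> 0" and G: "G \<longlonglongrightarrow> F"
  shows "(\<lambda>k. annihilation (step (c k)) (G k)) \<longlonglongrightarrow> annihilation (step t) F"
proof (rule strong_limit_compose[OF bounded_clinear_annihilation[OF real_L2_step] _ _ G])
  show bound: "norm (annihilation (step (c k)) F) \<le> sqrt (1 + B) * norm F" for k F
  proof -
    have "(\<integral>x. (step (c k) x)\<^sup>2 \<partial>half_line) = c k"
      unfolding power2_eq_square step_mult_step min.idem integral_step[OF c(2)] ..
    then have "norm (annihilation (step (c k)) F) \<le> sqrt (1 + c k) * norm F"
      using norm_annihilation_le[OF real_L2_step, of "c k" F] by simp
    also have "\<dots> \<le> sqrt (1 + B) * norm F" using c(3) by (intro mult_right_mono) auto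
    finally show ?thesis .
  qed
  note bc = bounded_clinear_annihilation[OF real_L2_step]
  show "(\<lambda>k. annihilation (step (c k)) F) \<longlonglongrightarrow> annihilation (step t) F"
  proof (rule strong_limit_dense[OF bc bound bc])
    show "(\<lambda>k. annihilation (step (c k)) \<Omega>) \<longlonglongrightarrow> annihilation (step t) \<Omega>"
      by (simp add: annihilation_vacuum real_L2_step)
    fix s :: real and F assume s: "s \<ge> 0"
    have eq: "annihilation (step a) (step s \<otimes>\<^sub>L F) = min a s *\<^sub>R F" if "a \<ge> 0" for a
    proof -
      have "min a s \<ge> 0" using that s by simp
      then show ?thesis
        unfolding annihilation_tensor_left[OF real_L2_step real_L2_step] step_mult_step scaleR_fock_def
        by (simp only: integral_step)
    qed
    show "(\<lambda>k. annihilation (step (c k)) (step s \<otimes>\<^sub>L F)) \<longlonglongrightarrow> annihilation (step t) (step s \<otimes>\<^sub>L F)"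
      unfolding eq[OF c(2)] eq[OF t] by (intro tendsto_intros c)
  qed
qed

text \<open>This is the endpoint \<open>c\<close> belonging to \<open>n = Suc k\<close>; the shift
  keeps the number of cells per unit of time positive.\<close>

definition grid :: "real \<Rightarrow> nat \<Rightarrow> real" where
  "grid t k = (real (nat \<lfloor>real (Suc k) * t\<rfloor>) + 1) / real (Suc k)"

lemma grid_bounds:
  assumes "t \<ge> 0"
  shows "t \<le> grid t k" "grid t k \<le> t + 1 / real (Suc k)"
proof -
  have "0 \<le> real (Suc k) * t" using assms by simp
  then have f: "real (nat \<lfloor>real (Suc k) * t\<rfloor>) = of_int \<lfloor>real (Suc k) * t\<rfloor>"
    by (intro of_nat_nat) (simp add: zero_le_floor)
  have "real (Suc k) * t \<le> real (nat \<lfloor>real (Suc k) * t\<rfloor>) + 1" unfolding f by linarith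
  then show "t \<le> grid t k" unfolding grid_def by (simp add: field_simps)
  have "real (nat \<lfloor>real (Suc k) * t\<rfloor>) \<le> real (Suc k) * t" unfolding f by linarith
  then have "grid t k \<le> (real (Suc k) * t + 1) / real (Suc k)"
    unfolding grid_def by (intro divide_right_mono) auto
  also have "\<dots> = t + 1 / real (Suc k)" by (simp add: field_simps)
  finally show "grid t k \<le> t + 1 / real (Suc k)" .
qed

lemma grid_tendsto:
  assumes "t \<ge> 0"
  shows "grid t \<longlonglongrightarrow> t"
proof (rule tendsto_sandwich)
  show "\<forall>\<^sub>F k in sequentially. t \<le> grid t k" "\<forall>\<^sub>F k in sequentially. grid t k \<le> t + 1 / real (Suc k)"
    using grid_bounds[OF assms] by simp_all
  have "(\<lambda>k. t + 1 / real (Suc k)) \<longlonglongrightarrow> t + 0"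
    by (intro tendsto_intros LIMSEQ_Suc[OF lim_1_over_n])
  then show "(\<lambda>k. t + 1 / real (Suc k)) \<longlonglongrightarrow> t" by simp
qed simp

lemma grid_nonneg_le: "t \<ge> 0 \<Longrightarrow> 0 \<le> grid t k" "t \<ge> 0 \<Longrightarrow> grid t k \<le> t + 1"
proof -
  have "1 / real (Suc k) \<le> 1" by simp
  then show "t \<ge> 0 \<Longrightarrow> 0 \<le> grid t k" "t \<ge> 0 \<Longrightarrow> grid t k \<le> t + 1"
    using grid_bounds[of t k] by linarith+
qed

text \<open>The argument varies with \<open>k\<close> so that the projections of a fixed vector can
  be inserted.\<close>

lemma toy_plus_limit:
  assumes G: "\<And>k. G k \<in> toy_fock (Suc k)" "G \<longlonglongrightarrow> F" and t: "t \<ge> 0"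
  shows "(\<lambda>k. (1 / sqrt (Suc k)) *\<^sub>R (\<Sum>i = 0..nat \<lfloor>real (Suc k) * t\<rfloor>. toy_plus (Suc k) i (G k)))
    \<longlonglongrightarrow> step t \<otimes>\<^sub>L F"
proof -
  have Suc: "Suc k \<ge> 1" for k by simp
  let ?R = "\<lambda>k. toy_diagonal (Suc k) (nat \<lfloor>real (Suc k) * t\<rfloor>) (G k)"
  have 0: "(\<lambda>k. 1 / sqrt (real (Suc k))) \<longlonglongrightarrow> 0"
    using tendsto_real_sqrt[OF LIMSEQ_Suc[OF lim_1_over_n]] by (simp add: real_sqrt_divide del: of_nat_Suc)
  have "(\<lambda>k. (1 / sqrt (real (Suc k))) * norm (G k)) \<longlonglongrightarrow> 0 * norm F"
    by (intro tendsto_mult tendsto_norm 0 G(2))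
  then have lim: "(\<lambda>k. (1 / sqrt (real (Suc k))) * norm (G k)) \<longlonglongrightarrow> 0" by simp
  have "(\<lambda>k. (1 / sqrt (real (Suc k))) *\<^sub>R ?R k) \<longlonglongrightarrow> 0"
  proof (rule Lim_null_comparison[OF _ lim], rule always_eventually, rule allI)
    fix k
    show "norm ((1 / sqrt (real (Suc k))) *\<^sub>R ?R k) \<le> (1 / sqrt (real (Suc k))) * norm (G k)"
      using norm_toy_diagonal_le[OF Suc] unfolding norm_scaleR by (intro mult_mono) auto
  qed
  moreover have "(\<lambda>k. step (grid t k) \<otimes>\<^sub>L G k) \<longlonglongrightarrow> step t \<otimes>\<^sub>L F"
    using grid_tendsto[OF t] grid_nonneg_le[OF t] t G(2) by (rule step_tensor_limit)
  ultimately have "(\<lambda>k. step (grid t k) \<otimes>\<^sub>L G k - (1 / sqrt (real (Suc k))) *\<^sub>R ?R k) \<longlonglongrightarrow> step t \<otimes>\<^sub>L F - 0"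
    by (intro tendsto_diff)
  then show ?thesis unfolding sum_toy_plus[OF Suc G(1)] grid_def by simp
qed

lemma toy_unit_tendsto: "(\<lambda>k. toy_unit (Suc k) F) \<longlonglongrightarrow> F"
proof (rule strong_limit_dense[where C = 1, OF _ _ bounded_clinear_ident])
  have Suc: "Suc k \<ge> 1" for k by simp
  show bc: "bounded_clinear (toy_unit (Suc k))" for k
    by (rule toy_boundedD(1)[OF toy_unit_bounded[OF Suc]])
  show le: "norm (toy_unit (Suc k) F) \<le> 1 * norm F" for k F
    using norm_toy_unit_le[OF Suc] by simp
  show "(\<lambda>k. toy_unit (Suc k) \<Omega>) \<longlonglongrightarrow> \<Omega>"
    using toy_unit_toy_vec[OF Suc, of "[]"] by simp
  fix s :: real and F assume s: "s \<ge> 0" and F: "(\<lambda>k. toy_unit (Suc k) F) \<longlonglongrightarrow> F"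
  \<comment> \<open>\<open>?V k\<close> lies in the toy Fock space and approximates \<open>step s \<otimes>\<^sub>L F\<close>, so the projection must converge.\<close>
  let ?V = "\<lambda>k. (1 / sqrt (Suc k)) *\<^sub>R
    (\<Sum>i = 0..nat \<lfloor>real (Suc k) * s\<rfloor>. toy_plus (Suc k) i (toy_unit (Suc k) F))"
  have V: "?V \<longlonglongrightarrow> step s \<otimes>\<^sub>L F"
    by (rule toy_plus_limit[OF toy_boundedD(2)[OF toy_unit_bounded[OF Suc]] F s])
  have V_toy: "toy_unit (Suc k) (?V k) = ?V k" for k
    by (intro toy_unit_toy_fock[OF Suc] toy_fock_scaleR toy_fock_sum toy_boundedD(2)[OF toy_plus_bounded[OF Suc]])
  \<comment> \<open>The projections are contractions for every \<open>k\<close>, so it suffices that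
    the argument tends to 0.\<close>
  have "(\<lambda>k. toy_unit (Suc k) (step s \<otimes>\<^sub>L F - ?V k)) \<longlonglongrightarrow> 0"
  proof (rule strong_limit_compose[where T = "\<lambda>k. toy_unit (Suc k)", OF bc le])
    show "(\<lambda>k. toy_unit (Suc k) 0) \<longlonglongrightarrow> 0" by (simp add: bounded_clinearD(5)[OF bc])
    show "(\<lambda>k. step s \<otimes>\<^sub>L F - ?V k) \<longlonglongrightarrow> 0"
      using tendsto_diff[OF tendsto_const V, of "step s \<otimes>\<^sub>L F"] by simp
  qed
  from tendsto_add[OF this V] show "(\<lambda>k. toy_unit (Suc k) (step s \<otimes>\<^sub>L F)) \<longlonglongrightarrow> step s \<otimes>\<^sub>L F"
    unfolding bounded_clinearD(4)[OF bc] V_toy by simp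
qed

lemma toy_poisson_tendsto:
  assumes t: "t \<ge> 0"
  shows "(\<lambda>n. toy_poisson n t F) \<longlonglongrightarrow> free_poisson t F"
\<comment> \<open>Shifting the index discards \<open>n = 0\<close>, where the cells are
  degenerate.\<close>
proof (rule LIMSEQ_imp_Suc)
  have Suc: "Suc k \<ge> 1" for k by simp
  let ?G = "\<lambda>k. toy_unit (Suc k) F"
  have G: "?G \<longlonglongrightarrow> F" by (rule toy_unit_tendsto)
  have G_toy: "?G k \<in> toy_fock (Suc k)" for k
    by (rule toy_boundedD(2)[OF toy_unit_bounded[OF Suc]])
  note c = grid_tendsto[OF t] grid_nonneg_le[OF t]
  have gauge: "(\<lambda>k. gauge_op (step (grid t k)) (?G k)) \<longlonglongrightarrow> gauge_op (step t) F"
    by (rule gauge_op_step_limit[OF c(1,2) t G])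
  have ann: "(\<lambda>k. annihilation (step (grid t k)) (?G k)) \<longlonglongrightarrow> annihilation (step t) F"
    by (rule annihilation_step_limit[OF c t G])
  \<comment> \<open>The limit keeps the vanishing gauge correction of the time part as
    \<open>0 *\<^sub>R gauge_op (step t) F\<close>, so that the limits can be combined term by
    term.\<close>
  have "(\<lambda>k. (1 / sqrt (Suc k)) *\<^sub>R (\<Sum>i = 0..nat \<lfloor>real (Suc k) * t\<rfloor>. toy_plus (Suc k) i (?G k))
      + annihilation (step (grid t k)) (?G k) + gauge_op (step (grid t k)) (?G k)
      + (grid t k *\<^sub>R ?G k - (1 / real (Suc k)) *\<^sub>R gauge_op (step (grid t k)) (?G k)))
    \<longlonglongrightarrow> step t \<otimes>\<^sub>L F + annihilation (step t) F + gauge_op (step t) F + (t *\<^sub>R F - 0 *\<^sub>R gauge_op (step t) F)"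
    by (intro tendsto_add tendsto_diff tendsto_scaleR toy_plus_limit ann gauge G G_toy t c(1)
        LIMSEQ_Suc[OF lim_1_over_n])
  moreover have "free_poisson t F
      = step t \<otimes>\<^sub>L F + annihilation (step t) F + gauge_op (step t) F + (t *\<^sub>R F - 0 *\<^sub>R gauge_op (step t) F)"
    unfolding free_poisson_def Let_def creation_def time_op_def integral_step[OF t] scaleR_fock_def by simp
  ultimately show "(\<lambda>k. toy_poisson (Suc k) t F) \<longlonglongrightarrow> free_poisson t F"
    unfolding toy_poisson_eq[OF Suc refl] grid_def by simp
qed

theorem proposition5:
  shows "(\<forall>n\<ge>1.
      (\<forall>i. has_distribution n (toy_Y n i)
         (two_point_law (1 / (real n + 1)) ((real n + 1) / sqrt (real n)) 0)) \<and>
      free_random_variables n (toy_Y n) UNIV) \<and>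
    (\<forall>t\<ge>0. \<forall>F. (\<lambda>n. toy_poisson n t F) \<longlonglongrightarrow> free_poisson t F)"
  using has_distribution_toy_Y free_random_variables_toy_Y toy_poisson_tendsto by blast

end
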